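(* Let $\nu$ be the standard normal distribution and let $\{S_n(t)\}_{n\ge1,\,t\ge0}$ be the dynamical walk with increment distribution $\nu$. Then for every non-empty non-random Borel set $E\subseteq[0,1]$, almost surely, $$\sup_{t\in E}\ \limsup_{n\to\infty}\ \frac{(S_n(t))^2-2n\ln\ln n}{n\ln\ln\ln n}=3+2\dim_{\mathscr P}E,$$ where $\dim_{\mathscr P}$ denotes packing dimension.
   Context: Dynamical walk: let $\{\xi_n^k\}_{n\ge1,k\ge0}$ be i.i.d. real random variables with law $\nu$, and let $\{\mathscr C_n\}_{n\ge1}$ be independent rate-one Poisson clocks (Poisson processes), independent of the $\xi$'s, the jump times of $\mathscr C_n$ being $0=\tau_n(0)<\tau_n(1)<\tau_n(2)<\cdots$. Put $X_n(t)=\xi_n^k$ if $\tau_n(k)\le t<\tau_n(k+1)$, and $S_n(t)=X_1(t)+\cdots+X_n(t)$ for $t\ge0$, $n\ge1$. *)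

theory Defs
  imports "HOL-Probability.Probability"
begin

section \<open>The dynamical walk\<close>

text \<open>
  \<open>\<xi> n k\<close> are the replacement variables and \<open>\<tau> n k\<close> the jump times of the \<open>n\<close>-th clock, used
  for \<open>n \<ge> 1\<close> and \<open>k \<ge> 0\<close> only.  A rate-one Poisson process is given by its independent,
  rate-one exponential holding times.  Independence of the clocks from each other and from the
  \<open>\<xi> n k\<close> is expressed, together with the independence inside each family, by mutual independence
  of all holding times and all \<open>\<xi> n k\<close>.
\<close>

locale dynamical_walk = prob_space M for M :: "'w measure" +
  fixes \<nu> :: "real measure"
    and \<xi> :: "nat \<Rightarrow> nat \<Rightarrow> 'w \<Rightarrow> real"
    and \<tau> :: "nat \<Rightarrow> nat \<Rightarrow> 'w \<Rightarrow> real"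
  assumes indep:
      "indep_vars (\<lambda>_. borel)
         (case_sum (\<lambda>(n, k). \<xi> n k) (\<lambda>(n, k) \<omega>. \<tau> n (Suc k) \<omega> - \<tau> n k \<omega>))
         (({1..} \<times> UNIV) <+> ({1..} \<times> UNIV))"
    and law_increments: "\<And>n k. n \<ge> 1 \<Longrightarrow> distr M borel (\<xi> n k) = \<nu>"
    and law_holding_times:
      "\<And>n k. n \<ge> 1 \<Longrightarrow>
         distributed M lborel (\<lambda>\<omega>. \<tau> n (Suc k) \<omega> - \<tau> n k \<omega>) (exponential_density 1)"
    and clock_start: "\<And>n \<omega>. n \<ge> 1 \<Longrightarrow> \<omega> \<in> space M \<Longrightarrow> \<tau> n 0 \<omega> = 0"
    and clock_strict_mono: "\<And>n \<omega>. n \<ge> 1 \<Longrightarrow> \<omega> \<in> space M \<Longrightarrow> strict_mono (\<lambda>k. \<tau> n k \<omega>)"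

text \<open>
  For strictly increasing clocks there is at most one suitable \<open>k\<close>, and almost surely there is one
  for every \<open>t \<ge> 0\<close>; on the null set where a clock explodes the value is arbitrary.
\<close>

definition dyn_increment ::
  "(nat \<Rightarrow> nat \<Rightarrow> 'w \<Rightarrow> real) \<Rightarrow> (nat \<Rightarrow> nat \<Rightarrow> 'w \<Rightarrow> real) \<Rightarrow> nat \<Rightarrow> real \<Rightarrow> 'w \<Rightarrow> real" where
  "dyn_increment \<xi> \<tau> n t \<omega> = \<xi> n (THE k. \<tau> n k \<omega> \<le> t \<and> t < \<tau> n (Suc k) \<omega>) \<omega>"

definition dyn_walk ::
  "(nat \<Rightarrow> nat \<Rightarrow> 'w \<Rightarrow> real) \<Rightarrow> (nat \<Rightarrow> nat \<Rightarrow> 'w \<Rightarrow> real) \<Rightarrow> nat \<Rightarrow> real \<Rightarrow> 'w \<Rightarrow> real" where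
  "dyn_walk \<xi> \<tau> n t \<omega> = (\<Sum>i=1..n. dyn_increment \<xi> \<tau> i t \<omega>)"

section \<open>Packing dimension\<close>

text \<open>
  A \<open>\<delta>\<close>-packing of \<open>F\<close> is a countable set of centre-radius pairs whose closed balls are pairwise
  disjoint, are centred in \<open>F\<close>, and have diameter \<open>2 * r \<le> \<delta>\<close>.
\<close>

definition packings :: "real \<Rightarrow> 'a::euclidean_space set \<Rightarrow> ('a \<times> real) set set" where
  "packings \<delta> F = {P. countable P \<and> (\<forall>(x, r)\<in>P. x \<in> F \<and> 0 < r \<and> 2 * r \<le> \<delta>) \<and>
     disjoint_family_on (\<lambda>(x, r). cball x r) P}"

definition packing_premeasure :: "real \<Rightarrow> 'a::euclidean_space set \<Rightarrow> ennreal" where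
  "packing_premeasure s F =
     (INF \<delta>\<in>{0<..}. SUP P\<in>packings \<delta> F. \<Sum>\<^sub>\<infinity>(x, r)\<in>P. ennreal ((2 * r) powr s))"

text \<open>The premeasure is not countably subadditive; countable covers turn it into an outer measure.\<close>

definition packing_measure :: "real \<Rightarrow> 'a::euclidean_space set \<Rightarrow> ennreal" where
  "packing_measure s E =
     (INF F\<in>{F :: nat \<Rightarrow> 'a set. E \<subseteq> (\<Union>i. F i)}. \<Sum>i. packing_premeasure s (F i))"

definition packing_dim :: "'a::euclidean_space set \<Rightarrow> ereal" where
  "packing_dim E = (INF s\<in>{s. 0 \<le> s \<and> packing_measure s E = 0}. ereal s)"

end

theory Submission
  imports Defs "HOL-Real_Asymp.Real_Asymp"
begin

text \<open>
  Conditioning on the clocks turns the walk into a Gaussian process in \<open>(n, t)\<close> whose correlations decay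
  like \<open>exp (- \<bar>t - s\<bar>)\<close>.  At the level \<open>H\<close> with \<open>H\<^sup>2 = 2 * ln (ln n) + c * ln (ln (ln n))\<close> the walk therefore
  decorrelates over time spans of order \<open>1 / H\<^sup>2\<close> and over blocks of \<open>n\<close> of relative length \<open>1 / H\<^sup>2\<close>.  Hence the
  event that a set \<open>F\<close> of times contains an exceedance in a given block has a probability of order
  \<open>K * exp (- H\<^sup>2 / 2) / H\<close>, where \<open>K\<close> is the number of \<open>1 / H\<^sup>2\<close>-separated points of \<open>F\<close>.  If \<open>K\<close> grows like
  \<open>(H\<^sup>2) powr s\<close>, the sum over the blocks behaves like the sum of \<open>ln k powr (s + 1 / 2 - c / 2) / k\<close>, which converges
  iff \<open>c > 3 + 2 * s\<close>.  The Borel-Cantelli lemmas give the theorem with the upper Minkowski dimension in place of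
  the packing dimension.  Countable covers localise the upper bound.  For the lower bound, \<open>E\<close> is the projection of a
  closed set; removing its small portions leaves a closed set whose relatively open parts all have large upper Minkowski
  dimension, and Baire's theorem produces one time at which the level is exceeded infinitely often.
\<close>

subsection \<open>Gaussian tails\<close>

text \<open>The threshold is decided by powers of \<open>H\<close>, so the supremum over a time
  window must have the tail of a single time up to a constant factor. The obstacle is that
  increments after a time \<open>a\<close> are correlated with the height at \<open>a\<close>. The
  remedy is to carry a monotone weight \<open>g\<close> of the value at \<open>a\<close> through all
  exponential moments: a jump replaces an old value by an independent fresh one, so it pulls down
  coordinates that are already high, and the weight costs nothing. Only such one-coordinate moments
  are taken from the clocks; the rest is independence of the coordinates.

  In the lower bound, large capacity is available only along a sequence of scales
  \<open>1 / K\<close>, so each of these scales must produce a probability near one by itself. Hence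
  one \<open>K\<close> serves a long range of walk times, on which \<open>H\<^sup>2\<close> is of
  order \<open>K powr (1 + d)\<close>: the grid is slightly coarser than the decorrelation scale,
  pair correlations beat the number of pairs, and the exponent changes only by a multiple of the
  small \<open>d\<close>. Since the theorem squares the walk, the upper bound is applied to the
  negated walk as well.\<close>

lemma (in prob_space) indep_var_nn_integral_pair:
  assumes "indep_var A U B V" and [measurable]: "f \<in> borel_measurable (A \<Otimes>\<^sub>M B)"
  shows "(\<integral>\<^sup>+\<omega>. f (U \<omega>, V \<omega>) \<partial>M) = (\<integral>\<^sup>+\<omega>. \<integral>\<^sup>+\<omega>'. f (U \<omega>, V \<omega>') \<partial>M \<partial>M)"
proof -
  have [measurable]: "U \<in> measurable M A" "V \<in> measurable M B"
    and eq: "distr M A U \<Otimes>\<^sub>M distr M B V = distr M (A \<Otimes>\<^sub>M B) (\<lambda>x. (U x, V x))"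
    using assms(1) unfolding indep_var_distribution_eq by auto
  interpret V: prob_space "distr M B V" by (rule prob_space_distr) simp
  have "(\<integral>\<^sup>+\<omega>. f (U \<omega>, V \<omega>) \<partial>M) = (\<integral>\<^sup>+z. f z \<partial>(distr M A U \<Otimes>\<^sub>M distr M B V))"
    unfolding eq by (simp add: nn_integral_distr)
  also have "\<dots> = (\<integral>\<^sup>+x. \<integral>\<^sup>+y. f (x, y) \<partial>distr M B V \<partial>distr M A U)"
    by (simp add: V.nn_integral_fst[symmetric])
  also have "\<dots> = (\<integral>\<^sup>+\<omega>. \<integral>\<^sup>+\<omega>'. f (U \<omega>, V \<omega>') \<partial>M \<partial>M)"
    by (subst nn_integral_distr) (auto intro!: nn_integral_cong simp: nn_integral_distr)
  finally show ?thesis .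
qed

definition normal_tail :: "real \<Rightarrow> real" where
  "normal_tail x = measure std_normal_distribution {x<..}"

interpretation std_normal: prob_space std_normal_distribution
  by (rule prob_space_normal_density) simp

lemma normal_tail_nonneg [simp]: "0 \<le> normal_tail x"
  and normal_tail_le_1 [simp]: "normal_tail x \<le> 1"
  by (simp_all add: normal_tail_def)

lemma normal_tail_antimono: "x \<le> y \<Longrightarrow> normal_tail y \<le> normal_tail x"
  unfolding normal_tail_def by (intro std_normal.finite_measure_mono) auto

lemma emeasure_normal_tail:
  "ennreal (normal_tail x) = (\<integral>\<^sup>+y. ennreal (std_normal_density y) * indicator {x<..} y \<partial>lborel)"
  unfolding normal_tail_def std_normal.emeasure_eq_measure[symmetric]
  by (subst emeasure_density) auto

text \<open>On the half-line beyond \<open>h\<close> the exponent \<open>- y\<^sup>2 / 2\<close>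
  lies below its tangent at \<open>h\<close>, because the square of \<open>h - y\<close> is
  nonnegative; the resulting exponential is integrated exactly.\<close>

lemma normal_tail_upper:
  assumes "h > 0" shows "normal_tail h \<le> exp (- h\<^sup>2 / 2) / h"
proof -
  have "ennreal (normal_tail h) \<le> (\<integral>\<^sup>+y. ennreal (exp (h\<^sup>2/2 - h * y)) * indicator {h..} y \<partial>lborel)"
    unfolding emeasure_normal_tail
  proof (intro nn_integral_mono)
    fix y :: real
    have "std_normal_density y \<le> 1 * exp (- y\<^sup>2/2)"
      unfolding std_normal_density_def
      by (intro mult_right_mono) (auto simp: divide_le_eq intro!: order_trans[OF _ real_sqrt_ge_one] pi_ge_two order_trans[OF _ mult_mono[of 1 2 1 pi]] order_trans[OF _ pi_ge_two])
    also have "\<dots> \<le> exp (h\<^sup>2/2 - h * y)"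
      using zero_le_power2[of "h - y"] by (simp add: power2_diff)
    finally show "ennreal (std_normal_density y) * indicator {h<..} y \<le> ennreal (exp (h\<^sup>2/2 - h * y)) * indicator {h..} y"
      by (auto split: split_indicator intro!: ennreal_leI)
  qed
  also have "\<dots> = ennreal (0 - (- exp (h\<^sup>2/2 - h * h) / h))"
  proof (rule nn_integral_FTC_atLeast[where F="\<lambda>y. - exp (h\<^sup>2/2 - h * y) / h" and T=0, THEN trans])
    show "((\<lambda>y. - exp (h\<^sup>2/2 - h * y) / h) \<longlongrightarrow> 0) at_top"
      using assms by real_asymp
  qed (use assms in \<open>auto intro!: derivative_eq_intros simp: field_simps\<close>)
  also have "\<dots> = ennreal (exp (- h\<^sup>2 / 2) / h)"
    by (simp add: power2_eq_square)
  finally show ?thesis using assms by (simp add: ennreal_le_iff)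
qed

text \<open>Only the interval from \<open>h\<close> to \<open>h + 1 / h\<close> is kept. There the
  exponent falls by at most 3/2, and the constant 20 comes from
  \<open>1 / sqrt (2 * pi) \<ge> 1/3\<close> and \<open>exp (-3/2) \<ge> 3/20\<close>.\<close>

lemma normal_tail_lower:
  assumes "h \<ge> 1" shows "normal_tail h \<ge> exp (- h\<^sup>2 / 2) / (20 * h)"
proof -
  have d: "std_normal_density y \<ge> exp (-h\<^sup>2/2) / 20" if "y \<in> {h..h + 1/h}" for y
  proof -
    have "y\<^sup>2 \<le> (h + 1/h)\<^sup>2" using that assms by (intro power_mono) auto
    also have "\<dots> = h\<^sup>2 + 2 + 1/h\<^sup>2" using assms by (simp add: power2_eq_square field_simps)
    also have "\<dots> \<le> h\<^sup>2 + 3" using assms by (simp add: divide_le_eq)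
    finally have "exp (- y\<^sup>2/2) \<ge> exp (-h\<^sup>2/2) * exp (-3/2)" by (simp add: exp_add[symmetric] field_simps)
    moreover have "1 / sqrt (2 * pi) \<ge> 1/3"
      using pi_less_4 by (intro divide_left_mono real_le_lsqrt) auto
    ultimately have "(1/3) * (exp (-h\<^sup>2/2) * exp (-3/2)) \<le> std_normal_density y"
      unfolding std_normal_density_def by (intro mult_mono) auto
    moreover have "exp (-3/2 :: real) \<ge> 3/20"
    proof -
      have "exp (3/2 :: real) ^ 2 = exp 1 ^ 3" by (simp add: exp_of_nat_mult[symmetric] del: exp_of_nat_mult)
      also have "\<dots> \<le> 3 ^ 3" by (intro power_mono exp_le) auto
      also have "\<dots> \<le> (20/3)^2" by (simp add: power2_eq_square)
      finally have "exp (3/2 :: real) \<le> 20/3" by (rule power2_le_imp_le) auto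
      then show ?thesis by (simp add: exp_minus field_simps)
    qed
    then have "(1/3) * (exp (-h\<^sup>2/2) * exp (-3/2)) \<ge> (1/3) * (exp (-h\<^sup>2/2) * (3/20))"
      by (intro mult_left_mono) auto
    ultimately have "(1/3) * (exp (-h\<^sup>2/2) * (3/20)) \<le> std_normal_density y" by (rule order_trans[rotated])
    then show ?thesis by simp
  qed
  have "ennreal (exp (- h\<^sup>2 / 2) / (20 * h)) = (\<integral>\<^sup>+y. ennreal (exp (-h\<^sup>2/2) / 20) * indicator {h<..h + 1/h} y \<partial>lborel)"
    using assms by (subst nn_integral_cmult_indicator) (simp_all add: ennreal_mult'[symmetric])
  also have "\<dots> \<le> ennreal (normal_tail h)"
    unfolding emeasure_normal_tail using d
    by (intro nn_integral_mono) (auto split: split_indicator intro!: ennreal_leI)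
  finally show ?thesis by (simp add: ennreal_le_iff)
qed

lemma (in prob_space) normal_tail_prob:
  assumes "distributed M lborel Z std_normal_density"
  shows "prob {\<omega>\<in>space M. x < Z \<omega>} = normal_tail x" and "prob {\<omega>\<in>space M. Z \<omega> < - x} = normal_tail x"
proof -
  have Z: "distr M lborel Z = std_normal_distribution" and [measurable]: "Z \<in> borel_measurable M"
    using assms by (auto simp: distributed_def)
  show "prob {\<omega>\<in>space M. x < Z \<omega>} = normal_tail x"
    unfolding normal_tail_def Z[symmetric] by (subst measure_distr) (auto intro!: arg_cong[where f=prob])
  have "distributed M lborel (\<lambda>\<omega>. 0 + (-1) * Z \<omega>) (normal_density (0 + (-1) * 0) (\<bar>-1\<bar> * 1))"
    by (rule normal_density_affine[OF assms]) auto
  then have Z: "distr M lborel (\<lambda>\<omega>. - Z \<omega>) = std_normal_distribution"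
    by (auto simp: distributed_def)
  show "prob {\<omega>\<in>space M. Z \<omega> < - x} = normal_tail x"
    unfolding normal_tail_def Z[symmetric] by (subst measure_distr) (auto intro!: arg_cong[where f=prob])
qed

text \<open>Cameron-Martin formula in dimension one, by completing the square: tilting by
  \<open>exp (\<theta> * x)\<close> is a translation by \<theta>. With a negative \<theta> it shows
  that a monotone \<open>g\<close> can only lose under the tilt.\<close>

lemma std_normal_exp_shift:
  fixes g :: "real \<Rightarrow> ennreal"
  assumes [measurable]: "g \<in> borel_measurable borel"
  shows "(\<integral>\<^sup>+x. g x * ennreal (exp (\<theta> * x)) \<partial>std_normal_distribution)
    = ennreal (exp (\<theta>\<^sup>2/2)) * (\<integral>\<^sup>+x. g (x + \<theta>) \<partial>std_normal_distribution)"
proof -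
  have "(\<integral>\<^sup>+x. g x * ennreal (exp (\<theta> * x)) \<partial>std_normal_distribution)
    = (\<integral>\<^sup>+x. ennreal (std_normal_density x) * (g x * ennreal (exp (\<theta> * x))) \<partial>lborel)"
    by (subst nn_integral_density) auto
  also have "\<dots> = (\<integral>\<^sup>+x. ennreal (std_normal_density (\<theta> + 1 * x)) * (g (\<theta> + 1 * x) * ennreal (exp (\<theta> * (\<theta> + 1 * x)))) \<partial>lborel)"
    by (subst nn_integral_real_affine[where c=1 and t=\<theta>]) auto
  also have "\<dots> = (\<integral>\<^sup>+x. ennreal (exp (\<theta>\<^sup>2/2)) * (ennreal (std_normal_density x) * g (x + \<theta>)) \<partial>lborel)"
  proof (intro nn_integral_cong)
    fix x :: real
    have "std_normal_density (\<theta> + 1 * x) * exp (\<theta> * (\<theta> + 1 * x)) = exp (\<theta>\<^sup>2/2) * std_normal_density x"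
      by (simp add: std_normal_density_def exp_add[symmetric] power2_eq_square field_simps)
    then have eq: "ennreal (std_normal_density (\<theta> + 1 * x)) * ennreal (exp (\<theta> * (\<theta> + 1 * x)))
        = ennreal (exp (\<theta>\<^sup>2/2)) * ennreal (std_normal_density x)"
      by (subst (1 2) ennreal_mult[symmetric]) auto
    have arrange: "u * (v * w) = (u * w) * v" for u v w :: ennreal
      by (simp add: mult_ac)
    show "ennreal (std_normal_density (\<theta> + 1 * x)) * (g (\<theta> + 1 * x) * ennreal (exp (\<theta> * (\<theta> + 1 * x))))
      = ennreal (exp (\<theta>\<^sup>2/2)) * (ennreal (std_normal_density x) * g (x + \<theta>))"
      unfolding arrange[of "ennreal (std_normal_density (\<theta> + 1 * x))"] eq
      by (simp add: mult.assoc add.commute)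
  qed
  also have "\<dots> = ennreal (exp (\<theta>\<^sup>2/2)) * (\<integral>\<^sup>+x. g (x + \<theta>) \<partial>std_normal_distribution)"
    by (subst nn_integral_cmult) (auto simp: nn_integral_density)
  finally show ?thesis .
qed

lemma std_normal_exp: "(\<integral>\<^sup>+x. ennreal (exp (\<theta> * x)) \<partial>std_normal_distribution) = ennreal (exp (\<theta>\<^sup>2/2))"
  using std_normal_exp_shift[of "\<lambda>_. 1" \<theta>] std_normal.emeasure_space_1 by simp

text \<open>All that the estimates use of the clocks. The monotone weight \<open>g\<close> of an
  earlier value allows every increment bound to be applied jointly with the event that the walk is
  already high. In \<open>exp_increment\<close> the term \<open>exp (\<theta>\<^sup>2)\<close> is
  the moment generating function of a difference of two independent standard normals and
  \<open>t - s\<close> bounds the jump probability; in \<open>exp_pair\<close> the factor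
  \<open>exp (- (t - s))\<close> is the probability of no jump. Right continuity reduces uncountable
  sets of times to rational ones, local constancy at fixed times serves the category
  argument.\<close>

locale gaussian_dynamics = prob_space M for M :: "'w measure" +
  fixes X :: "nat \<Rightarrow> real \<Rightarrow> 'w \<Rightarrow> real"
  assumes indep_X: "indep_vars (\<lambda>_. PiM UNIV (\<lambda>_::real. borel)) (\<lambda>i \<omega> t. X i t \<omega>) UNIV"
    and normal_X: "\<And>i t. 0 \<le> t \<Longrightarrow> distributed M lborel (X i t) std_normal_density"
    and exp_increment: "\<And>i a s t \<theta> (g :: real \<Rightarrow> ennreal). 0 \<le> a \<Longrightarrow> a \<le> s \<Longrightarrow> s \<le> t \<Longrightarrow> 0 \<le> \<theta> \<Longrightarrow> mono g \<Longrightarrow>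
      g \<in> borel_measurable borel \<Longrightarrow>
      (\<integral>\<^sup>+\<omega>. g (X i a \<omega>) * ennreal (exp (\<theta> * (X i t \<omega> - X i s \<omega>))) \<partial>M)
        \<le> ennreal (1 + (t - s) * (exp (\<theta>\<^sup>2) - 1)) * (\<integral>\<^sup>+\<omega>. g (X i a \<omega>) \<partial>M)"
    and exp_max_increment: "\<And>i a s t T (g :: real \<Rightarrow> ennreal). 0 \<le> a \<Longrightarrow> a \<le> s \<Longrightarrow> s \<le> t \<Longrightarrow> finite T \<Longrightarrow> T \<noteq> {} \<Longrightarrow>
      T \<subseteq> {s..t} \<Longrightarrow> mono g \<Longrightarrow> g \<in> borel_measurable borel \<Longrightarrow>
      (\<integral>\<^sup>+\<omega>. g (X i a \<omega>) * ennreal (exp (Max ((\<lambda>u. X i u \<omega> - X i s \<omega>) ` T))) \<partial>M)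
        \<le> ennreal (1 + (t - s) * exp 1) * (\<integral>\<^sup>+\<omega>. g (X i a \<omega>) \<partial>M)"
    and exp_pair: "\<And>i s t \<theta>. 0 \<le> s \<Longrightarrow> s \<le> t \<Longrightarrow>
      (\<integral>\<^sup>+\<omega>. ennreal (exp (\<theta> * (X i s \<omega> + X i t \<omega>))) \<partial>M)
        \<le> ennreal (exp (\<theta>\<^sup>2) * (1 + exp (- (t - s)) * (exp (\<theta>\<^sup>2) - 1)))"
    and right_continuous: "AE \<omega> in M. \<forall>i. \<forall>t\<ge>0. \<exists>e>0. \<forall>u\<in>{t..<t + e}. X i u \<omega> = X i t \<omega>"
    and locally_constant: "\<And>t. 0 \<le> t \<Longrightarrow> AE \<omega> in M. \<forall>i. \<exists>e>0. \<forall>u\<ge>0. \<bar>u - t\<bar> < e \<longrightarrow> X i u \<omega> = X i t \<omega>"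

subsection \<open>Poisson clocks\<close>

text \<open>\<open>h\<close> lists the holding times of one clock.\<close>

definition clock_sum :: "(nat \<Rightarrow> real) \<Rightarrow> nat \<Rightarrow> real" where
  "clock_sum h k = (\<Sum>j<k. h j)"

text \<open>The last branch only reproduces the junk value of the \<open>THE\<close> in \<open>dyn_increment\<close>; the \<open>LEAST\<close> makes measurability evident.\<close>

definition clock_index :: "(nat \<Rightarrow> real) \<Rightarrow> real \<Rightarrow> nat" where
  "clock_index h t =
    (if \<exists>k. clock_sum h k \<le> t \<and> t < clock_sum h (Suc k)
     then LEAST k. clock_sum h k \<le> t \<and> t < clock_sum h (Suc k) else (THE k. False))"

lemma clock_sum_0 [simp]: "clock_sum h 0 = 0"
  and clock_sum_Suc: "clock_sum h (Suc k) = clock_sum h k + h k"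
  by (simp_all add: clock_sum_def)

lemma strict_mono_interval_unique:
  fixes f :: "nat \<Rightarrow> real"
  assumes "strict_mono f" "f k \<le> t" "t < f (Suc k)" "f k' \<le> t" "t < f (Suc k')"
  shows "k = k'"
proof -
  have "f k < f (Suc k')" "f k' < f (Suc k)" using assms by auto
  then show ?thesis using assms(1) by (simp add: strict_mono_less)
qed

lemma clock_index_eq_THE:
  assumes "strict_mono (clock_sum h)"
  shows "clock_index h t = (THE k. clock_sum h k \<le> t \<and> t < clock_sum h (Suc k))"
proof (cases "\<exists>k. clock_sum h k \<le> t \<and> t < clock_sum h (Suc k)")
  case True
  then obtain k where k: "clock_sum h k \<le> t \<and> t < clock_sum h (Suc k)" by blast
  have u: "k' = k" if "clock_sum h k' \<le> t \<and> t < clock_sum h (Suc k')" for k'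
    using strict_mono_interval_unique[OF assms] k that by blast
  have "(LEAST k. clock_sum h k \<le> t \<and> t < clock_sum h (Suc k)) = k"
  proof (rule Least_equality)
    show "k \<le> y" if "clock_sum h y \<le> t \<and> t < clock_sum h (Suc y)" for y
      using u[OF that] by simp
  qed (rule k)
  moreover have "(THE k. clock_sum h k \<le> t \<and> t < clock_sum h (Suc k)) = k"
    using k u by (intro the_equality) blast+
  ultimately show ?thesis using True by (simp add: clock_index_def)
next
  case False
  then have "(\<lambda>k. clock_sum h k \<le> t \<and> t < clock_sum h (Suc k)) = (\<lambda>k. False)" by auto
  then show ?thesis using False by (simp add: clock_index_def)
qed

lemma measurable_clock_sum [measurable]: "(\<lambda>h. clock_sum h k) \<in> borel_measurable (PiM UNIV (\<lambda>_. borel))"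
  unfolding clock_sum_def by measurable

lemma measurable_clock_index [measurable]:
  "(\<lambda>h. clock_index h t) \<in> measurable (PiM UNIV (\<lambda>_. borel)) (count_space UNIV)"
  unfolding clock_index_def by measurable

definition regular_clock :: "(nat \<Rightarrow> real) \<Rightarrow> bool" where
  "regular_clock h \<longleftrightarrow> strict_mono (clock_sum h) \<and> (\<forall>m::nat. \<exists>k. real m < clock_sum h k)"

lemma regular_clock_index:
  assumes "regular_clock h" "0 \<le> t"
  shows "clock_sum h (clock_index h t) \<le> t" "t < clock_sum h (Suc (clock_index h t))"
proof -
  have sm: "strict_mono (clock_sum h)" using assms by (simp add: regular_clock_def)
  obtain m where "t < real m" using reals_Archimedean2 by blast
  moreover obtain k where "real m < clock_sum h k" using assms by (auto simp: regular_clock_def)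
  ultimately have ex: "\<exists>k. t < clock_sum h k" by (meson less_trans)
  define k where "k = (LEAST k. t < clock_sum h k)"
  have k: "t < clock_sum h k" unfolding k_def using ex by (rule LeastI_ex)
  then have "k \<noteq> 0" using assms(2) by (cases k) auto
  then obtain k' where k': "k = Suc k'" by (cases k) auto
  have "\<not> t < clock_sum h k'" using not_less_Least[of k' "\<lambda>k. t < clock_sum h k"] k' by (simp add: k_def)
  then have "\<exists>k. clock_sum h k \<le> t \<and> t < clock_sum h (Suc k)" using k k' by (intro exI[of _ k']) auto
  then have *: "clock_sum h (clock_index h t) \<le> t \<and> t < clock_sum h (Suc (clock_index h t))"
    unfolding clock_index_def by (simp only: if_True) (rule LeastI_ex)
  then show "clock_sum h (clock_index h t) \<le> t" "t < clock_sum h (Suc (clock_index h t))" by auto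
qed

lemma regular_clock_index_eqI:
  assumes "regular_clock h" "0 \<le> t" "clock_sum h k \<le> t" "t < clock_sum h (Suc k)"
  shows "clock_index h t = k"
  using strict_mono_interval_unique[of "clock_sum h"] regular_clock_index[OF assms(1,2)] assms
  by (auto simp: regular_clock_def)

lemma regular_clock_index_mono:
  assumes "regular_clock h" "0 \<le> s" "s \<le> t"
  shows "clock_index h s \<le> clock_index h t"
proof -
  have "clock_sum h (clock_index h s) < clock_sum h (Suc (clock_index h t))"
    using regular_clock_index[OF assms(1), of s] regular_clock_index[OF assms(1), of t] assms(2,3) by auto
  then show ?thesis using assms(1) by (simp add: strict_mono_less regular_clock_def)
qed

lemma regular_clock_index_less_iff:
  assumes "regular_clock h" "0 \<le> t"
  shows "clock_index h t < k \<longleftrightarrow> t < clock_sum h k"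
proof
  assume "clock_index h t < k"
  then have "clock_sum h (Suc (clock_index h t)) \<le> clock_sum h k"
    using assms(1) by (simp add: strict_mono_less_eq regular_clock_def)
  then show "t < clock_sum h k" using regular_clock_index[OF assms] by simp
next
  assume "t < clock_sum h k"
  then have "clock_sum h (clock_index h t) < clock_sum h k" using regular_clock_index[OF assms] by simp
  then show "clock_index h t < k" using assms(1) by (simp add: strict_mono_less regular_clock_def)
qed

section \<open>Holding times and replacement variables of a single coordinate\<close>

locale normal_walk = dynamical_walk M std_normal_distribution \<xi> \<tau>
  for M :: "'w measure" and \<xi> \<tau> :: "nat \<Rightarrow> nat \<Rightarrow> 'w \<Rightarrow> real"
begin

definition hold :: "nat \<Rightarrow> 'w \<Rightarrow> nat \<Rightarrow> real" where
  "hold i \<omega> k = \<tau> i (Suc k) \<omega> - \<tau> i k \<omega>"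

abbreviation PN :: "(nat \<Rightarrow> real) measure" where "PN \<equiv> PiM UNIV (\<lambda>_. borel)"

abbreviation base :: "(nat \<times> nat) + (nat \<times> nat) \<Rightarrow> 'w \<Rightarrow> real" where
  "base \<equiv> case_sum (\<lambda>(n, k). \<xi> n k) (\<lambda>(n, k) \<omega>. \<tau> n (Suc k) \<omega> - \<tau> n k \<omega>)"

lemma clock_sum_hold:
  assumes "i \<ge> 1" "\<omega> \<in> space M" shows "clock_sum (hold i \<omega>) k = \<tau> i k \<omega>"
  using clock_start[OF assms] by (induction k) (auto simp: clock_sum_Suc hold_def)

lemma strict_mono_hold:
  assumes "i \<ge> 1" "\<omega> \<in> space M" shows "strict_mono (clock_sum (hold i \<omega>))"
  using clock_strict_mono[OF assms] clock_sum_hold[OF assms] by (simp add: strict_mono_def)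

lemma dyn_increment_eq:
  assumes "i \<ge> 1" "\<omega> \<in> space M"
  shows "dyn_increment \<xi> \<tau> i t \<omega> = \<xi> i (clock_index (hold i \<omega>) t) \<omega>"
  unfolding dyn_increment_def clock_index_eq_THE[OF strict_mono_hold[OF assms]] clock_sum_hold[OF assms] ..

lemma rv_base:
  assumes "i \<ge> 1" shows "\<xi> i k \<in> borel_measurable M" "(\<lambda>\<omega>. hold i \<omega> k) \<in> borel_measurable M"
proof -
  have "base j \<in> borel_measurable M" if "j \<in> ({1..} \<times> UNIV) <+> ({1..} \<times> UNIV)" for j
    using indep that unfolding indep_vars_def by blast
  from this[of "Inl (i, k)"] this[of "Inr (i, k)"] assms
  show "\<xi> i k \<in> borel_measurable M" "(\<lambda>\<omega>. hold i \<omega> k) \<in> borel_measurable M" by (auto simp: hold_def)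
qed

lemma indep_hold_xi:
  assumes "i \<ge> 1"
  shows "indep_var PN (hold i) PN (\<lambda>\<omega> k. \<xi> i k \<omega>)"
proof -
  let ?A = "range (\<lambda>k. Inr (i, k)) :: ((nat \<times> nat) + (nat \<times> nat)) set"
  let ?B = "range (\<lambda>k. Inl (i, k)) :: ((nat \<times> nat) + (nat \<times> nat)) set"
  have "indep_var (PiM ?A (\<lambda>_. borel)) (\<lambda>\<omega>. restrict (\<lambda>j. base j \<omega>) ?A)
      (PiM ?B (\<lambda>_. borel)) (\<lambda>\<omega>. restrict (\<lambda>j. base j \<omega>) ?B)"
    by (rule indep_var_restrict[OF indep]) (use assms in auto)
  then have "indep_var PN ((\<lambda>f k. f (Inr (i, k))) \<circ> (\<lambda>\<omega>. restrict (\<lambda>j. base j \<omega>) ?A))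
     PN ((\<lambda>f k. f (Inl (i, k))) \<circ> (\<lambda>\<omega>. restrict (\<lambda>j. base j \<omega>) ?B))"
    by (rule indep_var_compose) (auto intro!: measurable_PiM_single' measurable_component_singleton simp: space_PiM)
  then show ?thesis by (simp add: comp_def hold_def[abs_def])
qed

lemma indep_xi:
  assumes "i \<ge> 1" shows "indep_vars (\<lambda>_. borel) (\<xi> i) UNIV"
proof -
  have "indep_vars (\<lambda>j. PiM {Inl (i, j)} (\<lambda>_. borel)) (\<lambda>j \<omega>. restrict (\<lambda>l. base l \<omega>) {Inl (i, j)}) (UNIV :: nat set)"
    by (rule indep_vars_restrict[OF indep]) (use assms in \<open>auto simp: disjoint_family_on_def\<close>)
  then have "indep_vars (\<lambda>_. borel) (\<lambda>j \<omega>. (\<lambda>f. f (Inl (i, j))) (restrict (\<lambda>l. base l \<omega>) {Inl (i, j)})) UNIV"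
    by (rule indep_vars_compose2) auto
  then show ?thesis by simp
qed

lemma indep_hold:
  assumes "i \<ge> 1" shows "indep_vars (\<lambda>_. borel) (\<lambda>k \<omega>. hold i \<omega> k) UNIV"
proof -
  have "indep_vars (\<lambda>j. PiM {Inr (i, j)} (\<lambda>_. borel)) (\<lambda>j \<omega>. restrict (\<lambda>l. base l \<omega>) {Inr (i, j)}) (UNIV :: nat set)"
    by (rule indep_vars_restrict[OF indep]) (use assms in \<open>auto simp: disjoint_family_on_def\<close>)
  then have "indep_vars (\<lambda>_. borel) (\<lambda>j \<omega>. (\<lambda>f. f (Inr (i, j))) (restrict (\<lambda>l. base l \<omega>) {Inr (i, j)})) UNIV"
    by (rule indep_vars_compose2) auto
  then show ?thesis by (simp add: hold_def)
qed

lemma distributed_xi: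
  assumes "i \<ge> 1" shows "distributed M lborel (\<xi> i k) std_normal_density"
  using law_increments[OF assms, of k] rv_base(1)[OF assms, of k]
  by (simp add: distributed_def cong: distr_cong)

lemma nn_integral_xi:
  assumes "i \<ge> 1" and [measurable]: "g \<in> borel_measurable borel"
  shows "(\<integral>\<^sup>+\<omega>. g (\<xi> i k \<omega>) \<partial>M) = (\<integral>\<^sup>+x. g x \<partial>std_normal_distribution)"
proof -
  note [measurable] = rv_base(1)[OF assms(1)]
  show ?thesis unfolding law_increments[OF assms(1), of k, symmetric] by (subst nn_integral_distr) auto
qed

text \<open>This is the conditioning on the clock: the holding times are frozen at \<omega> while
  the replacement variables are integrated over an independent \<omega>'.\<close>

lemma fubini_clock:
  assumes "i \<ge> 1" and [measurable]: "f \<in> borel_measurable (PN \<Otimes>\<^sub>M PN)"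
  shows "(\<integral>\<^sup>+\<omega>. f (hold i \<omega>, \<lambda>k. \<xi> i k \<omega>) \<partial>M) = (\<integral>\<^sup>+\<omega>. \<integral>\<^sup>+\<omega>'. f (hold i \<omega>, \<lambda>k. \<xi> i k \<omega>') \<partial>M \<partial>M)"
  using indep_var_nn_integral_pair[OF indep_hold_xi[OF assms(1)] assms(2)] .

text \<open>Given the \<open>k\<close>-th jump time \<open>u \<le> s\<close>, the next holding time
  exceeds \<open>t - u\<close> with probability \<open>exp (- (t - u))\<close>. The factor
  \<open>exp (- u)\<close> of the Erlang density cancels the \<open>u\<close> in the exponent, and a
  monomial remains to be integrated over \<open>{0..s}\<close>. Two times \<open>s \<le> t\<close>
  are treated at once because this is the event of having no jump between them.\<close>

lemma prob_poisson:
  assumes i: "i \<ge> 1" and s: "0 \<le> s" "s \<le> t"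
  shows "emeasure M {\<omega>\<in>space M. clock_sum (hold i \<omega>) k \<le> s \<and> t < clock_sum (hold i \<omega>) (Suc k)}
    = ennreal (exp (- t) * s ^ k / fact k)"
proof (cases k)
  case 0
  have "prob {\<omega>\<in>space M. t < hold i \<omega> 0} = exp (- t * 1)"
    using exponential_distributedD_gt[OF law_holding_times[OF i, of 0], of t] s by (simp add: hold_def)
  then show ?thesis using s 0 by (simp add: emeasure_eq_measure clock_sum_Suc)
next
  case (Suc j)
  note [measurable] = rv_base[OF i]
  have [measurable]: "(\<lambda>\<omega>. clock_sum (hold i \<omega>) k) \<in> borel_measurable M" for k
    unfolding clock_sum_def by measurable
  have D: "distributed M lborel (\<lambda>\<omega>. clock_sum (hold i \<omega>) k) (erlang_density (card {..<k} - 1) 1)"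
    unfolding clock_sum_def
    by (rule exponential_distributed_sum)
       (use law_holding_times[OF i] indep_vars_subset[OF indep_hold[OF i]] Suc in \<open>auto simp: hold_def[abs_def]\<close>)
  have "indep_var (PiM {..<k} (\<lambda>_. borel)) (\<lambda>\<omega>. restrict (\<lambda>j. hold i \<omega> j) {..<k})
      (PiM {k} (\<lambda>_. borel)) (\<lambda>\<omega>. restrict (\<lambda>j. hold i \<omega> j) {k})"
    by (rule indep_var_restrict[OF indep_hold[OF i]]) auto
  then have "indep_var borel ((\<lambda>f. \<Sum>j<k. f j) \<circ> (\<lambda>\<omega>. restrict (\<lambda>j. hold i \<omega> j) {..<k}))
      borel ((\<lambda>f. f k) \<circ> (\<lambda>\<omega>. restrict (\<lambda>j. hold i \<omega> j) {k}))"
    by (rule indep_var_compose) auto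
  then have ind: "indep_var borel (\<lambda>\<omega>. clock_sum (hold i \<omega>) k) borel (\<lambda>\<omega>. hold i \<omega> k)"
    by (simp add: comp_def clock_sum_def)
  have "emeasure M {\<omega>\<in>space M. clock_sum (hold i \<omega>) k \<le> s \<and> t < clock_sum (hold i \<omega>) (Suc k)}
    = (\<integral>\<^sup>+\<omega>. indicator {z. fst z \<le> s \<and> t < fst z + snd z} (clock_sum (hold i \<omega>) k, hold i \<omega> k) \<partial>M)"
  proof -
    have "emeasure M {\<omega>\<in>space M. clock_sum (hold i \<omega>) k \<le> s \<and> t < clock_sum (hold i \<omega>) (Suc k)}
      = (\<integral>\<^sup>+\<omega>. indicator {\<omega>\<in>space M. clock_sum (hold i \<omega>) k \<le> s \<and> t < clock_sum (hold i \<omega>) (Suc k)} \<omega> \<partial>M)"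
      by (rule nn_integral_indicator[symmetric]) measurable
    also have "\<dots> = (\<integral>\<^sup>+\<omega>. indicator {z. fst z \<le> s \<and> t < fst z + snd z} (clock_sum (hold i \<omega>) k, hold i \<omega> k) \<partial>M)"
      by (rule nn_integral_cong) (simp add: clock_sum_Suc indicator_def)
    finally show ?thesis .
  qed
  also have "\<dots> = (\<integral>\<^sup>+\<omega>. \<integral>\<^sup>+\<omega>'. indicator {z. fst z \<le> s \<and> t < fst z + snd z} (clock_sum (hold i \<omega>) k, hold i \<omega>' k) \<partial>M \<partial>M)"
    by (rule indep_var_nn_integral_pair[OF ind]) measurable
  also have "\<dots> = (\<integral>\<^sup>+\<omega>. (\<lambda>u. ennreal (exp (- (t - u))) * indicator {..s} u) (clock_sum (hold i \<omega>) k) \<partial>M)"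
  proof (rule nn_integral_cong)
    fix \<omega> assume "\<omega> \<in> space M"
    define u where "u = clock_sum (hold i \<omega>) k"
    show "(\<integral>\<^sup>+\<omega>'. indicator {z. fst z \<le> s \<and> t < fst z + snd z} (clock_sum (hold i \<omega>) k, hold i \<omega>' k) \<partial>M)
      = ennreal (exp (- (t - clock_sum (hold i \<omega>) k))) * indicator {..s} (clock_sum (hold i \<omega>) k)"
    proof (cases "u \<le> s")
      case True
      have "(\<integral>\<^sup>+\<omega>'. indicator {z. fst z \<le> s \<and> t < fst z + snd z} (u, hold i \<omega>' k) \<partial>M)
        = (\<integral>\<^sup>+\<omega>'. indicator {\<omega>\<in>space M. t - u < hold i \<omega> k} \<omega>' \<partial>M)"
        using True by (intro nn_integral_cong) (auto split: split_indicator)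
      also have "\<dots> = prob {\<omega>\<in>space M. t - u < hold i \<omega> k}"
        by (simp add: emeasure_eq_measure)
      also have "\<dots> = exp (- (t - u) * 1)"
        using exponential_distributedD_gt[OF law_holding_times[OF i, of k], of "t - u"] s True by (simp add: hold_def)
      finally show ?thesis using True by (simp add: u_def)
    qed (simp add: u_def)
  qed
  also have "\<dots> = (\<integral>\<^sup>+u. ennreal (erlang_density (card {..<k} - 1) 1 u) * (ennreal (exp (- (t - u))) * indicator {..s} u) \<partial>lborel)"
    by (subst distributed_nn_integral[OF D]) auto
  also have "\<dots> = (\<integral>\<^sup>+u. ennreal (u ^ j / fact j * exp (- t)) * indicator {0..s} u \<partial>lborel)"
  proof (rule nn_integral_cong)
    fix u :: real
    show "ennreal (erlang_density (card {..<k} - 1) 1 u) * (ennreal (exp (- (t - u))) * indicator {..s} u)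
      = ennreal (u ^ j / fact j * exp (- t)) * indicator {0..s} u"
    proof (cases "0 \<le> u \<and> u \<le> s")
      case True
      have "u ^ j * exp (- u) / fact j * exp (- (t - u)) = u ^ j / fact j * exp (- t)"
        by (simp add: exp_diff exp_minus field_simps)
      then have "erlang_density (card {..<k} - 1) 1 u * exp (- (t - u)) = u ^ j / fact j * exp (- t)"
        using True Suc by (simp add: erlang_density_def)
      then show ?thesis using True by (simp add: ennreal_mult'[symmetric])
    qed (auto simp: erlang_density_def)
  qed
  also have "\<dots> = ennreal (s ^ Suc j / fact (Suc j) * exp (- t) - 0 ^ Suc j / fact (Suc j) * exp (- t))"
  proof (rule nn_integral_FTC_Icc)
    fix u :: real
    have "((\<lambda>u. u ^ Suc j) has_real_derivative real (Suc j) * u ^ j) (at u)"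
      using DERIV_pow[of "Suc j" u UNIV] by simp
    then have "((\<lambda>u. u ^ Suc j / fact (Suc j) * exp (- t)) has_real_derivative
        real (Suc j) * u ^ j / fact (Suc j) * exp (- t)) (at u)"
      by (intro DERIV_cmult_right DERIV_cdivide)
    then show "((\<lambda>u. u ^ Suc j / fact (Suc j) * exp (- t)) has_real_derivative u ^ j / fact j * exp (- t)) (at u)"
      by (simp add: field_simps del: of_nat_Suc)
  qed (use s in auto)
  finally show ?thesis using Suc by (simp add: mult.commute)
qed

end

section \<open>Exponential moments of a single coordinate\<close>

context normal_walk
begin

lemma rv_clock [measurable]:
  assumes "i \<ge> 1"
  shows "hold i \<in> measurable M PN" "(\<lambda>\<omega> k. \<xi> i k \<omega>) \<in> measurable M PN"
    "(\<lambda>\<omega>. clock_sum (hold i \<omega>) k) \<in> borel_measurable M"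
    "(\<lambda>\<omega>. clock_index (hold i \<omega>) t) \<in> measurable M (count_space UNIV)"
proof -
  note [measurable] = rv_base[OF assms]
  show h [measurable]: "hold i \<in> measurable M PN" by (rule measurable_PiM_single') auto
  show "(\<lambda>\<omega> k. \<xi> i k \<omega>) \<in> measurable M PN" by (rule measurable_PiM_single') auto
  show "(\<lambda>\<omega>. clock_sum (hold i \<omega>) k) \<in> borel_measurable M" by measurable
  show "(\<lambda>\<omega>. clock_index (hold i \<omega>) t) \<in> measurable M (count_space UNIV)" by measurable
qed

definition stays :: "nat \<Rightarrow> real \<Rightarrow> real \<Rightarrow> 'w set" where
  "stays i s t = {\<omega>\<in>space M. \<exists>k. clock_sum (hold i \<omega>) k \<le> s \<and> t < clock_sum (hold i \<omega>) (Suc k)}"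

lemma sets_stays [measurable]: "i \<ge> 1 \<Longrightarrow> stays i s t \<in> sets M"
  unfolding stays_def by measurable

lemma prob_stays:
  assumes i: "i \<ge> 1" and s: "0 \<le> s" "s \<le> t"
  shows "prob (stays i s t) = exp (- (t - s))"
proof -
  let ?A = "\<lambda>k. {\<omega>\<in>space M. clock_sum (hold i \<omega>) k \<le> s \<and> t < clock_sum (hold i \<omega>) (Suc k)}"
  have disj: "disjoint_family ?A"
    unfolding disjoint_family_on_def
  proof (intro ballI impI)
    fix k k' :: nat assume "k \<noteq> k'"
    then show "?A k \<inter> ?A k' = {}"
      using strict_mono_interval_unique[OF strict_mono_hold[OF i], of _ k s k'] s by force
  qed
  have "(\<lambda>k. prob (?A k)) sums prob (\<Union>k. ?A k)"
    by (rule finite_measure_UNION[OF _ disj]) (use i in auto)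
  moreover have "prob (?A k) = exp (- t) * (s ^ k / fact k)" for k
    using prob_poisson[OF i s, of k] s unfolding emeasure_eq_measure by (subst (asm) ennreal_inj) auto
  moreover have "(\<lambda>k. exp (- t) * (s ^ k / fact k)) sums (exp (- t) * exp s)"
    using exp_converges[of s] by (intro sums_mult) (simp add: divide_inverse mult.commute)
  moreover have "(\<Union>k. ?A k) = stays i s t" by (auto simp: stays_def)
  ultimately have "prob (stays i s t) = exp (- t) * exp s"
    by (auto dest: sums_unique2)
  then show ?thesis by (simp add: exp_add[symmetric])
qed

text \<open>For \<open>s = t = m\<close> the probability in \<open>prob_stays\<close> is 1, so
  almost surely every natural number lies in some holding interval, and a clock with this property
  does not explode.\<close>

lemma AE_regular_clock:
  assumes i: "i \<ge> 1" shows "AE \<omega> in M. regular_clock (hold i \<omega>)"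
proof -
  have "AE \<omega> in M. \<omega> \<in> stays i (real m) (real m)" for m
    using prob_stays[OF i, of "real m" "real m"] i by (subst prob_eq_1[symmetric]) auto
  then have "AE \<omega> in M. \<forall>m. \<omega> \<in> stays i (real m) (real m)" by (simp add: AE_all_countable)
  then show ?thesis
    using AE_space
  proof eventually_elim
    case (elim \<omega>)
    then show ?case using strict_mono_hold[OF i] by (auto simp: regular_clock_def stays_def)
  qed
qed

lemma stays_iff:
  assumes "\<omega> \<in> space M" "regular_clock (hold i \<omega>)" "0 \<le> s" "s \<le> t"
  shows "\<omega> \<in> stays i s t \<longleftrightarrow> clock_index (hold i \<omega>) s = clock_index (hold i \<omega>) t"
proof
  assume "\<omega> \<in> stays i s t"
  then obtain k where "clock_sum (hold i \<omega>) k \<le> s" "t < clock_sum (hold i \<omega>) (Suc k)"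
    by (auto simp: stays_def)
  then have "clock_index (hold i \<omega>) s = k" "clock_index (hold i \<omega>) t = k"
    using assms by (auto intro!: regular_clock_index_eqI)
  then show "clock_index (hold i \<omega>) s = clock_index (hold i \<omega>) t" by simp
next
  assume "clock_index (hold i \<omega>) s = clock_index (hold i \<omega>) t"
  then show "\<omega> \<in> stays i s t"
    using regular_clock_index[OF assms(2), of s] regular_clock_index[OF assms(2), of t] assms
    by (auto simp: stays_def intro!: exI[of _ "clock_index (hold i \<omega>) t"])
qed

text \<open>The left side is the expected number of jumps in \<open>{s<..t}\<close>. The Erlang
  densities of the successive jump times add up to the constant 1, which is the intensity of the
  clock.\<close>

lemma emeasure_jump:
  assumes i: "i \<ge> 1" and s: "0 \<le> s" "s \<le> t"
  shows "(\<Sum>k. emeasure M {\<omega>\<in>space M. s < clock_sum (hold i \<omega>) (Suc k) \<and> clock_sum (hold i \<omega>) (Suc k) \<le> t})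
    = ennreal (t - s)"
proof -
  have *: "emeasure M {\<omega>\<in>space M. s < clock_sum (hold i \<omega>) (Suc k) \<and> clock_sum (hold i \<omega>) (Suc k) \<le> t}
    = (\<integral>\<^sup>+u. ennreal (exp (- u) * (u ^ k / fact k)) * indicator {s<..t} u \<partial>lborel)" for k
  proof -
    have D: "distributed M lborel (\<lambda>\<omega>. clock_sum (hold i \<omega>) (Suc k)) (erlang_density (card {..<Suc k} - 1) 1)"
      unfolding clock_sum_def
      by (rule exponential_distributed_sum)
         (use law_holding_times[OF i] indep_vars_subset[OF indep_hold[OF i]] in \<open>auto simp: hold_def[abs_def]\<close>)
    have "emeasure M {\<omega>\<in>space M. s < clock_sum (hold i \<omega>) (Suc k) \<and> clock_sum (hold i \<omega>) (Suc k) \<le> t}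
      = emeasure M ((\<lambda>\<omega>. clock_sum (hold i \<omega>) (Suc k)) -` {s<..t} \<inter> space M)"
      by (rule arg_cong[where f="emeasure M"]) auto
    also have "\<dots> = (\<integral>\<^sup>+u. ennreal (erlang_density (card {..<Suc k} - 1) 1 u) * indicator {s<..t} u \<partial>lborel)"
      by (rule distributed_emeasure[OF D]) simp
    also have "\<dots> = (\<integral>\<^sup>+u. ennreal (exp (- u) * (u ^ k / fact k)) * indicator {s<..t} u \<partial>lborel)"
      using s by (intro nn_integral_cong) (auto simp: erlang_density_def mult.commute split: split_indicator)
    finally show ?thesis .
  qed
  have "(\<Sum>k. \<integral>\<^sup>+u. ennreal (exp (- u) * (u ^ k / fact k)) * indicator {s<..t} u \<partial>lborel)
    = (\<integral>\<^sup>+u. (\<Sum>k. ennreal (exp (- u) * (u ^ k / fact k)) * indicator {s<..t} u) \<partial>lborel)"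
    by (rule nn_integral_suminf[symmetric]) measurable
  also have "\<dots> = (\<integral>\<^sup>+u. indicator {s<..t} u \<partial>lborel)"
  proof (rule nn_integral_cong)
    fix u :: real
    show "(\<Sum>k. ennreal (exp (- u) * (u ^ k / fact k)) * indicator {s<..t} u) = indicator {s<..t} u"
    proof (cases "u \<in> {s<..t}")
      case True
      have "(\<lambda>k. exp (- u) * (u ^ k / fact k)) sums (exp (- u) * exp u)"
        using exp_converges[of u] by (intro sums_mult) (simp add: divide_inverse mult.commute)
      then have "(\<lambda>k. exp (- u) * (u ^ k / fact k)) sums 1" by (simp add: exp_add[symmetric])
      then have "(\<Sum>k. ennreal (exp (- u) * (u ^ k / fact k))) = ennreal 1"
        using True s by (intro suminf_ennreal_eq) auto
      then show ?thesis using True by simp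
    qed simp
  qed
  also have "\<dots> = ennreal (t - s)" using s by simp
  finally show ?thesis by (simp only: *)
qed

text \<open>Here \<open>k1\<close> and \<open>k2\<close> are the indices in force at the times
  \<open>a\<close> and \<open>s\<close>, and \<open>k3\<close> belongs to a later jump. If
  \<open>k1 \<noteq> k2\<close> the three variables are independent. If \<open>k1 = k2\<close> the
  factor \<open>exp (- \<theta> * x)\<close> tilts the variable inside \<open>g\<close>; by the
  Cameron-Martin formula this shifts the argument of \<open>g\<close> to the left, which a monotone
  \<open>g\<close> turns into an inequality in the right direction.\<close>

lemma exp_xi_triple:
  fixes g :: "real \<Rightarrow> ennreal"
  assumes i: "i \<ge> 1" and g: "mono g" "g \<in> borel_measurable borel" and k: "k3 \<noteq> k1" "k3 \<noteq> k2" and "0 \<le> \<theta>"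
  shows "(\<integral>\<^sup>+\<omega>. g (\<xi> i k1 \<omega>) * ennreal (exp (\<theta> * (\<xi> i k3 \<omega> - \<xi> i k2 \<omega>))) \<partial>M)
    \<le> ennreal (exp (\<theta>\<^sup>2)) * (\<integral>\<^sup>+x. g x \<partial>std_normal_distribution)"
proof -
  note [measurable] = g(2) rv_base[OF i]
  let ?N = std_normal_distribution
  \<comment> \<open>One family of factors covers both cases: if \<open>k1 = k2\<close>, the index
    set \<open>{k1, k2, k3}\<close> has two elements and the factor at \<open>k1\<close> collects
    the weight together with the negative tilt.\<close>
  define Z where "Z k x = (if k = k1 then g x else 1) * (if k = k2 then ennreal (exp (- \<theta> * x)) else 1)
    * (if k = k3 then ennreal (exp (\<theta> * x)) else 1)" for k x
  have [measurable]: "Z k \<in> borel_measurable borel" for k unfolding Z_def by measurable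
  have indep: "indep_vars (\<lambda>_. borel) (\<lambda>k \<omega>. Z k (\<xi> i k \<omega>)) {k1, k2, k3}"
    by (rule indep_vars_compose2[OF indep_vars_subset[OF indep_xi[OF i]]]) auto
  have e: "ennreal (exp (\<theta> * (a - b))) = ennreal (exp (- \<theta> * b)) * ennreal (exp (\<theta> * a))" for a b
    by (subst ennreal_mult[symmetric]) (auto simp: exp_add[symmetric] algebra_simps)
  have "(\<integral>\<^sup>+\<omega>. g (\<xi> i k1 \<omega>) * ennreal (exp (\<theta> * (\<xi> i k3 \<omega> - \<xi> i k2 \<omega>))) \<partial>M)
    = (\<integral>\<^sup>+\<omega>. (\<Prod>k\<in>{k1, k2, k3}. Z k (\<xi> i k \<omega>)) \<partial>M)"
    unfolding e using k by (intro nn_integral_cong) (cases "k1 = k2"; auto simp: Z_def mult_ac)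
  also have "\<dots> = (\<Prod>k\<in>{k1, k2, k3}. \<integral>\<^sup>+\<omega>. Z k (\<xi> i k \<omega>) \<partial>M)"
    by (rule indep_vars_nn_integral[OF _ indep]) auto
  also have "\<dots> = (\<Prod>k\<in>{k1, k2, k3}. \<integral>\<^sup>+x. Z k x \<partial>?N)"
    by (intro prod.cong refl nn_integral_xi[OF i]) auto
  also have "\<dots> \<le> ennreal (exp (\<theta>\<^sup>2/2)) * (\<integral>\<^sup>+x. g x \<partial>?N) * ennreal (exp (\<theta>\<^sup>2/2))"
  proof (cases "k1 = k2")
    case True
    have "(\<integral>\<^sup>+x. g x * ennreal (exp (- \<theta> * x)) \<partial>?N) = ennreal (exp (\<theta>\<^sup>2/2)) * (\<integral>\<^sup>+x. g (x + - \<theta>) \<partial>?N)"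
      by (subst std_normal_exp_shift) auto
    also have "\<dots> \<le> ennreal (exp (\<theta>\<^sup>2/2)) * (\<integral>\<^sup>+x. g x \<partial>?N)"
      using \<open>0 \<le> \<theta>\<close> by (intro mult_left_mono nn_integral_mono monoD[OF g(1)]) auto
    finally show ?thesis
      using True k std_normal_exp[of \<theta>] by (simp add: Z_def mult_right_mono)
  next
    case False
    then show ?thesis
      using k std_normal_exp[of \<theta>] std_normal_exp[of "- \<theta>"] by (simp add: Z_def mult_ac)
  qed
  also have "\<dots> = ennreal (exp (\<theta>\<^sup>2)) * (\<integral>\<^sup>+x. g x \<partial>?N)"
    by (simp add: mult_ac ennreal_mult[symmetric] exp_add[symmetric] flip: mult.assoc)
  finally show ?thesis .
qed

lemma nn_integral_dyn:
  assumes i: "i \<ge> 1" and [measurable]: "g \<in> borel_measurable borel"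
  shows "(\<integral>\<^sup>+\<omega>. g (\<xi> i (clock_index (hold i \<omega>) t) \<omega>) \<partial>M) = (\<integral>\<^sup>+x. g x \<partial>std_normal_distribution)"
proof -
  have "(\<integral>\<^sup>+\<omega>. g (\<xi> i (clock_index (hold i \<omega>) t) \<omega>) \<partial>M)
    = (\<integral>\<^sup>+\<omega>. \<integral>\<^sup>+\<omega>'. (\<lambda>(h, x). g (x (clock_index h t))) (hold i \<omega>, \<lambda>k. \<xi> i k \<omega>') \<partial>M \<partial>M)"
    by (subst fubini_clock[OF i, symmetric]) auto
  also have "\<dots> = (\<integral>\<^sup>+\<omega>. (\<integral>\<^sup>+x. g x \<partial>std_normal_distribution) \<partial>M)"
    using nn_integral_xi[OF i] by (intro nn_integral_cong) auto
  also have "\<dots> = (\<integral>\<^sup>+x. g x \<partial>std_normal_distribution)" by (simp add: emeasure_space_1)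
  finally show ?thesis .
qed

text \<open>Given the clock, either there is no jump between \<open>s\<close> and \<open>t\<close>
  and the increment vanishes, or the index at \<open>t\<close> is fresh and
  \<open>exp_xi_triple\<close> applies. The second case has probability
  \<open>1 - exp (- (t - s))\<close>, which is at most \<open>t - s\<close>.\<close>

lemma exp_increment_dyn:
  fixes g :: "real \<Rightarrow> ennreal"
  assumes i: "i \<ge> 1" and t: "0 \<le> a" "a \<le> s" "s \<le> t" and \<theta>: "0 \<le> \<theta>" and g: "mono g" "g \<in> borel_measurable borel"
  shows "(\<integral>\<^sup>+\<omega>. g (\<xi> i (clock_index (hold i \<omega>) a) \<omega>) *
      ennreal (exp (\<theta> * (\<xi> i (clock_index (hold i \<omega>) t) \<omega> - \<xi> i (clock_index (hold i \<omega>) s) \<omega>))) \<partial>M)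
    \<le> ennreal (1 + (t - s) * (exp (\<theta>\<^sup>2) - 1)) * (\<integral>\<^sup>+x. g x \<partial>std_normal_distribution)"
proof -
  note [measurable] = g(2)
  define G where "G = (\<integral>\<^sup>+x. g x \<partial>std_normal_distribution)"
  define f where "f = (\<lambda>(h, x). g (x (clock_index h a)) *
      ennreal (exp (\<theta> * (x (clock_index h t) - x (clock_index h s)))))"
  have [measurable]: "f \<in> borel_measurable (PN \<Otimes>\<^sub>M PN)" unfolding f_def by measurable
  have "(\<integral>\<^sup>+\<omega>. g (\<xi> i (clock_index (hold i \<omega>) a) \<omega>) *
      ennreal (exp (\<theta> * (\<xi> i (clock_index (hold i \<omega>) t) \<omega> - \<xi> i (clock_index (hold i \<omega>) s) \<omega>))) \<partial>M)
    = (\<integral>\<^sup>+\<omega>. f (hold i \<omega>, \<lambda>k. \<xi> i k \<omega>) \<partial>M)"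
    by (simp add: f_def)
  also have "\<dots> = (\<integral>\<^sup>+\<omega>. \<integral>\<^sup>+\<omega>'. f (hold i \<omega>, \<lambda>k. \<xi> i k \<omega>') \<partial>M \<partial>M)"
    by (rule fubini_clock[OF i]) measurable
  also have "\<dots> \<le> (\<integral>\<^sup>+\<omega>. (1 + ennreal (exp (\<theta>\<^sup>2) - 1) * indicator (space M - stays i s t) \<omega>) * G \<partial>M)"
  proof (rule nn_integral_mono_AE)
    show "AE \<omega> in M. (\<integral>\<^sup>+\<omega>'. f (hold i \<omega>, \<lambda>k. \<xi> i k \<omega>') \<partial>M)
      \<le> (1 + ennreal (exp (\<theta>\<^sup>2) - 1) * indicator (space M - stays i s t) \<omega>) * G"
      using AE_regular_clock[OF i] AE_space
    proof eventually_elim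
      case (elim \<omega>)
      have mono: "clock_index (hold i \<omega>) a \<le> clock_index (hold i \<omega>) s" "clock_index (hold i \<omega>) s \<le> clock_index (hold i \<omega>) t"
        using t elim by (auto intro!: regular_clock_index_mono)
      show ?case
      proof (cases "\<omega> \<in> stays i s t")
        case True
        then have "clock_index (hold i \<omega>) s = clock_index (hold i \<omega>) t"
          using stays_iff[OF elim(2,1), of s t] t by auto
        then show ?thesis using True nn_integral_xi[OF i g(2)] by (simp add: f_def G_def)
      next
        case False
        then have "clock_index (hold i \<omega>) s \<noteq> clock_index (hold i \<omega>) t"
          using stays_iff[OF elim(2,1), of s t] t by auto
        then have "(\<integral>\<^sup>+\<omega>'. f (hold i \<omega>, \<lambda>k. \<xi> i k \<omega>') \<partial>M) \<le> ennreal (exp (\<theta>\<^sup>2)) * G"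
          unfolding f_def G_def prod.case using mono by (intro exp_xi_triple[OF i g _ _ \<theta>]) auto
        moreover have "1 + ennreal (exp (\<theta>\<^sup>2) - 1) = ennreal (exp (\<theta>\<^sup>2))"
          unfolding ennreal_1[symmetric] by (subst ennreal_plus[symmetric]) auto
        ultimately show ?thesis using False elim(2) by simp
      qed
    qed
  qed
  also have "\<dots> = (1 + ennreal (exp (\<theta>\<^sup>2) - 1) * emeasure M (space M - stays i s t)) * G"
    using i by (subst nn_integral_multc) (auto simp: nn_integral_add nn_integral_cmult emeasure_space_1)
  also have "emeasure M (space M - stays i s t) = ennreal (1 - exp (- (t - s)))"
    using prob_compl[OF sets_stays[OF i, of s t]] prob_stays[OF i, of s t] t by (simp add: emeasure_eq_measure)
  also have "(1 + ennreal (exp (\<theta>\<^sup>2) - 1) * ennreal (1 - exp (- (t - s)))) * G \<le> ennreal (1 + (t - s) * (exp (\<theta>\<^sup>2) - 1)) * G"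
  proof (intro mult_right_mono)
    have "1 + ennreal (exp (\<theta>\<^sup>2) - 1) * ennreal (1 - exp (- (t - s))) = ennreal (1 + (exp (\<theta>\<^sup>2) - 1) * (1 - exp (- (t - s))))"
      using t by (simp add: ennreal_mult[symmetric] ennreal_plus ennreal_1[symmetric] del: ennreal_1)
    also have "\<dots> \<le> ennreal (1 + (t - s) * (exp (\<theta>\<^sup>2) - 1))"
    proof (intro ennreal_leI add_left_mono)
      have "1 - exp (- (t - s)) \<le> t - s" using exp_ge_add_one_self[of "- (t - s)"] by linarith
      then show "(exp (\<theta>\<^sup>2) - 1) * (1 - exp (- (t - s))) \<le> (t - s) * (exp (\<theta>\<^sup>2) - 1)"
        by (subst mult.commute) (intro mult_right_mono, auto)
    qed
    finally show "1 + ennreal (exp (\<theta>\<^sup>2) - 1) * ennreal (1 - exp (- (t - s))) \<le> \<dots>" .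
  qed simp
  finally show ?thesis unfolding G_def .
qed

text \<open>The maximum over \<open>T\<close> is attained. If no jump precedes its maximiser the
  increment is 0; otherwise it is the increment produced by one particular jump in
  \<open>{s<..t}\<close>. So 1 plus the sum over all jumps in this interval dominates, and the
  expected number of these jumps is \<open>t - s\<close>.\<close>

lemma exp_max_increment_dyn:
  fixes g :: "real \<Rightarrow> ennreal"
  assumes i: "i \<ge> 1" and t: "0 \<le> a" "a \<le> s" "s \<le> t" and T: "finite T" "T \<noteq> {}" "T \<subseteq> {s..t}"
    and g: "mono g" "g \<in> borel_measurable borel"
  shows "(\<integral>\<^sup>+\<omega>. g (\<xi> i (clock_index (hold i \<omega>) a) \<omega>) *
      ennreal (exp (Max ((\<lambda>u. \<xi> i (clock_index (hold i \<omega>) u) \<omega> - \<xi> i (clock_index (hold i \<omega>) s) \<omega>) ` T))) \<partial>M)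
    \<le> ennreal (1 + (t - s) * exp 1) * (\<integral>\<^sup>+x. g x \<partial>std_normal_distribution)"
proof -
  note [measurable] = g(2)
  define G where "G = (\<integral>\<^sup>+x. g x \<partial>std_normal_distribution)"
  define f where "f = (\<lambda>(h, x). g (x (clock_index h a)) *
      (1 + (\<Sum>k. indicator {s<..t} (clock_sum h (Suc k)) * ennreal (exp (x (Suc k) - x (clock_index h s))))))"
  have [measurable]: "f \<in> borel_measurable (PN \<Otimes>\<^sub>M PN)" unfolding f_def by measurable
  define A where "A k = {\<omega>\<in>space M. s < clock_sum (hold i \<omega>) (Suc k) \<and> clock_sum (hold i \<omega>) (Suc k) \<le> t}" for k
  have [measurable]: "A k \<in> sets M" for k unfolding A_def using i by measurable
  have "(\<integral>\<^sup>+\<omega>. g (\<xi> i (clock_index (hold i \<omega>) a) \<omega>) *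
      ennreal (exp (Max ((\<lambda>u. \<xi> i (clock_index (hold i \<omega>) u) \<omega> - \<xi> i (clock_index (hold i \<omega>) s) \<omega>) ` T))) \<partial>M)
    \<le> (\<integral>\<^sup>+\<omega>. f (hold i \<omega>, \<lambda>k. \<xi> i k \<omega>) \<partial>M)"
  proof (rule nn_integral_mono_AE)
    show "AE \<omega> in M. g (\<xi> i (clock_index (hold i \<omega>) a) \<omega>) *
      ennreal (exp (Max ((\<lambda>u. \<xi> i (clock_index (hold i \<omega>) u) \<omega> - \<xi> i (clock_index (hold i \<omega>) s) \<omega>) ` T)))
      \<le> f (hold i \<omega>, \<lambda>k. \<xi> i k \<omega>)"
      using AE_regular_clock[OF i] AE_space
    proof eventually_elim
      case (elim \<omega>)
      let ?h = "hold i \<omega>" and ?c = "\<lambda>u. clock_index (hold i \<omega>) u"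
      have "Max ((\<lambda>u. \<xi> i (?c u) \<omega> - \<xi> i (?c s) \<omega>) ` T) \<in> (\<lambda>u. \<xi> i (?c u) \<omega> - \<xi> i (?c s) \<omega>) ` T"
        using T by (intro Max_in) auto
      then obtain u where u: "u \<in> T" and eq: "Max ((\<lambda>u. \<xi> i (?c u) \<omega> - \<xi> i (?c s) \<omega>) ` T) = \<xi> i (?c u) \<omega> - \<xi> i (?c s) \<omega>"
        by auto
      have su: "s \<le> u" "u \<le> t" using u T by auto
      let ?F = "\<lambda>k. indicator {s<..t} (clock_sum ?h (Suc k)) * ennreal (exp (\<xi> i (Suc k) \<omega> - \<xi> i (?c s) \<omega>))"
      have "ennreal (exp (\<xi> i (?c u) \<omega> - \<xi> i (?c s) \<omega>)) \<le> 1 + (\<Sum>k. ?F k)"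
      proof (cases "?c u = ?c s")
        case False
        then have less: "?c s < ?c u"
          using regular_clock_index_mono[OF elim(1), of s u] su t by auto
        then obtain k where k: "?c u = Suc k" by (cases "?c u") auto
        have "s < clock_sum ?h (Suc k)"
          using regular_clock_index_less_iff[OF elim(1), of s "Suc k"] less k t by auto
        moreover have "clock_sum ?h (Suc k) \<le> t"
          using regular_clock_index(1)[OF elim(1), of u] k su t by auto
        ultimately have "ennreal (exp (\<xi> i (?c u) \<omega> - \<xi> i (?c s) \<omega>)) = (\<Sum>k\<in>{k}. ?F k)"
          using k by simp
        also have "\<dots> \<le> (\<Sum>k. ?F k)" by (rule sum_le_suminf) auto
        finally show ?thesis by (simp add: add_increasing)
      qed simp
      then show ?case unfolding f_def prod.case eq by (intro mult_left_mono) auto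
    qed
  qed
  also have "\<dots> = (\<integral>\<^sup>+\<omega>. \<integral>\<^sup>+\<omega>'. f (hold i \<omega>, \<lambda>k. \<xi> i k \<omega>') \<partial>M \<partial>M)"
    by (rule fubini_clock[OF i]) measurable
  also have "\<dots> \<le> (\<integral>\<^sup>+\<omega>. G + (\<Sum>k. indicator (A k) \<omega> * (ennreal (exp 1) * G)) \<partial>M)"
  proof (rule nn_integral_mono_AE)
    show "AE \<omega> in M. (\<integral>\<^sup>+\<omega>'. f (hold i \<omega>, \<lambda>k. \<xi> i k \<omega>') \<partial>M) \<le> G + (\<Sum>k. indicator (A k) \<omega> * (ennreal (exp 1) * G))"
      using AE_regular_clock[OF i] AE_space
    proof eventually_elim
      case (elim \<omega>)
      note [measurable] = rv_base[OF i]
      let ?h = "hold i \<omega>" and ?c = "\<lambda>u. clock_index (hold i \<omega>) u"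
      let ?I = "\<lambda>k. indicator {s<..t} (clock_sum ?h (Suc k)) :: ennreal"
      have "(\<integral>\<^sup>+\<omega>'. f (?h, \<lambda>k. \<xi> i k \<omega>') \<partial>M)
        = (\<integral>\<^sup>+\<omega>'. g (\<xi> i (?c a) \<omega>') + (\<Sum>k. ?I k * (g (\<xi> i (?c a) \<omega>') * ennreal (exp (1 * (\<xi> i (Suc k) \<omega>' - \<xi> i (?c s) \<omega>'))))) \<partial>M)"
        unfolding f_def prod.case distrib_left mult_1_right mult_1 ennreal_suminf_cmult[symmetric]
        by (intro nn_integral_cong arg_cong2[where f="(+)"] refl suminf_cong) (simp add: mult_ac)
      also have "\<dots> = (\<integral>\<^sup>+\<omega>'. g (\<xi> i (?c a) \<omega>') \<partial>M)
        + (\<Sum>k. ?I k * (\<integral>\<^sup>+\<omega>'. g (\<xi> i (?c a) \<omega>') * ennreal (exp (1 * (\<xi> i (Suc k) \<omega>' - \<xi> i (?c s) \<omega>'))) \<partial>M))"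
        by (subst nn_integral_add) (auto simp: nn_integral_suminf nn_integral_cmult)
      also have "(\<integral>\<^sup>+\<omega>'. g (\<xi> i (?c a) \<omega>') \<partial>M) = G"
        unfolding G_def by (rule nn_integral_xi[OF i g(2)])
      also have "(\<Sum>k. ?I k * (\<integral>\<^sup>+\<omega>'. g (\<xi> i (?c a) \<omega>') * ennreal (exp (1 * (\<xi> i (Suc k) \<omega>' - \<xi> i (?c s) \<omega>'))) \<partial>M))
        \<le> (\<Sum>k. indicator (A k) \<omega> * (ennreal (exp 1) * G))"
      proof (rule suminf_le)
        fix k
        show "?I k * (\<integral>\<^sup>+\<omega>'. g (\<xi> i (?c a) \<omega>') * ennreal (exp (1 * (\<xi> i (Suc k) \<omega>' - \<xi> i (?c s) \<omega>'))) \<partial>M)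
          \<le> indicator (A k) \<omega> * (ennreal (exp 1) * G)"
        proof (cases "clock_sum ?h (Suc k) \<in> {s<..t}")
          case True
          have "?c s < Suc k"
            using True regular_clock_index_less_iff[OF elim(1), of s "Suc k"] t by auto
          moreover have "?c a \<le> ?c s" using regular_clock_index_mono[OF elim(1), of a s] t by auto
          ultimately have "(\<integral>\<^sup>+\<omega>'. g (\<xi> i (?c a) \<omega>') * ennreal (exp (1 * (\<xi> i (Suc k) \<omega>' - \<xi> i (?c s) \<omega>'))) \<partial>M)
            \<le> ennreal (exp (1\<^sup>2)) * G"
            unfolding G_def by (intro exp_xi_triple[OF i g]) auto
          then show ?thesis using True elim(2) by (simp add: A_def)
        qed simp
      qed auto
      finally show ?case by (simp add: add_left_mono)
    qed
  qed
  also have "\<dots> = G + (\<Sum>k. emeasure M (A k)) * (ennreal (exp 1) * G)"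
    by (simp add: nn_integral_add nn_integral_suminf nn_integral_multc emeasure_space_1)
  also have "(\<Sum>k. emeasure M (A k)) = ennreal (t - s)"
    unfolding A_def using t by (intro emeasure_jump[OF i]) auto
  also have "G + ennreal (t - s) * (ennreal (exp 1) * G) = ennreal (1 + (t - s) * exp 1) * G"
    using t by (simp add: ennreal_plus ennreal_mult distrib_right mult.assoc)
  finally show ?thesis unfolding G_def .
qed

text \<open>If no jump separates the two times, the sum is twice one normal variable, with moment
  \<open>exp (2 * \<theta>\<^sup>2)\<close>; otherwise the two variables are independent, with
  moment \<open>exp (\<theta>\<^sup>2)\<close>.\<close>

lemma exp_pair_dyn:
  assumes i: "i \<ge> 1" and t: "0 \<le> s" "s \<le> t"
  shows "(\<integral>\<^sup>+\<omega>. ennreal (exp (\<theta> * (\<xi> i (clock_index (hold i \<omega>) s) \<omega> + \<xi> i (clock_index (hold i \<omega>) t) \<omega>))) \<partial>M)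
    \<le> ennreal (exp (\<theta>\<^sup>2) * (1 + exp (- (t - s)) * (exp (\<theta>\<^sup>2) - 1)))"
proof -
  define f where "f = (\<lambda>(h, x). ennreal (exp (\<theta> * (x (clock_index h s) + x (clock_index h t)))))"
  have [measurable]: "f \<in> borel_measurable (PN \<Otimes>\<^sub>M PN)" unfolding f_def by measurable
  have "(\<integral>\<^sup>+\<omega>. ennreal (exp (\<theta> * (\<xi> i (clock_index (hold i \<omega>) s) \<omega> + \<xi> i (clock_index (hold i \<omega>) t) \<omega>))) \<partial>M)
    = (\<integral>\<^sup>+\<omega>. f (hold i \<omega>, \<lambda>k. \<xi> i k \<omega>) \<partial>M)"
    by (simp add: f_def)
  also have "\<dots> = (\<integral>\<^sup>+\<omega>. \<integral>\<^sup>+\<omega>'. f (hold i \<omega>, \<lambda>k. \<xi> i k \<omega>') \<partial>M \<partial>M)"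
    by (rule fubini_clock[OF i]) measurable
  also have "\<dots> = (\<integral>\<^sup>+\<omega>. ennreal (exp (\<theta>\<^sup>2)) * (1 + ennreal (exp (\<theta>\<^sup>2) - 1) * indicator (stays i s t) \<omega>) \<partial>M)"
  proof (rule nn_integral_cong_AE)
    show "AE \<omega> in M. (\<integral>\<^sup>+\<omega>'. f (hold i \<omega>, \<lambda>k. \<xi> i k \<omega>') \<partial>M)
      = ennreal (exp (\<theta>\<^sup>2)) * (1 + ennreal (exp (\<theta>\<^sup>2) - 1) * indicator (stays i s t) \<omega>)"
      using AE_regular_clock[OF i] AE_space
    proof eventually_elim
      case (elim \<omega>)
      note [measurable] = rv_base[OF i]
      let ?c = "\<lambda>u. clock_index (hold i \<omega>) u"
      show ?case
      proof (cases "\<omega> \<in> stays i s t")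
        case True
        then have eq: "?c s = ?c t" using stays_iff[OF elim(2,1), of s t] t by auto
        have "(\<integral>\<^sup>+\<omega>'. f (hold i \<omega>, \<lambda>k. \<xi> i k \<omega>') \<partial>M) = (\<integral>\<^sup>+\<omega>'. (\<lambda>x. ennreal (exp ((2 * \<theta>) * x))) (\<xi> i (?c t) \<omega>') \<partial>M)"
          unfolding f_def prod.case eq by (intro nn_integral_cong) (simp add: algebra_simps)
        also have "\<dots> = ennreal (exp ((2 * \<theta>)\<^sup>2 / 2))"
          by (subst nn_integral_xi[OF i]) (auto simp: std_normal_exp)
        also have "\<dots> = ennreal (exp (\<theta>\<^sup>2)) * ennreal (exp (\<theta>\<^sup>2))"
          by (subst ennreal_mult[symmetric]) (auto simp: exp_add[symmetric] power2_eq_square)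
        finally have *: "(\<integral>\<^sup>+\<omega>'. f (hold i \<omega>, \<lambda>k. \<xi> i k \<omega>') \<partial>M) = ennreal (exp (\<theta>\<^sup>2)) * ennreal (exp (\<theta>\<^sup>2))" .
        have "ennreal (exp (\<theta>\<^sup>2)) = 1 + ennreal (exp (\<theta>\<^sup>2) - 1)"
          unfolding ennreal_1[symmetric] by (subst ennreal_plus[symmetric]) auto
        then show ?thesis using True * by simp
      next
        case False
        then have ne: "?c s \<noteq> ?c t" using stays_iff[OF elim(2,1), of s t] t by auto
        let ?Z = "\<lambda>k \<omega>. ennreal (exp (\<theta> * \<xi> i k \<omega>))"
        have ind: "indep_vars (\<lambda>_. borel) (\<lambda>k \<omega>. (\<lambda>x. ennreal (exp (\<theta> * x))) (\<xi> i k \<omega>)) {?c s, ?c t}"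
          by (rule indep_vars_compose2[OF indep_vars_subset[OF indep_xi[OF i]]]) auto
        have "(\<integral>\<^sup>+\<omega>'. f (hold i \<omega>, \<lambda>k. \<xi> i k \<omega>') \<partial>M) = (\<integral>\<^sup>+\<omega>'. (\<Prod>k\<in>{?c s, ?c t}. ?Z k \<omega>') \<partial>M)"
          unfolding f_def prod.case using ne
          by (intro nn_integral_cong) (simp add: ennreal_mult[symmetric] exp_add[symmetric] distrib_left)
        also have "\<dots> = (\<Prod>k\<in>{?c s, ?c t}. \<integral>\<^sup>+\<omega>'. ?Z k \<omega>' \<partial>M)"
          by (rule indep_vars_nn_integral[OF _ ind]) auto
        also have "\<dots> = (\<Prod>k\<in>{?c s, ?c t}. ennreal (exp (\<theta>\<^sup>2/2)))"
          by (intro prod.cong refl, subst nn_integral_xi[OF i, of "\<lambda>x. ennreal (exp (\<theta> * x))"]) (auto simp: std_normal_exp)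
        also have "\<dots> = ennreal (exp (\<theta>\<^sup>2))"
          using ne by (simp add: ennreal_mult[symmetric] exp_add[symmetric])
        finally show ?thesis using False by simp
      qed
    qed
  qed
  also have "\<dots> = ennreal (exp (\<theta>\<^sup>2)) * (1 + ennreal (exp (\<theta>\<^sup>2) - 1) * emeasure M (stays i s t))"
    using i by (simp add: nn_integral_cmult nn_integral_add emeasure_space_1)
  also have "emeasure M (stays i s t) = ennreal (exp (- (t - s)))"
    using prob_stays[OF i t] by (simp add: emeasure_eq_measure)
  also have "ennreal (exp (\<theta>\<^sup>2)) * (1 + ennreal (exp (\<theta>\<^sup>2) - 1) * ennreal (exp (- (t - s))))
     = ennreal (exp (\<theta>\<^sup>2) * (1 + exp (- (t - s)) * (exp (\<theta>\<^sup>2) - 1)))"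
    by (simp add: ennreal_mult ennreal_plus mult.commute)
  finally show ?thesis by simp
qed

end

text \<open>The formula for \<open>dyn_increment\<close> through \<open>clock_index\<close> is
  available on \<open>space M\<close> only, since the clocks are controlled only there; independence
  has to be carried across an equality of this kind.\<close>

lemma (in prob_space) indep_vars_cong_space:
  assumes "indep_vars N X I" "\<And>i \<omega>. i \<in> I \<Longrightarrow> \<omega> \<in> space M \<Longrightarrow> X i \<omega> = Y i \<omega>"
  shows "indep_vars N Y I"
proof -
  have "X i -` A \<inter> space M = Y i -` A \<inter> space M" if "i \<in> I" for i A
    using assms(2)[OF that] by auto
  then have *: "{X i -` A \<inter> space M |A. A \<in> sets (N i)} = {Y i -` A \<inter> space M |A. A \<in> sets (N i)}" if "i \<in> I" for i
    using that by auto
  have "indep_sets (\<lambda>i. {X i -` A \<inter> space M |A. A \<in> sets (N i)}) I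
    = indep_sets (\<lambda>i. {Y i -` A \<inter> space M |A. A \<in> sets (N i)}) I"
    by (rule indep_sets_cong) (use * in auto)
  moreover have "X i \<in> measurable M (N i) \<longleftrightarrow> Y i \<in> measurable M (N i)" if "i \<in> I" for i
    by (rule measurable_cong) (use assms(2) that in auto)
  ultimately show ?thesis using assms(1) unfolding indep_vars_def2 by auto
qed

section \<open>Independence of the coordinate processes and regularity of their paths\<close>

context normal_walk
begin

lemma indep_dyn:
  "indep_vars (\<lambda>_. PiM UNIV (\<lambda>_::real. borel)) (\<lambda>i \<omega> t. dyn_increment \<xi> \<tau> (Suc i) t \<omega>) UNIV"
proof -
  let ?K = "\<lambda>i. range (\<lambda>k. Inl (Suc i, k)) \<union> range (\<lambda>k. Inr (Suc i, k)) :: ((nat \<times> nat) + (nat \<times> nat)) set"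
  let ?G = "\<lambda>i (f :: _ \<Rightarrow> real) t. f (Inl (Suc i, clock_index (\<lambda>k. f (Inr (Suc i, k))) t))"
  have "indep_vars (\<lambda>i. PiM (?K i) (\<lambda>_. borel)) (\<lambda>i \<omega>. restrict (\<lambda>l. base l \<omega>) (?K i)) UNIV"
    by (rule indep_vars_restrict[OF indep]) (auto simp: disjoint_family_on_def)
  then have "indep_vars (\<lambda>_. PiM UNIV (\<lambda>_::real. borel)) (\<lambda>i \<omega>. ?G i (restrict (\<lambda>l. base l \<omega>) (?K i))) UNIV"
  proof (rule indep_vars_compose2)
    fix i
    have h: "(\<lambda>f k. f (Inr (Suc i, k))) \<in> measurable (PiM (?K i) (\<lambda>_. borel)) PN"
      by (intro measurable_PiM_single' measurable_component_singleton) auto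
    have "(\<lambda>f. f (Inl (Suc i, clock_index (\<lambda>k. f (Inr (Suc i, k))) t))) \<in> borel_measurable (PiM (?K i) (\<lambda>_. borel))" for t
    proof (rule measurable_compose_countable[where f="\<lambda>k f. f (Inl (Suc i, k))" and g="\<lambda>f. clock_index (\<lambda>k. f (Inr (Suc i, k))) t"])
      show "(\<lambda>f. f (Inl (Suc i, k))) \<in> borel_measurable (PiM (?K i) (\<lambda>_. borel))" for k
        by (rule measurable_component_singleton) auto
      show "(\<lambda>f. clock_index (\<lambda>k. f (Inr (Suc i, k))) t) \<in> measurable (PiM (?K i) (\<lambda>_. borel)) (count_space UNIV)"
        by (rule measurable_compose[OF h measurable_clock_index])
    qed
    then show "?G i \<in> measurable (PiM (?K i) (\<lambda>_. borel)) (PiM UNIV (\<lambda>_::real. borel))"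
      by (intro measurable_PiM_single') auto
  qed
  then show ?thesis
  proof (rule indep_vars_cong_space)
    fix i \<omega> assume "\<omega> \<in> space M"
    then show "?G i (restrict (\<lambda>l. base l \<omega>) (?K i)) = (\<lambda>t. dyn_increment \<xi> \<tau> (Suc i) t \<omega>)"
      by (simp add: dyn_increment_eq hold_def[abs_def])
  qed
qed

lemma rv_dyn: "dyn_increment \<xi> \<tau> (Suc i) t \<in> borel_measurable M"
  using indep_dyn measurable_compose[OF _ measurable_component_singleton[of t UNIV "\<lambda>_. borel"]]
  unfolding indep_vars_def by auto

lemma distributed_dyn: "distributed M lborel (dyn_increment \<xi> \<tau> (Suc i) t) std_normal_density"
proof -
  note [measurable] = rv_dyn
  have "distr M lborel (dyn_increment \<xi> \<tau> (Suc i) t) = std_normal_distribution"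
  proof (rule measure_eqI)
    fix A assume "A \<in> sets (distr M lborel (dyn_increment \<xi> \<tau> (Suc i) t))"
    then have [measurable]: "A \<in> sets borel" by simp
    have "emeasure (distr M lborel (dyn_increment \<xi> \<tau> (Suc i) t)) A
      = (\<integral>\<^sup>+\<omega>. indicator A (dyn_increment \<xi> \<tau> (Suc i) t \<omega>) \<partial>M)"
      by (subst nn_integral_indicator[symmetric], simp, subst nn_integral_distr) auto
    also have "\<dots> = (\<integral>\<^sup>+\<omega>. indicator A (\<xi> (Suc i) (clock_index (hold (Suc i) \<omega>) t) \<omega>) \<partial>M)"
      by (intro nn_integral_cong) (simp add: dyn_increment_eq)
    also have "\<dots> = emeasure std_normal_distribution A"
      by (subst nn_integral_dyn) auto
    finally show "emeasure (distr M lborel (dyn_increment \<xi> \<tau> (Suc i) t)) A = emeasure std_normal_distribution A" .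
  qed simp
  then show ?thesis by (simp add: distributed_def)
qed

lemma AE_regular_clocks: "AE \<omega> in M. \<forall>i. regular_clock (hold (Suc i) \<omega>)"
  using AE_regular_clock by (simp add: AE_all_countable)

lemma AE_jump_neq:
  assumes "i \<ge> 1" shows "AE \<omega> in M. \<forall>k. clock_sum (hold i \<omega>) (Suc k) \<noteq> t"
  unfolding AE_all_countable
proof
  fix k
  have D: "distributed M lborel (\<lambda>\<omega>. clock_sum (hold i \<omega>) (Suc k)) (erlang_density (card {..<Suc k} - 1) 1)"
    unfolding clock_sum_def
    by (rule exponential_distributed_sum)
       (use law_holding_times[OF assms] indep_vars_subset[OF indep_hold[OF assms]] in \<open>auto simp: hold_def[abs_def]\<close>)
  have "emeasure M ((\<lambda>\<omega>. clock_sum (hold i \<omega>) (Suc k)) -` {t} \<inter> space M)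
    = (\<integral>\<^sup>+u. ennreal (erlang_density (card {..<Suc k} - 1) 1 u) * indicator {t} u \<partial>lborel)"
    by (rule distributed_emeasure[OF D]) simp
  also have "\<dots> = 0"
    by (subst nn_integral_indicator_singleton) auto
  finally show "AE \<omega> in M. clock_sum (hold i \<omega>) (Suc k) \<noteq> t"
    using rv_clock(3)[OF assms, of "Suc k"]
    by (intro AE_I'[of "(\<lambda>\<omega>. clock_sum (hold i \<omega>) (Suc k)) -` {t} \<inter> space M"]) (auto simp: null_sets_def)
qed

lemma dyn_right_continuous:
  "AE \<omega> in M. \<forall>i. \<forall>t\<ge>0. \<exists>e>0. \<forall>u\<in>{t..<t + e}. dyn_increment \<xi> \<tau> (Suc i) u \<omega> = dyn_increment \<xi> \<tau> (Suc i) t \<omega>"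
  using AE_regular_clocks AE_space
proof eventually_elim
  case (elim \<omega>)
  have "\<exists>e>0. \<forall>u\<in>{t..<t + e}. dyn_increment \<xi> \<tau> (Suc i) u \<omega> = dyn_increment \<xi> \<tau> (Suc i) t \<omega>"
    if t: "0 \<le> t" for i t
  proof -
    have one: "1 \<le> Suc i" by simp
    have r: "regular_clock (hold (Suc i) \<omega>)" using elim(1) by blast
    define k where "k = clock_index (hold (Suc i) \<omega>) t"
    define e where "e = clock_sum (hold (Suc i) \<omega>) (Suc k) - t"
    have eq: "clock_index (hold (Suc i) \<omega>) u = k" if "u \<in> {t..<t + e}" for u
      using that t regular_clock_index(1)[OF r t]
      by (intro regular_clock_index_eqI[OF r]) (auto simp: e_def k_def)
    have "dyn_increment \<xi> \<tau> (Suc i) u \<omega> = dyn_increment \<xi> \<tau> (Suc i) t \<omega>" if "u \<in> {t..<t + e}" for u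
      unfolding dyn_increment_eq[OF one elim(2)] eq[OF that] k_def ..
    moreover have "e > 0" using regular_clock_index(2)[OF r t] by (simp add: e_def k_def)
    ultimately show ?thesis by blast
  qed
  then show ?case by blast
qed

lemma dyn_locally_constant:
  assumes t: "0 \<le> t"
  shows "AE \<omega> in M. \<forall>i. \<exists>e>0. \<forall>u\<ge>0. \<bar>u - t\<bar> < e \<longrightarrow> dyn_increment \<xi> \<tau> (Suc i) u \<omega> = dyn_increment \<xi> \<tau> (Suc i) t \<omega>"
proof -
  have "AE \<omega> in M. \<forall>k. clock_sum (hold (Suc i) \<omega>) (Suc k) \<noteq> t" for i
    by (rule AE_jump_neq) simp
  then have "AE \<omega> in M. \<forall>i. \<forall>k. clock_sum (hold (Suc i) \<omega>) (Suc k) \<noteq> t"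
    by (subst AE_all_countable) blast
  then show ?thesis
    using AE_regular_clocks AE_space
  proof eventually_elim
    case (elim \<omega>)
    have "\<exists>e>0. \<forall>u\<ge>0. \<bar>u - t\<bar> < e \<longrightarrow> dyn_increment \<xi> \<tau> (Suc i) u \<omega> = dyn_increment \<xi> \<tau> (Suc i) t \<omega>" for i
    proof -
      have one: "1 \<le> Suc i" by simp
      define h where "h = hold (Suc i) \<omega>"
      have r: "regular_clock h" using elim(2) unfolding h_def by blast
      define k where "k = clock_index h t"
      have k: "clock_sum h k \<le> t" "t < clock_sum h (Suc k)"
        using regular_clock_index[OF r t] by (simp_all add: k_def)
      \<comment> \<open>For \<open>k = 0\<close> the left end of the holding interval is time 0,
        which is no jump. No room to the left is required there since only \<open>u \<ge> 0\<close>
        is considered; this covers \<open>t = 0\<close>.\<close>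
      define e where "e = (if k = 0 then clock_sum h (Suc k) - t else min (t - clock_sum h k) (clock_sum h (Suc k) - t))"
      have "clock_sum h k \<noteq> t" if nz: "k \<noteq> 0"
      proof -
        obtain j where "k = Suc j" using nz by (cases k) auto
        then show ?thesis using elim(1) unfolding h_def by blast
      qed
      then have "0 < e" using k by (auto simp: e_def)
      moreover have eq: "clock_index h u = k" if "0 \<le> u" "\<bar>u - t\<bar> < e" for u
        using that by (intro regular_clock_index_eqI[OF r]) (auto simp: e_def split: if_splits)
      have "dyn_increment \<xi> \<tau> (Suc i) u \<omega> = dyn_increment \<xi> \<tau> (Suc i) t \<omega>" if "0 \<le> u" "\<bar>u - t\<bar> < e" for u
        unfolding dyn_increment_eq[OF one elim(3)] h_def[symmetric] eq[OF that] k_def ..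
      ultimately show ?thesis by blast
    qed
    then show ?case by blast
  qed
qed

text \<open>The walk is indexed from 1 and the coordinates of the locale from 0, hence the shift by
  \<open>Suc\<close>.\<close>

sublocale gaussian_dynamics M "\<lambda>i t. dyn_increment \<xi> \<tau> (Suc i) t"
proof unfold_locales
  show "indep_vars (\<lambda>_. PiM UNIV (\<lambda>_::real. borel)) (\<lambda>i \<omega> t. dyn_increment \<xi> \<tau> (Suc i) t \<omega>) UNIV"
    by (rule indep_dyn)
  show "distributed M lborel (dyn_increment \<xi> \<tau> (Suc i) t) std_normal_density" for i t
    by (rule distributed_dyn)
next
  fix i and a s t \<theta> :: real and g :: "real \<Rightarrow> ennreal"
  assume *: "0 \<le> a" "a \<le> s" "s \<le> t" "0 \<le> \<theta>" "mono g" "g \<in> borel_measurable borel"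
  show "(\<integral>\<^sup>+\<omega>. g (dyn_increment \<xi> \<tau> (Suc i) a \<omega>) *
      ennreal (exp (\<theta> * (dyn_increment \<xi> \<tau> (Suc i) t \<omega> - dyn_increment \<xi> \<tau> (Suc i) s \<omega>))) \<partial>M)
    \<le> ennreal (1 + (t - s) * (exp (\<theta>\<^sup>2) - 1)) * (\<integral>\<^sup>+\<omega>. g (dyn_increment \<xi> \<tau> (Suc i) a \<omega>) \<partial>M)"
    using exp_increment_dyn[OF _ *, of "Suc i"] nn_integral_dyn[OF _ *(6), of "Suc i" a]
    by (simp add: dyn_increment_eq cong: nn_integral_cong)
next
  fix i and a s t :: real and T and g :: "real \<Rightarrow> ennreal"
  assume *: "0 \<le> a" "a \<le> s" "s \<le> t" "finite T" "T \<noteq> {}" "T \<subseteq> {s..t}" "mono g" "g \<in> borel_measurable borel"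
  show "(\<integral>\<^sup>+\<omega>. g (dyn_increment \<xi> \<tau> (Suc i) a \<omega>) *
      ennreal (exp (Max ((\<lambda>u. dyn_increment \<xi> \<tau> (Suc i) u \<omega> - dyn_increment \<xi> \<tau> (Suc i) s \<omega>) ` T))) \<partial>M)
    \<le> ennreal (1 + (t - s) * exp 1) * (\<integral>\<^sup>+\<omega>. g (dyn_increment \<xi> \<tau> (Suc i) a \<omega>) \<partial>M)"
    using exp_max_increment_dyn[OF _ *, of "Suc i"] nn_integral_dyn[OF _ *(8), of "Suc i" a]
    by (simp add: dyn_increment_eq cong: nn_integral_cong)
next
  fix i and s t \<theta> :: real assume *: "0 \<le> s" "s \<le> (t::real)"
  show "(\<integral>\<^sup>+\<omega>. ennreal (exp (\<theta> * (dyn_increment \<xi> \<tau> (Suc i) s \<omega> + dyn_increment \<xi> \<tau> (Suc i) t \<omega>))) \<partial>M)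
    \<le> ennreal (exp (\<theta>\<^sup>2) * (1 + exp (- (t - s)) * (exp (\<theta>\<^sup>2) - 1)))"
    using exp_pair_dyn[OF _ *, of "Suc i" \<theta>]
    by (simp add: dyn_increment_eq cong: nn_integral_cong)
qed (rule dyn_right_continuous dyn_locally_constant | assumption)+

text \<open>By symmetry of the normal law the negated walk satisfies the same hypotheses; this turns
  one-sided upper bounds into bounds for the square.\<close>

lemma normal_walk_uminus: "normal_walk M (\<lambda>n k \<omega>. - \<xi> n k \<omega>) \<tau>"
proof -
  have "dynamical_walk M std_normal_distribution (\<lambda>n k \<omega>. - \<xi> n k \<omega>) \<tau>"
  proof unfold_locales
    have "indep_vars (\<lambda>_. borel) (\<lambda>j \<omega>. (case j of Inl _ \<Rightarrow> uminus | Inr _ \<Rightarrow> id) (base j \<omega>)) (({1..} \<times> UNIV) <+> ({1..} \<times> UNIV))"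
      by (rule indep_vars_compose2[OF indep]) (auto split: sum.split)
    also have "(\<lambda>j \<omega>. (case j of Inl _ \<Rightarrow> uminus | Inr _ \<Rightarrow> id) (base j \<omega>)) =
       case_sum (\<lambda>(n, k) \<omega>. - \<xi> n k \<omega>) (\<lambda>(n, k) \<omega>. \<tau> n (Suc k) \<omega> - \<tau> n k \<omega>)"
      by (auto simp: fun_eq_iff split: sum.split)
    finally show "indep_vars (\<lambda>_. borel) (case_sum (\<lambda>(n, k) \<omega>. - \<xi> n k \<omega>) (\<lambda>(n, k) \<omega>. \<tau> n (Suc k) \<omega> - \<tau> n k \<omega>))
      (({1..} \<times> UNIV) <+> ({1..} \<times> UNIV))" .
    fix n k :: nat assume n: "1 \<le> n"
    have "distributed M lborel (\<lambda>\<omega>. 0 + (-1) * \<xi> n k \<omega>) (normal_density (0 + (-1) * 0) (\<bar>-1\<bar> * 1))"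
      by (rule normal_density_affine[OF distributed_xi[OF n]]) auto
    then show "distr M borel (\<lambda>\<omega>. - \<xi> n k \<omega>) = std_normal_distribution"
      by (simp add: distributed_def cong: distr_cong)
  qed (use law_holding_times clock_start clock_strict_mono in auto)
  then show ?thesis by (simp add: normal_walk_def)
qed

end

subsection \<open>Maximal inequality\<close>

text \<open>The last coordinate is split off. With its values frozen, \<open>g (x + A n)\<close> is
  monotone in \<open>x\<close> and the induction hypothesis removes the tilt of the first
  \<open>n\<close> coordinates. What remains is the mean of \<open>g\<close> at the shifted sum,
  again monotone in \<open>A n\<close>, so \<open>step\<close> removes the last tilt. Monotone
  weights are exactly the class that survives both operations.\<close>

lemma (in prob_space) nn_integral_exp_tilt_sum:
  fixes A Y :: "nat \<Rightarrow> 'a \<Rightarrow> real" and g :: "real \<Rightarrow> ennreal"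
  assumes indep: "indep_vars (\<lambda>_. borel \<Otimes>\<^sub>M borel) (\<lambda>i \<omega>. (A i \<omega>, Y i \<omega>)) UNIV"
    and step: "\<And>i (g :: real \<Rightarrow> ennreal). mono g \<Longrightarrow> g \<in> borel_measurable borel \<Longrightarrow>
      (\<integral>\<^sup>+\<omega>. g (A i \<omega>) * ennreal (exp (Y i \<omega>)) \<partial>M) \<le> ennreal c * (\<integral>\<^sup>+\<omega>. g (A i \<omega>) \<partial>M)"
    and c: "0 \<le> c" and g: "mono g" "g \<in> borel_measurable borel"
  shows "(\<integral>\<^sup>+\<omega>. g (\<Sum>i<n. A i \<omega>) * ennreal (exp (\<Sum>i<n. Y i \<omega>)) \<partial>M)
    \<le> ennreal (c ^ n) * (\<integral>\<^sup>+\<omega>. g (\<Sum>i<n. A i \<omega>) \<partial>M)"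
  using g
proof (induction n arbitrary: g)
  case 0
  then show ?case by simp
next
  case (Suc n)
  note [measurable] = Suc.prems(2)
  let ?B = "borel \<Otimes>\<^sub>M borel :: (real \<times> real) measure"
  have rv: "(\<lambda>\<omega>. (A i \<omega>, Y i \<omega>)) \<in> measurable M ?B" for i
    using indep unfolding indep_vars_def by blast
  have [measurable]: "A i \<in> borel_measurable M" "Y i \<in> borel_measurable M" for i
    using measurable_compose[OF rv[of i] measurable_fst] measurable_compose[OF rv[of i] measurable_snd] by simp_all
  have "indep_var (PiM {n} (\<lambda>_. ?B)) (\<lambda>\<omega>. restrict (\<lambda>i. (A i \<omega>, Y i \<omega>)) {n})
      (PiM {..<n} (\<lambda>_. ?B)) (\<lambda>\<omega>. restrict (\<lambda>i. (A i \<omega>, Y i \<omega>)) {..<n})"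
    by (rule indep_var_restrict[OF indep]) auto
  then have "indep_var ?B ((\<lambda>f. f n) \<circ> (\<lambda>\<omega>. restrict (\<lambda>i. (A i \<omega>, Y i \<omega>)) {n}))
     ?B ((\<lambda>f. (\<Sum>i<n. fst (f i), \<Sum>i<n. snd (f i))) \<circ> (\<lambda>\<omega>. restrict (\<lambda>i. (A i \<omega>, Y i \<omega>)) {..<n}))"
    by (rule indep_var_compose) auto
  then have ind: "indep_var ?B (\<lambda>\<omega>. (A n \<omega>, Y n \<omega>)) ?B (\<lambda>\<omega>. (\<Sum>i<n. A i \<omega>, \<Sum>i<n. Y i \<omega>))"
    by (simp add: comp_def)
  let ?S = "\<lambda>\<omega>. \<Sum>i<n. A i \<omega>" and ?T = "\<lambda>\<omega>. \<Sum>i<n. Y i \<omega>"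
  define g2 where "g2 x = (\<integral>\<^sup>+\<omega>. g (?S \<omega> + x) \<partial>M)" for x
  have g2: "mono g2" unfolding g2_def
    by (intro monoI nn_integral_mono monoD[OF Suc.prems(1)]) auto
  have g2m [measurable]: "g2 \<in> borel_measurable borel" unfolding g2_def by measurable
  have "(\<integral>\<^sup>+\<omega>. g (\<Sum>i<Suc n. A i \<omega>) * ennreal (exp (\<Sum>i<Suc n. Y i \<omega>)) \<partial>M)
    = (\<integral>\<^sup>+\<omega>. (\<lambda>(u, v). g (fst v + fst u) * ennreal (exp (snd v)) * ennreal (exp (snd u))) ((A n \<omega>, Y n \<omega>), (?S \<omega>, ?T \<omega>)) \<partial>M)"
    by (intro nn_integral_cong) (simp add: exp_add ennreal_mult mult_ac)
  also have "\<dots> = (\<integral>\<^sup>+\<omega>'. \<integral>\<^sup>+\<omega>. g (?S \<omega> + A n \<omega>') * ennreal (exp (?T \<omega>)) * ennreal (exp (Y n \<omega>')) \<partial>M \<partial>M)"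
    by (subst indep_var_nn_integral_pair[OF ind]) auto
  also have "\<dots> = (\<integral>\<^sup>+\<omega>'. (\<integral>\<^sup>+\<omega>. g (?S \<omega> + A n \<omega>') * ennreal (exp (?T \<omega>)) \<partial>M) * ennreal (exp (Y n \<omega>')) \<partial>M)"
    by (intro nn_integral_cong nn_integral_multc) measurable
  also have "\<dots> \<le> (\<integral>\<^sup>+\<omega>'. (ennreal (c ^ n) * g2 (A n \<omega>')) * ennreal (exp (Y n \<omega>')) \<partial>M)"
  proof (intro nn_integral_mono mult_right_mono)
    fix \<omega>'
    show "(\<integral>\<^sup>+\<omega>. g (?S \<omega> + A n \<omega>') * ennreal (exp (?T \<omega>)) \<partial>M) \<le> ennreal (c ^ n) * g2 (A n \<omega>')"
      unfolding g2_def
      by (rule Suc.IH[of "\<lambda>x. g (x + A n \<omega>')"]) (auto intro!: monoI monoD[OF Suc.prems(1)])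
  qed simp
  also have "\<dots> = ennreal (c ^ n) * (\<integral>\<^sup>+\<omega>'. g2 (A n \<omega>') * ennreal (exp (Y n \<omega>')) \<partial>M)"
    by (subst nn_integral_cmult[symmetric]) (auto simp: mult.assoc)
  also have "\<dots> \<le> ennreal (c ^ n) * (ennreal c * (\<integral>\<^sup>+\<omega>'. g2 (A n \<omega>') \<partial>M))"
    by (intro mult_left_mono step g2 g2m) simp
  also have "(\<integral>\<^sup>+\<omega>'. g2 (A n \<omega>') \<partial>M) = (\<integral>\<^sup>+\<omega>. (\<lambda>(u, v). g (fst v + fst u)) ((A n \<omega>, Y n \<omega>), (?S \<omega>, ?T \<omega>)) \<partial>M)"
    unfolding g2_def by (subst indep_var_nn_integral_pair[OF ind]) auto
  also have "\<dots> = (\<integral>\<^sup>+\<omega>. g (\<Sum>i<Suc n. A i \<omega>) \<partial>M)" by simp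
  finally show ?case using c by (simp add: ennreal_mult mult_ac)
qed

lemma exp_minus_one_le:
  fixes x :: real assumes "0 \<le> x" "x \<le> 1" shows "exp x - 1 \<le> 3 * x"
proof -
  have "exp x * (1 - x) \<le> exp x * exp (- x)"
    using exp_ge_add_one_self[of "- x"] by (intro mult_left_mono) auto
  then have "exp x - 1 \<le> x * exp x" by (simp add: exp_add[symmetric] algebra_simps)
  have "exp x \<le> exp 1" using assms by simp
  then have "x * exp x \<le> x * 3" using exp_le assms by (intro mult_left_mono) linarith+
  with \<open>exp x - 1 \<le> x * exp x\<close> show ?thesis by simp
qed

context gaussian_dynamics
begin

definition S :: "nat \<Rightarrow> real \<Rightarrow> 'w \<Rightarrow> real" where "S n t \<omega> = (\<Sum>i<n. X i t \<omega>)"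

lemma rv_path: "(\<lambda>\<omega> t. X i t \<omega>) \<in> measurable M (PiM UNIV (\<lambda>_. borel))"
  using indep_X unfolding indep_vars_def by blast

lemma rv_X [measurable]: "X i t \<in> borel_measurable M"
  using measurable_compose[OF rv_path measurable_component_singleton[of t]] by simp

lemma rv_S [measurable]: "S n t \<in> borel_measurable M"
  unfolding S_def[abs_def] by measurable

lemma prob_sum_X:
  assumes "finite I" "I \<noteq> {}" "0 \<le> t"
  shows "prob {\<omega>\<in>space M. y < (\<Sum>i\<in>I. X i t \<omega>)} = normal_tail (y / sqrt (card I))"
    and "prob {\<omega>\<in>space M. (\<Sum>i\<in>I. X i t \<omega>) < - y} = normal_tail (y / sqrt (card I))"
proof -
  let ?s = "sqrt (real (card I))"
  have pos: "?s > 0" using assms by (simp add: card_gt_0_iff)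
  have ind: "indep_vars (\<lambda>_. borel) (\<lambda>i \<omega>. (\<lambda>f. f t) (\<lambda>t. X i t \<omega>)) UNIV"
    by (rule indep_vars_compose2[OF indep_X]) measurable
  have "distributed M lborel (\<lambda>\<omega>. \<Sum>i\<in>I. X i t \<omega>) (normal_density (\<Sum>i\<in>I. 0) (sqrt (\<Sum>i\<in>I. 1\<^sup>2)))"
    by (rule sum_indep_normal) (use assms normal_X indep_vars_subset[OF ind] in auto)
  then have "distributed M lborel (\<lambda>\<omega>. \<Sum>i\<in>I. X i t \<omega>) (normal_density 0 ?s)" by simp
  then have "distributed M lborel (\<lambda>\<omega>. 0 + (1 / ?s) * (\<Sum>i\<in>I. X i t \<omega>)) (normal_density (0 + (1 / ?s) * 0) (\<bar>1 / ?s\<bar> * ?s))"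
    by (rule normal_density_affine) (use pos in auto)
  then have D: "distributed M lborel (\<lambda>\<omega>. (\<Sum>i\<in>I. X i t \<omega>) / ?s) std_normal_density"
    using pos by simp
  show "prob {\<omega>\<in>space M. y < (\<Sum>i\<in>I. X i t \<omega>)} = normal_tail (y / sqrt (card I))"
    unfolding normal_tail_prob(1)[OF D, symmetric] using pos
    by (intro arg_cong[where f=prob] Collect_cong conj_cong refl) (simp add: divide_less_cancel)
  have "s < - y \<longleftrightarrow> s / ?s < - (y / ?s)" for s
    unfolding minus_divide_left using pos by (subst divide_less_cancel) auto
  then show "prob {\<omega>\<in>space M. (\<Sum>i\<in>I. X i t \<omega>) < - y} = normal_tail (y / sqrt (card I))"
    unfolding normal_tail_prob(2)[OF D, symmetric] by simp
qed

lemma indep_pair: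
  assumes [measurable]: "\<And>i. F i \<in> borel_measurable (PiM UNIV (\<lambda>_::real. borel :: real measure))"
  shows "indep_vars (\<lambda>_. borel \<Otimes>\<^sub>M borel) (\<lambda>i \<omega>. (X i a \<omega>, F i (\<lambda>t. X i t \<omega>) :: real)) UNIV"
proof -
  have "indep_vars (\<lambda>_. borel \<Otimes>\<^sub>M borel) (\<lambda>i \<omega>. (\<lambda>f. (f a, F i f)) (\<lambda>t. X i t \<omega>)) UNIV"
    by (rule indep_vars_compose2[OF indep_X]) measurable
  then show ?thesis by simp
qed

text \<open>Exponential Markov inequality under the weight \<open>g\<close>. The constant 48 is 16 *
  3: both applications have a variance proxy of at most 16, and 3 comes from
  \<open>exp x - 1 \<le> 3 * x\<close> in one of them and from \<open>exp 1 \<le> 3\<close> in the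
  other.\<close>

lemma markov_tilt:
  fixes g :: "real \<Rightarrow> ennreal" and Y :: "'w \<Rightarrow> real"
  assumes [measurable]: "Y \<in> borel_measurable M" "g \<in> borel_measurable borel"
    and b: "(\<integral>\<^sup>+\<omega>. g (S N a \<omega>) * ennreal (exp (Y \<omega>)) \<partial>M) \<le> ennreal c * (\<integral>\<^sup>+\<omega>. g (S N a \<omega>) \<partial>M)"
    and c: "c \<le> exp 48" and x: "z \<le> x"
  shows "(\<integral>\<^sup>+\<omega>. g (S N a \<omega>) * indicator {\<omega>. x < Y \<omega>} \<omega> \<partial>M)
    \<le> ennreal (exp (48 - z)) * (\<integral>\<^sup>+\<omega>. g (S N a \<omega>) \<partial>M)"
proof -
  have "(\<integral>\<^sup>+\<omega>. g (S N a \<omega>) * indicator {\<omega>. x < Y \<omega>} \<omega> \<partial>M)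
    \<le> (\<integral>\<^sup>+\<omega>. ennreal (exp (- z)) * (g (S N a \<omega>) * ennreal (exp (Y \<omega>))) \<partial>M)"
  proof (rule nn_integral_mono)
    fix \<omega>
    have "1 \<le> ennreal (exp (- z)) * ennreal (exp (Y \<omega>))" if "x < Y \<omega>"
      using that x by (simp add: ennreal_mult[symmetric] exp_add[symmetric] ennreal_1[symmetric] del: ennreal_1)
    then have "(indicator {\<omega>. x < Y \<omega>} \<omega> :: ennreal) \<le> ennreal (exp (- z)) * ennreal (exp (Y \<omega>))"
      by (auto split: split_indicator)
    then have "g (S N a \<omega>) * indicator {\<omega>. x < Y \<omega>} \<omega> \<le> g (S N a \<omega>) * (ennreal (exp (- z)) * ennreal (exp (Y \<omega>)))"
      by (rule mult_left_mono) simp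
    then show "g (S N a \<omega>) * indicator {\<omega>. x < Y \<omega>} \<omega> \<le> ennreal (exp (- z)) * (g (S N a \<omega>) * ennreal (exp (Y \<omega>)))"
      by (simp add: mult_ac)
  qed
  also have "\<dots> = ennreal (exp (- z)) * (\<integral>\<^sup>+\<omega>. g (S N a \<omega>) * ennreal (exp (Y \<omega>)) \<partial>M)"
    by (rule nn_integral_cmult) measurable
  also have "\<dots> \<le> ennreal (exp (- z)) * (ennreal c * (\<integral>\<^sup>+\<omega>. g (S N a \<omega>) \<partial>M))"
    by (intro mult_left_mono b) simp
  also have "\<dots> \<le> ennreal (exp (- z)) * (ennreal (exp 48) * (\<integral>\<^sup>+\<omega>. g (S N a \<omega>) \<partial>M))"
    by (intro mult_left_mono mult_right_mono ennreal_leI c) simp_all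
  also have "\<dots> = ennreal (exp (48 - z)) * (\<integral>\<^sup>+\<omega>. g (S N a \<omega>) \<partial>M)"
    by (simp add: mult.assoc[symmetric] ennreal_mult[symmetric] exp_add[symmetric])
  finally show ?thesis .
qed

lemma power_one_plus_le_exp: "0 \<le> x \<Longrightarrow> real n * x \<le> y \<Longrightarrow> (1 + x) ^ n \<le> exp y" for x y :: real
  using power_mono[OF exp_ge_add_one_self[of x], of n]
  by (simp add: exp_of_nat_mult[symmetric]) (meson exp_le_cancel_iff order_trans)

lemma increment_tail:
  fixes g :: "real \<Rightarrow> ennreal"
  assumes t: "0 \<le> a" "a \<le> s" "s \<le> t" and \<theta>: "0 \<le> \<theta>" "\<theta> \<le> 1" and g: "mono g" "g \<in> borel_measurable borel"
    and N: "real N * (t - s) * (3 * \<theta>\<^sup>2) \<le> 48" and z: "z \<le> \<theta> * x"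
  shows "(\<integral>\<^sup>+\<omega>. g (S N a \<omega>) * indicator {\<omega>. x < S N t \<omega> - S N s \<omega>} \<omega> \<partial>M)
    \<le> ennreal (exp (48 - z)) * (\<integral>\<^sup>+\<omega>. g (S N a \<omega>) \<partial>M)"
proof (cases "\<theta> = 0")
  case True
  have "(\<integral>\<^sup>+\<omega>. g (S N a \<omega>) * indicator {\<omega>. x < S N t \<omega> - S N s \<omega>} \<omega> \<partial>M) \<le> (\<integral>\<^sup>+\<omega>. g (S N a \<omega>) \<partial>M)"
    by (intro nn_integral_mono) (auto split: split_indicator)
  also have "\<dots> = ennreal 1 * \<dots>" by simp
  also have "\<dots> \<le> ennreal (exp (48 - z)) * (\<integral>\<^sup>+\<omega>. g (S N a \<omega>) \<partial>M)"
    using z True by (intro mult_right_mono ennreal_leI) auto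
  finally show ?thesis .
next
  case False
  then have \<theta>': "\<theta> > 0" using \<theta> by simp
  define c where "c = 1 + (t - s) * (exp (\<theta>\<^sup>2) - 1)"
  have "\<theta>\<^sup>2 \<le> 1" using \<theta> by (simp add: power_le_one)
  then have e: "exp (\<theta>\<^sup>2) - 1 \<le> 3 * \<theta>\<^sup>2" by (intro exp_minus_one_le) auto
  have c: "c ^ N \<le> exp 48"
    unfolding c_def
  proof (rule power_one_plus_le_exp)
    have "real N * (t - s) * (exp (\<theta>\<^sup>2) - 1) \<le> real N * (t - s) * (3 * \<theta>\<^sup>2)"
      using e t by (intro mult_left_mono) auto
    then show "real N * ((t - s) * (exp (\<theta>\<^sup>2) - 1)) \<le> 48" using N by (simp add: mult.assoc)
  qed (use t in auto)
  have *: "(\<Sum>i<N. \<theta> * (X i t \<omega> - X i s \<omega>)) = \<theta> * (S N t \<omega> - S N s \<omega>)" for \<omega>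
    by (simp add: S_def sum_subtractf sum_distrib_left[symmetric])
  have "(\<integral>\<^sup>+\<omega>. g (\<Sum>i<N. X i a \<omega>) * ennreal (exp (\<Sum>i<N. \<theta> * (X i t \<omega> - X i s \<omega>))) \<partial>M)
    \<le> ennreal (c ^ N) * (\<integral>\<^sup>+\<omega>. g (\<Sum>i<N. X i a \<omega>) \<partial>M)"
  proof (rule nn_integral_exp_tilt_sum)
    show "indep_vars (\<lambda>_. borel \<Otimes>\<^sub>M borel) (\<lambda>i \<omega>. (X i a \<omega>, \<theta> * (X i t \<omega> - X i s \<omega>))) UNIV"
      using indep_pair[of "\<lambda>i f. \<theta> * (f t - f s)"] by simp
    show "0 \<le> c" using t unfolding c_def by (intro add_nonneg_nonneg mult_nonneg_nonneg) auto
  qed (use exp_increment[OF t \<theta>(1)] g in \<open>auto simp: c_def\<close>)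
  then have b: "(\<integral>\<^sup>+\<omega>. g (S N a \<omega>) * ennreal (exp (\<theta> * (S N t \<omega> - S N s \<omega>))) \<partial>M)
    \<le> ennreal (c ^ N) * (\<integral>\<^sup>+\<omega>. g (S N a \<omega>) \<partial>M)"
    unfolding * S_def[symmetric] .
  have "(\<integral>\<^sup>+\<omega>. g (S N a \<omega>) * indicator {\<omega>. \<theta> * x < \<theta> * (S N t \<omega> - S N s \<omega>)} \<omega> \<partial>M)
    \<le> ennreal (exp (48 - z)) * (\<integral>\<^sup>+\<omega>. g (S N a \<omega>) \<partial>M)"
    by (rule markov_tilt[OF _ g(2) b c z]) measurable
  then show ?thesis using \<theta>' by simp
qed

text \<open>The maximum of the sums is bounded by the sum of the coordinatewise maxima. This is
  affordable because \<open>N * (t - s)\<close>, the expected number of jumps of all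
  \<open>N\<close> clocks together, is bounded.\<close>

lemma max_increment_tail:
  fixes g :: "real \<Rightarrow> ennreal"
  assumes t: "0 \<le> a" "a \<le> s" "s \<le> t" and T: "finite T" "T \<subseteq> {s..t}" and g: "mono g" "g \<in> borel_measurable borel"
    and N: "real N * (t - s) * 3 \<le> 48" and z: "z \<le> x"
  shows "(\<integral>\<^sup>+\<omega>. g (S N a \<omega>) * indicator {\<omega>. \<exists>u\<in>T. x < S N u \<omega> - S N s \<omega>} \<omega> \<partial>M)
    \<le> ennreal (exp (48 - z)) * (\<integral>\<^sup>+\<omega>. g (S N a \<omega>) \<partial>M)"
proof (cases "T = {}")
  case False
  define c where "c = 1 + (t - s) * exp (1::real)"
  have c: "c ^ N \<le> exp 48"
    unfolding c_def
  proof (rule power_one_plus_le_exp)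
    have "real N * (t - s) * exp 1 \<le> real N * (t - s) * 3"
      using t exp_le by (intro mult_left_mono) auto
    then show "real N * ((t - s) * exp 1) \<le> 48" using N by (simp add: mult.assoc)
  qed (use t in auto)
  let ?Y = "\<lambda>i \<omega>. Max ((\<lambda>u. X i u \<omega> - X i s \<omega>) ` T)"
  have [measurable]: "(\<lambda>f. Max ((\<lambda>u. f u - f s) ` T)) \<in> borel_measurable (PiM UNIV (\<lambda>_::real. borel :: real measure))"
    using T by (intro borel_measurable_Max) auto
  have [measurable]: "?Y i \<in> borel_measurable M" for i
    using T by (intro borel_measurable_Max) auto
  have b: "(\<integral>\<^sup>+\<omega>. g (S N a \<omega>) * ennreal (exp (\<Sum>i<N. ?Y i \<omega>)) \<partial>M)
    \<le> ennreal (c ^ N) * (\<integral>\<^sup>+\<omega>. g (S N a \<omega>) \<partial>M)"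
    unfolding S_def
  proof (rule nn_integral_exp_tilt_sum)
    show "indep_vars (\<lambda>_. borel \<Otimes>\<^sub>M borel) (\<lambda>i \<omega>. (X i a \<omega>, ?Y i \<omega>)) UNIV"
      using indep_pair[of "\<lambda>i f. Max ((\<lambda>u. f u - f s) ` T)"] by simp
    show "0 \<le> c" using t unfolding c_def by (intro add_nonneg_nonneg mult_nonneg_nonneg) auto
  qed (use exp_max_increment[OF t T(1) False T(2)] g in \<open>auto simp: c_def\<close>)
  have "(\<integral>\<^sup>+\<omega>. g (S N a \<omega>) * indicator {\<omega>. \<exists>u\<in>T. x < S N u \<omega> - S N s \<omega>} \<omega> \<partial>M)
    \<le> (\<integral>\<^sup>+\<omega>. g (S N a \<omega>) * indicator {\<omega>. x < (\<Sum>i<N. ?Y i \<omega>)} \<omega> \<partial>M)"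
  proof (intro nn_integral_mono mult_left_mono)
    fix \<omega>
    have "S N u \<omega> - S N s \<omega> \<le> (\<Sum>i<N. ?Y i \<omega>)" if "u \<in> T" for u
      unfolding S_def sum_subtractf[symmetric] using that T by (intro sum_mono Max_ge) auto
    then show "(indicator {\<omega>. \<exists>u\<in>T. x < S N u \<omega> - S N s \<omega>} \<omega> :: ennreal) \<le> indicator {\<omega>. x < (\<Sum>i<N. ?Y i \<omega>)} \<omega>"
      by (auto split: split_indicator intro: less_le_trans)
  qed simp
  also have "\<dots> \<le> ennreal (exp (48 - z)) * (\<integral>\<^sup>+\<omega>. g (S N a \<omega>) \<partial>M)"
    by (rule markov_tilt[OF _ g(2) b c z]) measurable
  finally show ?thesis .
qed simp

end

lemma floor_div_16: "nat \<lfloor>16 * x\<rfloor> div 16 = nat \<lfloor>x\<rfloor>" if "0 \<le> x" for x :: real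
proof -
  have "\<lfloor>x\<rfloor> = \<lfloor>16 * x\<rfloor> div 16"
    using floor_divide_real_eq_div[of 16 "16 * x"] by simp
  then show ?thesis using that by (simp add: nat_div_distrib)
qed

text \<open>Level \<open>l\<close> of the chaining has \<open>16 ^ l\<close> points, each with the
  exponent \<open>2 ^ l * 10 * k\<close>. Since \<open>2 ^ l\<close> outgrows \<open>6 * l\<close>
  and \<open>32 \<le> exp 6\<close>, the union bound over level \<open>l\<close> costs at most a
  summand of a geometric series.\<close>

lemma chain_weight:
  fixes k :: real assumes "1 \<le> k"
  shows "16 ^ l * exp (48 - 2 ^ l * 10 * k) \<le> exp (48 - 4 * k) / 2 ^ l"
proof -
  have "(32::real) \<le> exp 6"
  proof -
    have "(2::real) ^ 6 \<le> exp 1 ^ 6" using exp_ge_add_one_self[of 1] by (intro power_mono) auto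
    then show ?thesis by (simp add: exp_of_nat_mult[symmetric])
  qed
  then have "(32::real) ^ l \<le> exp 6 ^ l" by (intro power_mono) auto
  also have "\<dots> = exp (6 * real l)" by (simp add: exp_of_nat_mult[symmetric] mult.commute)
  also have "\<dots> \<le> exp (2 ^ l * 10 * k - 4 * k)"
  proof -
    have l: "real l \<le> 2 ^ l" by (metis less_exp less_le of_nat_le_iff of_nat_numeral of_nat_power)
    have one: "(1::real) \<le> 2 ^ l" by simp
    have "6 * real l + 4 \<le> 6 * 2 ^ l + 4 * 2 ^ l" by (intro add_mono mult_left_mono l) (use one in auto)
    then have "6 * real l \<le> (2 ^ l * 10 - 4) * 1" by (simp add: algebra_simps)
    also have "\<dots> \<le> (2 ^ l * 10 - 4) * k" using assms one by (intro mult_left_mono) linarith+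
    finally show ?thesis by (simp add: algebra_simps)
  qed
  finally have *: "(32::real) ^ l \<le> exp (2 ^ l * 10 * k - 4 * k)" .
  have "16 ^ l * exp (48 - 2 ^ l * 10 * k) * 2 ^ l = 32 ^ l * exp (48 - 2 ^ l * 10 * k)"
    by (simp add: power_mult_distrib[symmetric])
  also have "\<dots> \<le> exp (2 ^ l * 10 * k - 4 * k) * exp (48 - 2 ^ l * 10 * k)"
    using * by (intro mult_right_mono) auto
  also have "\<dots> = exp (48 - 4 * k)" by (simp add: exp_add[symmetric])
  finally show ?thesis by (simp add: field_simps)
qed

context gaussian_dynamics
begin

text \<open>
  Chaining along the grids of mesh \<open>\<epsilon> / 16 ^ l\<close>, the share of level \<open>l\<close> in the increment being
  \<open>2 ^ - l\<close>.  The exponential tilt of level \<open>l\<close> is \<open>4 ^ l * 10 * H / sqrt N\<close>; it stays below 1 up to level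
  \<open>L\<close>, where the mesh is of order \<open>1 / N\<close> and the maximum over a cell can be bounded directly.
\<close>

lemma chain_tail:
  fixes g :: "real \<Rightarrow> ennreal"
  assumes a: "0 \<le> a" and H: "0 < H" "10 * H \<le> sqrt (real N)" and k: "1 \<le> k"
    and T: "finite T" "T \<subseteq> {a..<a + 1 / (100 * H\<^sup>2)}" and g: "mono g" "g \<in> borel_measurable borel"
  shows "(\<integral>\<^sup>+\<omega>. g (S N a \<omega>) * indicator {\<omega>. \<exists>t\<in>T. sqrt (real N) * k / H < S N t \<omega> - S N a \<omega>} \<omega> \<partial>M)
    \<le> ennreal (exp (48 - 4 * k)) * (\<integral>\<^sup>+\<omega>. g (S N a \<omega>) \<partial>M)"
proof -
  note [measurable] = g(2)
  define eps where "eps = 1 / (100 * H\<^sup>2)"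
  define w where "w = sqrt (real N) * k / H"
  define mesh where "mesh l = eps / 16 ^ l" for l :: nat
  define J where "J l t = nat \<lfloor>(t - a) / mesh l\<rfloor>" for l t
  define p where "p l j = a + real j * mesh l" for l j
  define G where "G = (\<integral>\<^sup>+\<omega>. g (S N a \<omega>) \<partial>M)"
  have sN: "sqrt (real N) > 0" using H by linarith
  have eps: "eps > 0" using H by (simp add: eps_def)
  have mesh: "mesh l > 0" for l using eps by (simp add: mesh_def)
  \<comment> \<open>The last level whose tilt is at most 1. The tilt of the next level exceeds 1,
    and squaring this inequality gives \<open>N * mesh L \<le> 16\<close>.\<close>
  define L where "L = (LEAST l. sqrt (real N) < 4 ^ Suc l * 10 * H)"
  have "\<exists>l. sqrt (real N) < 4 ^ Suc l * 10 * H"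
  proof -
    obtain l where "sqrt (real N) / (10 * H) < 4 ^ l"
      using real_arch_pow[of 4 "sqrt (real N) / (10 * H)"] by auto
    then have "sqrt (real N) < 4 ^ l * 10 * H" using H by (simp add: field_simps)
    also have "\<dots> \<le> 4 ^ Suc l * 10 * H" using H by simp
    finally show ?thesis by blast
  qed
  then have L1: "sqrt (real N) < 4 ^ Suc L * 10 * H" unfolding L_def by (rule LeastI_ex)
  have L2: "4 ^ l * 10 * H \<le> sqrt (real N)" if "l \<le> L" for l
  proof (cases l)
    case 0 then show ?thesis using H by simp
  next
    case (Suc l')
    then have "\<not> sqrt (real N) < 4 ^ Suc l' * 10 * H"
      using that not_less_Least[of l' "\<lambda>l. sqrt (real N) < 4 ^ Suc l * 10 * H"] by (simp add: L_def)
    then show ?thesis using Suc by simp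
  qed
  have J: "p l (J l t) \<le> t" "t < p l (J l t) + mesh l" "J l t < 16 ^ l" "J l t = J (Suc l) t div 16"
    if "t \<in> T" for l t
  proof -
    have ta: "0 \<le> t - a" "t - a < eps" using that T by (auto simp: eps_def)
    define q where "q = (t - a) / mesh l"
    have "(t - a) / eps < 1" using ta eps by (simp only: divide_less_eq_1_pos)
    then have q: "0 \<le> q" "q < 16 ^ l"
      using ta mesh[of l] eps mult_strict_right_mono[of "(t - a) / eps" 1 "16 ^ l"] by (auto simp: q_def mesh_def)
    have fl: "real (J l t) \<le> q" "q < real (J l t) + 1"
      using q(1) unfolding J_def q_def[symmetric] by (auto simp: of_nat_nat)
    have tq: "t = a + q * mesh l" using mesh[of l] by (simp add: q_def)
    show "p l (J l t) \<le> t" unfolding p_def using tq mesh[of l] fl(1) by simp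
    have "q * mesh l < (real (J l t) + 1) * mesh l" using fl(2) mesh[of l] by simp
    then show "t < p l (J l t) + mesh l" unfolding p_def using tq by (simp add: distrib_right)
    have "real (J l t) < 16 ^ l" using fl(1) q(2) by (rule le_less_trans)
    then show "J l t < 16 ^ l" by (metis of_nat_less_iff of_nat_numeral of_nat_power)
    have "(t - a) / mesh (Suc l) = 16 * q" by (simp add: q_def mesh_def)
    then show "J l t = J (Suc l) t div 16" unfolding J_def q_def[symmetric] using floor_div_16[OF q(1)] by simp
  qed
  have J0: "p 0 (J 0 t) = a" if "t \<in> T" for t using J(3)[OF that, of 0] by (simp add: p_def)
  \<comment> \<open>A grid point of level \<open>l\<close> is compared with its parent
    \<open>j div 16\<close>; \<open>B j\<close> below takes care of what happens inside a cell of
    the last level.\<close>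
  define A where "A l j = {\<omega>. w / 2 ^ l < S N (p l j) \<omega> - S N (p (l - 1) (j div 16)) \<omega>}" for l j
  define B where "B j = {\<omega>. \<exists>u\<in>{t\<in>T. J L t = j}. w / 2 ^ L < S N u \<omega> - S N (p L j) \<omega>}" for j
  have [measurable]: "Measurable.pred M (\<lambda>\<omega>. \<omega> \<in> A l j)" for l j unfolding A_def by simp
  have [measurable]: "Measurable.pred M (\<lambda>\<omega>. \<omega> \<in> B j)" for j
  proof -
    have "finite {t\<in>T. J L t = j}" using T by simp
    then have [measurable]: "countable {t\<in>T. J L t = j}" by (rule countable_finite)
    show ?thesis unfolding B_def mem_Collect_eq by measurable
  qed
  \<comment> \<open>Outside all events \<open>A\<close> and \<open>B\<close> the chain from
    \<open>a\<close> to \<open>t\<close> telescopes to at most \<open>w * (1 - 1 / 2 ^ L)\<close>,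
    and the last cell adds at most \<open>w / 2 ^ L\<close>.\<close>
  have cover: "indicator {\<omega>. \<exists>t\<in>T. w < S N t \<omega> - S N a \<omega>} \<omega>
      \<le> (\<Sum>l\<in>{1..L}. \<Sum>j<16^l. indicator (A l j) \<omega>) + (\<Sum>j<16^L. indicator (B j) \<omega> :: ennreal)" for \<omega>
  proof (cases "(\<exists>l\<in>{1..L}. \<exists>j<16^l. \<omega> \<in> A l j) \<or> (\<exists>j<16^L. \<omega> \<in> B j)")
    case True
    then have "1 \<le> (\<Sum>l\<in>{1..L}. \<Sum>j<16^l. indicator (A l j) \<omega>) + (\<Sum>j<16^L. indicator (B j) \<omega> :: ennreal)"
    proof
      assume "\<exists>l\<in>{1..L}. \<exists>j<16^l. \<omega> \<in> A l j"
      then obtain l j where lj: "l \<in> {1..L}" "j < 16^l" "\<omega> \<in> A l j" by auto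
      have "(1::ennreal) = indicator (A l j) \<omega>" using lj by simp
      also have "\<dots> \<le> (\<Sum>j<16^l. indicator (A l j) \<omega>)" using lj by (intro member_le_sum) auto
      also have "\<dots> \<le> (\<Sum>l\<in>{1..L}. \<Sum>j<16^l. indicator (A l j) \<omega>)"
        using lj by (intro member_le_sum[of l "{1..L}" "\<lambda>l. \<Sum>j<16^l. indicator (A l j) \<omega>"]) auto
      finally show ?thesis by (simp add: add_increasing2)
    next
      assume "\<exists>j<16^L. \<omega> \<in> B j"
      then obtain j where j: "j < 16^L" "\<omega> \<in> B j" by auto
      have "(1::ennreal) = indicator (B j) \<omega>" using j by simp
      also have "\<dots> \<le> (\<Sum>j<16^L. indicator (B j) \<omega>)" using j by (intro member_le_sum) auto
      finally show ?thesis by (simp add: add_increasing)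
    qed
    then show ?thesis by (simp split: split_indicator)
  next
    case False
    have "S N t \<omega> - S N a \<omega> \<le> w" if t: "t \<in> T" for t
    proof -
      have "S N (p l (J l t)) \<omega> - S N a \<omega> \<le> w * (1 - 1 / 2 ^ l)" if "l \<le> L" for l
        using that
      proof (induction l)
        case 0 then show ?case using J0[OF t] by simp
      next
        case (Suc l)
        have "\<omega> \<notin> A (Suc l) (J (Suc l) t)" using False Suc.prems J(3)[OF t, of "Suc l"] by auto
        then have "S N (p (Suc l) (J (Suc l) t)) \<omega> - S N (p l (J l t)) \<omega> \<le> w / 2 ^ Suc l"
          using J(4)[OF t, of l] by (simp add: A_def not_less)
        then show ?case using Suc by (simp add: field_simps)
      qed
      from this[of L] have "S N (p L (J L t)) \<omega> - S N a \<omega> \<le> w * (1 - 1 / 2 ^ L)" by simp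
      moreover have "S N t \<omega> - S N (p L (J L t)) \<omega> \<le> w / 2 ^ L"
      proof -
        have "\<omega> \<notin> B (J L t)" using False J(3)[OF t, of L] by blast
        then show ?thesis using t unfolding B_def by (auto simp: not_less)
      qed
      moreover have "w * (1 - 1 / 2 ^ L) = w - w / 2 ^ L" by (simp add: algebra_simps)
      ultimately show ?thesis by linarith
    qed
    then show ?thesis by (auto simp: not_less split: split_indicator)
  qed
  have boundA: "(\<integral>\<^sup>+\<omega>. g (S N a \<omega>) * indicator (A l j) \<omega> \<partial>M) \<le> ennreal (exp (48 - 2 ^ l * 10 * k)) * G"
    if l: "l \<in> {1..L}" for l j
    unfolding A_def G_def
  proof (rule increment_tail[where \<theta>="4 ^ l * 10 * H / sqrt (real N)"])
    obtain l' where l': "l = Suc l'" using l by (cases l) auto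
    have "j = 16 * (j div 16) + j mod 16" by simp
    then have "real j = 16 * real (j div 16) + real (j mod 16)"
      by (metis of_nat_add of_nat_mult of_nat_numeral)
    then have diff: "p l j - p (l - 1) (j div 16) = real (j mod 16) * mesh l"
      by (simp add: p_def l' mesh_def field_simps)
    then show "p (l - 1) (j div 16) \<le> p l j" using mesh[of l]
      by (metis diff_ge_0_iff_ge less_imp_le mult_nonneg_nonneg of_nat_0_le_iff)
    show "a \<le> p (l - 1) (j div 16)" using mesh[of "l - 1"] by (simp add: p_def)
    show "0 \<le> 4 ^ l * 10 * H / sqrt (real N)" using H by simp
    show "4 ^ l * 10 * H / sqrt (real N) \<le> 1" using L2[of l] l sN by (simp add: divide_le_eq)
    have "real (j mod 16) * mesh l \<le> 16 * mesh l" using mesh[of l] by (intro mult_right_mono) auto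
    then have "real N * (p l j - p (l - 1) (j div 16)) * (3 * (4 ^ l * 10 * H / sqrt (real N))\<^sup>2)
      \<le> real N * (16 * mesh l) * (3 * (4 ^ l * 10 * H / sqrt (real N))\<^sup>2)"
      unfolding diff using mesh[of l] by (intro mult_right_mono mult_left_mono) auto
    also have "\<dots> = 48"
    proof -
      have "(4 ^ l)\<^sup>2 = (16 ^ l :: real)" by (simp add: power2_eq_square power_mult_distrib[symmetric])
      then show ?thesis using sN H by (simp add: mesh_def eps_def power_divide power_mult_distrib)
    qed
    finally show "real N * (p l j - p (l - 1) (j div 16)) * (3 * (4 ^ l * 10 * H / sqrt (real N))\<^sup>2) \<le> 48" .
    \<comment> \<open>The exponent gained at level \<open>l\<close> is tilt times share:
      \<open>4 ^ l * 10 * H / sqrt N\<close> times \<open>sqrt N * k / (H * 2 ^ l)\<close>.\<close>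
    have "(4 ^ l :: real) = 2 ^ l * 2 ^ l" by (simp add: power_mult_distrib[symmetric])
    then show "2 ^ l * 10 * k \<le> 4 ^ l * 10 * H / sqrt (real N) * (w / 2 ^ l)"
      using sN H by (simp add: w_def)
  qed (use a g in auto)
  have boundB: "(\<integral>\<^sup>+\<omega>. g (S N a \<omega>) * indicator (B j) \<omega> \<partial>M) \<le> ennreal (exp (48 - 2 ^ L * 10 * k)) * G" for j
    unfolding B_def G_def
  proof (rule max_increment_tail[where t="p L j + mesh L"])
    show "a \<le> p L j" using mesh[of L] by (simp add: p_def)
    show "p L j \<le> p L j + mesh L" using mesh[of L] by simp
    show "{t \<in> T. J L t = j} \<subseteq> {p L j..p L j + mesh L}" 
    proof
      fix u assume "u \<in> {t \<in> T. J L t = j}"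
      then show "u \<in> {p L j..p L j + mesh L}" using J(1,2)[of u L] by auto
    qed
    have "real N < (4 ^ Suc L * 10 * H)\<^sup>2"
      using power_strict_mono[OF L1, of 2] by simp
    also have "\<dots> = 1600 * 16 ^ L * H\<^sup>2"
    proof -
      have "(4 ^ L)\<^sup>2 = (16 ^ L :: real)" by (simp add: power2_eq_square power_mult_distrib[symmetric])
      then show ?thesis by (simp add: power_mult_distrib)
    qed
    finally have "real N * mesh L \<le> 1600 * 16 ^ L * H\<^sup>2 * mesh L"
      using mesh[of L] by (intro mult_right_mono) auto
    also have "\<dots> = 16" using H by (simp add: mesh_def eps_def)
    finally show "real N * (p L j + mesh L - p L j) * 3 \<le> 48" by simp
    have "2 ^ L * 10 * k * 2 ^ L = 4 ^ L * 10 * k" by (simp add: power_mult_distrib[symmetric])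
    also have "\<dots> \<le> sqrt (real N) * k / H"
      using mult_right_mono[OF L2[of L], of k] k H by (simp add: field_simps)
    finally show "2 ^ L * 10 * k \<le> w / 2 ^ L" by (subst pos_le_divide_eq) (simp_all add: w_def)
  qed (use a g T in auto)
  have sumbound: "(\<Sum>j<(16::nat)^l. ennreal (exp (48 - 2 ^ l * 10 * k)) * G) \<le> ennreal (exp (48 - 4 * k) / 2 ^ l) * G" for l
  proof -
    have "(\<Sum>j<(16::nat)^l. ennreal (exp (48 - 2 ^ l * 10 * k)) * G) = ennreal (16 ^ l * exp (48 - 2 ^ l * 10 * k)) * G"
      by (simp add: ennreal_mult mult.assoc ennreal_of_nat_eq_real_of_nat)
    also have "\<dots> \<le> ennreal (exp (48 - 4 * k) / 2 ^ l) * G"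
      by (intro mult_right_mono ennreal_leI chain_weight k) auto
    finally show ?thesis .
  qed
  have "(\<integral>\<^sup>+\<omega>. g (S N a \<omega>) * indicator {\<omega>. \<exists>t\<in>T. w < S N t \<omega> - S N a \<omega>} \<omega> \<partial>M)
    \<le> (\<integral>\<^sup>+\<omega>. (\<Sum>l\<in>{1..L}. \<Sum>j<16^l. g (S N a \<omega>) * indicator (A l j) \<omega>) + (\<Sum>j<16^L. g (S N a \<omega>) * indicator (B j) \<omega>) \<partial>M)"
    by (intro nn_integral_mono order_trans[OF mult_left_mono[OF cover]])
       (simp_all add: distrib_left sum_distrib_left)
  also have "\<dots> = (\<Sum>l\<in>{1..L}. \<Sum>j<16^l. \<integral>\<^sup>+\<omega>. g (S N a \<omega>) * indicator (A l j) \<omega> \<partial>M)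
      + (\<Sum>j<16^L. \<integral>\<^sup>+\<omega>. g (S N a \<omega>) * indicator (B j) \<omega> \<partial>M)"
  proof -
    have mA: "(\<lambda>\<omega>. g (S N a \<omega>) * indicator (A l j) \<omega>) \<in> borel_measurable M" for l j by measurable
    have mB: "(\<lambda>\<omega>. g (S N a \<omega>) * indicator (B j) \<omega>) \<in> borel_measurable M" for j by measurable
    show ?thesis
      by (simp only: nn_integral_add nn_integral_sum borel_measurable_sum mA mB)
  qed
  also have "\<dots> \<le> (\<Sum>l\<in>{1..L}. \<Sum>j<(16::nat)^l. ennreal (exp (48 - 2 ^ l * 10 * k)) * G)
      + (\<Sum>j<(16::nat)^L. ennreal (exp (48 - 2 ^ L * 10 * k)) * G)"
    by (intro add_mono sum_mono boundA boundB)
  also have "\<dots> \<le> (\<Sum>l\<in>{1..L}. ennreal (exp (48 - 4 * k) / 2 ^ l) * G) + ennreal (exp (48 - 4 * k) / 2 ^ L) * G"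
    by (intro add_mono sum_mono sumbound)
  also have "\<dots> = ennreal (exp (48 - 4 * k) * ((\<Sum>l\<in>{1..L}. 1 / 2 ^ l) + 1 / 2 ^ L)) * G"
    by (simp add: sum_distrib_right[symmetric] sum_ennreal distrib_right[symmetric] ennreal_plus[symmetric]
        sum_nonneg sum_distrib_left distrib_left del: ennreal_plus)
  also have "(\<Sum>l\<in>{1..L}. 1 / 2 ^ l) + 1 / 2 ^ L = (1::real)"
    by (induction L) (auto simp: field_simps)
  finally show ?thesis unfolding w_def G_def by simp
qed

lemma prob_S_greater:
  assumes "0 \<le> t" "0 < n" shows "prob {\<omega>\<in>space M. y < S n t \<omega>} = normal_tail (y / sqrt n)"
  unfolding S_def using prob_sum_X(1)[of "{..<n}" t y] assms by auto

text \<open>The two weights that are needed: the indicator of a half-line, which keeps the full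
  Gaussian factor for the height at \<open>a\<close>, and the constant 1.\<close>

lemma chain_tail_prob:
  assumes a: "0 \<le> a" and H: "0 < H" "10 * H \<le> sqrt (real N)" and k: "1 \<le> k"
    and T: "finite T" "T \<subseteq> {a..<a + 1 / (100 * H\<^sup>2)}"
  shows "prob {\<omega>\<in>space M. y < S N a \<omega> \<and> (\<exists>t\<in>T. sqrt (real N) * k / H < S N t \<omega> - S N a \<omega>)}
      \<le> exp (48 - 4 * k) * normal_tail (y / sqrt (real N))"
    and "prob {\<omega>\<in>space M. \<exists>t\<in>T. sqrt (real N) * k / H < S N t \<omega> - S N a \<omega>} \<le> exp (48 - 4 * k)"
proof -
  have N: "0 < N" using H by (cases N) auto
  have [measurable]: "countable T" using T by (simp add: countable_finite)
  let ?E = "{\<omega>. \<exists>t\<in>T. sqrt (real N) * k / H < S N t \<omega> - S N a \<omega>}"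
  have "mono (\<lambda>x. indicator {y<..} x :: ennreal)" by (auto simp: mono_def split: split_indicator)
  from chain_tail[OF a H k T this]
  have "(\<integral>\<^sup>+\<omega>. indicator {y<..} (S N a \<omega>) * indicator ?E \<omega> \<partial>M)
    \<le> ennreal (exp (48 - 4 * k)) * (\<integral>\<^sup>+\<omega>. indicator {y<..} (S N a \<omega>) \<partial>M)" by simp
  also have "(\<integral>\<^sup>+\<omega>. indicator {y<..} (S N a \<omega>) \<partial>M) = (\<integral>\<^sup>+\<omega>. indicator {\<omega>\<in>space M. y < S N a \<omega>} \<omega> \<partial>M)"
    by (intro nn_integral_cong) (auto split: split_indicator)
  also have "\<dots> = ennreal (normal_tail (y / sqrt (real N)))"
    using prob_S_greater[OF a N, of y] by (simp add: emeasure_eq_measure)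
  also have "(\<integral>\<^sup>+\<omega>. indicator {y<..} (S N a \<omega>) * indicator ?E \<omega> \<partial>M)
    = (\<integral>\<^sup>+\<omega>. indicator {\<omega>\<in>space M. y < S N a \<omega> \<and> \<omega> \<in> ?E} \<omega> \<partial>M)"
    by (intro nn_integral_cong) (auto split: split_indicator)
  also have "\<dots> = ennreal (prob {\<omega>\<in>space M. y < S N a \<omega> \<and> \<omega> \<in> ?E})"
    by (simp add: emeasure_eq_measure)
  finally show "prob {\<omega>\<in>space M. y < S N a \<omega> \<and> (\<exists>t\<in>T. sqrt (real N) * k / H < S N t \<omega> - S N a \<omega>)}
      \<le> exp (48 - 4 * k) * normal_tail (y / sqrt (real N))"
    by (simp add: ennreal_mult[symmetric] ennreal_le_iff)
  have "mono (\<lambda>x::real. 1 :: ennreal)" by (simp add: mono_def)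
  from chain_tail[OF a H k T this]
  have "(\<integral>\<^sup>+\<omega>. indicator ?E \<omega> \<partial>M) \<le> ennreal (exp (48 - 4 * k))" by (simp add: emeasure_space_1)
  also have "(\<integral>\<^sup>+\<omega>. indicator ?E \<omega> \<partial>M) = (\<integral>\<^sup>+\<omega>. indicator {\<omega>\<in>space M. \<omega> \<in> ?E} \<omega> \<partial>M)"
    by (intro nn_integral_cong) (auto split: split_indicator)
  also have "\<dots> = ennreal (prob {\<omega>\<in>space M. \<omega> \<in> ?E})"
    by (simp add: emeasure_eq_measure)
  finally show "prob {\<omega>\<in>space M. \<exists>t\<in>T. sqrt (real N) * k / H < S N t \<omega> - S N a \<omega>} \<le> exp (48 - 4 * k)"
    by (simp add: ennreal_le_iff)
qed

text \<open>The exceedance is split according to the deficit of the walk at \<open>a\<close>,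
  measured in units of \<open>sqrt N / H\<close>. A deficit of about \<open>k\<close> raises the
  Gaussian tail by a factor of order \<open>exp k\<close>, whereas making up for it costs
  \<open>exp (- 4 * k)\<close>; the sum over \<open>k\<close> converges, and the supremum over the
  window has a tail of the same order as a single time.\<close>

lemma sup_tail_finite:
  assumes a: "0 \<le> a" and H: "2 \<le> H" "10 * H \<le> sqrt (real N)"
    and T: "finite T" "T \<subseteq> {a..<a + 1 / (100 * H\<^sup>2)}"
  shows "prob {\<omega>\<in>space M. \<exists>t\<in>T. sqrt (real N) * H < S N t \<omega>} \<le> 100 * exp 48 * (exp (- H\<^sup>2/2) / H)"
proof -
  have N: "0 < N" using H by (cases N) auto
  have sN: "sqrt (real N) > 0" using N by simp
  have H0: "0 < H" using H by simp
  have [measurable]: "countable T" using T by (simp add: countable_finite)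
  \<comment> \<open>Up to this deficit \<open>H - k / H\<close> stays above \<open>H / 2\<close>, so
    the denominator of the Gaussian tail bound loses only a factor 2. Beyond it the increment alone
    is unlikely enough: \<open>4 * K\<close> is at least \<open>2 * H\<^sup>2 - 4\<close>.\<close>
  define K where "K = nat \<lfloor>H\<^sup>2 / 2\<rfloor>"
  have H2: "4 \<le> H\<^sup>2" using power_mono[of 2 H 2] H by simp
  have K: "real K \<le> H\<^sup>2/2" "H\<^sup>2/2 - 1 \<le> real K" "1 \<le> K" using H2 unfolding K_def by linarith+
  define E where "E k = {\<omega>\<in>space M. sqrt (real N) * (H - (real k + 1) / H) < S N a \<omega> \<and>
     (\<exists>t\<in>T. sqrt (real N) * real k / H < S N t \<omega> - S N a \<omega>)}" for k
  define E0 where "E0 = {\<omega>\<in>space M. sqrt (real N) * (H - 1 / H) < S N a \<omega>}"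
  define E1 where "E1 = {\<omega>\<in>space M. \<exists>t\<in>T. sqrt (real N) * real K / H < S N t \<omega> - S N a \<omega>}"
  have [measurable]: "E k \<in> sets M" "E0 \<in> sets M" "E1 \<in> sets M" for k unfolding E_def E0_def E1_def by measurable
  have "{\<omega>\<in>space M. \<exists>t\<in>T. sqrt (real N) * H < S N t \<omega>} \<subseteq> E0 \<union> (\<Union>k\<in>{1..<K}. E k) \<union> E1"
  proof safe
    fix \<omega> t assume \<omega>: "\<omega> \<in> space M" "t \<in> T" "sqrt (real N) * H < S N t \<omega>" "\<omega> \<notin> E1" "\<omega> \<notin> (\<Union>k\<in>{1..<K}. E k)"
    \<comment> \<open>The deficit of the walk at \<open>a\<close> below the level, in units of
      \<open>sqrt N / H\<close>.\<close>
    define q where "q = (H - S N a \<omega> / sqrt (real N)) * H"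
    have Sa: "S N a \<omega> = sqrt (real N) * (H - q / H)" using sN H0 by (simp add: q_def)
    have inc: "sqrt (real N) * q / H < S N t \<omega> - S N a \<omega>" unfolding Sa using \<omega>(3) by (simp add: algebra_simps)
    have inc': "sqrt (real N) * k / H < S N t \<omega> - S N a \<omega>" if "k \<le> q" for k
      using that inc sN H0 by (elim order_le_less_trans[rotated]) (auto intro!: divide_right_mono mult_left_mono)
    have "q < real K"
    proof (rule ccontr)
      assume "\<not> q < real K"
      then have "\<omega> \<in> E1" unfolding E1_def using inc'[of "real K"] \<omega>(1,2) by auto
      then show False using \<omega>(4) by blast
    qed
    have "q < 1"
    proof (rule ccontr)
      assume "\<not> q < 1"
      define k where "k = nat \<lfloor>q\<rfloor>"
      have k: "real k \<le> q" "q < real k + 1" "1 \<le> k" using \<open>\<not> q < 1\<close> unfolding k_def by linarith+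
      have "k \<in> {1..<K}" using k \<open>q < real K\<close> by auto
      moreover have "\<omega> \<in> E k"
        unfolding E_def using \<omega>(1,2) inc'[OF k(1)] k(2) sN H0 by (auto simp: Sa divide_strict_right_mono)
      ultimately show False using \<omega>(5) by blast
    qed
    then show "\<omega> \<in> E0" unfolding E0_def using \<omega>(1) sN H0 by (auto simp: Sa divide_strict_right_mono)
  qed
  then have "prob {\<omega>\<in>space M. \<exists>t\<in>T. sqrt (real N) * H < S N t \<omega>} \<le> prob (E0 \<union> (\<Union>k\<in>{1..<K}. E k) \<union> E1)"
    by (intro finite_measure_mono) measurable
  also have "\<dots> \<le> prob E0 + prob (\<Union>k\<in>{1..<K}. E k) + prob E1"
  proof -
    have "prob (E0 \<union> (\<Union>k\<in>{1..<K}. E k) \<union> E1) \<le> prob (E0 \<union> (\<Union>k\<in>{1..<K}. E k)) + prob E1"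
      by (rule measure_Un_le) auto
    also have "prob (E0 \<union> (\<Union>k\<in>{1..<K}. E k)) \<le> prob E0 + prob (\<Union>k\<in>{1..<K}. E k)"
      by (rule measure_Un_le) auto
    finally show ?thesis by simp
  qed
  also have "\<dots> \<le> prob E0 + (\<Sum>k\<in>{1..<K}. prob (E k)) + prob E1"
    by (intro add_mono order_refl measure_UNION_le) auto
  also have "\<dots> \<le> 2 * exp 1 * (exp (- H\<^sup>2/2) / H) + (\<Sum>k\<in>{1..<K}. 2 * exp 48 * (1/2)^k * (exp (- H\<^sup>2/2) / H)) + exp 52 * (exp (- H\<^sup>2/2) / H)"
  proof (intro add_mono sum_mono)
    have tail: "normal_tail (H - k / H) \<le> 2 * exp k * (exp (- H\<^sup>2/2) / H)" if "k \<le> H\<^sup>2/2" for k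
    proof -
      have "k / H \<le> H / 2" using that H0 by (simp add: divide_le_eq power2_eq_square)
      then have h: "H / 2 \<le> H - k / H" by linarith
      then have "normal_tail (H - k / H) \<le> exp (- (H - k / H)\<^sup>2 / 2) / (H - k / H)"
        using H0 by (intro normal_tail_upper) linarith
      also have "\<dots> \<le> exp (- (H - k / H)\<^sup>2 / 2) / (H / 2)"
      proof (rule divide_left_mono[OF h])
        show "0 < (H - k / H) * (H / 2)" using h H0 by (intro mult_pos_pos) linarith+
      qed simp
      also have "\<dots> \<le> exp (k - H\<^sup>2 / 2) / (H / 2)"
      proof (intro divide_right_mono exp_mono)
        have "(H - k / H)\<^sup>2 = H\<^sup>2 - 2 * k + (k / H)\<^sup>2" using H0 by (simp add: power2_diff)
        then show "- (H - k / H)\<^sup>2 / 2 \<le> k - H\<^sup>2 / 2" using zero_le_power2[of "k / H"] by simp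
      qed (use H0 in auto)
      also have "exp (k - H\<^sup>2 / 2) = exp k * exp (- H\<^sup>2/2)" by (simp add: exp_add[symmetric])
      also have "exp k * exp (- H\<^sup>2/2) / (H / 2) = 2 * exp k * (exp (- H\<^sup>2/2) / H)" by simp
      finally show ?thesis .
    qed
    have "prob E0 = normal_tail (sqrt (real N) * (H - 1 / H) / sqrt (real N))"
      unfolding E0_def by (rule prob_S_greater[OF a N])
    also have "\<dots> \<le> 2 * exp 1 * (exp (- H\<^sup>2/2) / H)" using tail[of 1] H2 sN by simp
    finally show "prob E0 \<le> 2 * exp 1 * (exp (- H\<^sup>2/2) / H)" .
    show "prob (E k) \<le> 2 * exp 48 * (1/2)^k * (exp (- H\<^sup>2/2) / H)" if k: "k \<in> {1..<K}" for k
    proof -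
      have k1: "1 \<le> real k" "real k + 1 \<le> H\<^sup>2/2" using k K by auto
      have "prob (E k) \<le> exp (48 - 4 * real k) * normal_tail (sqrt (real N) * (H - (real k + 1) / H) / sqrt (real N))"
        unfolding E_def by (rule chain_tail_prob(1)[OF a H0 H(2) k1(1) T])
      also have "\<dots> \<le> exp (48 - 4 * real k) * (2 * exp (real k + 1) * (exp (- H\<^sup>2/2) / H))"
        using tail[OF k1(2)] sN by (intro mult_left_mono) auto
      also have "\<dots> = 2 * exp (49 - 3 * real k) * (exp (- H\<^sup>2/2) / H)"
        by (simp add: exp_add[symmetric])
      also have "\<dots> \<le> 2 * (exp 48 * (1/2)^k) * (exp (- H\<^sup>2/2) / H)"
      proof (intro mult_left_mono mult_right_mono)
        have "exp (49 - 3 * real k) \<le> exp (48 - real k)" using k1 by simp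
        also have "\<dots> = exp 48 * exp (-1) ^ k" by (simp add: exp_add[symmetric] exp_of_nat_mult[symmetric])
        also have "\<dots> \<le> exp 48 * (1/2) ^ k"
          using exp_ge_add_one_self[of 1] by (intro mult_left_mono power_mono) (auto simp: exp_minus field_simps)
        finally show "exp (49 - 3 * real k) \<le> exp 48 * (1/2) ^ k" .
      qed (use H0 in auto)
      finally show ?thesis by (simp add: mult_ac)
    qed
    have "prob E1 \<le> exp (48 - 4 * real K)"
      unfolding E1_def using K by (intro chain_tail_prob(2)[OF a H0 H(2) _ T]) auto
    also have "\<dots> \<le> exp (52 - H\<^sup>2/2 - H)"
    proof -
      have "H \<le> H\<^sup>2" using H by (simp add: power2_eq_square)
      then show ?thesis using K H0 by simp
    qed
    also have "\<dots> = exp 52 * (exp (- H\<^sup>2/2) * exp (- H))" by (simp add: exp_add[symmetric])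
    also have "\<dots> \<le> exp 52 * (exp (- H\<^sup>2/2) * (1 / H))"
    proof (intro mult_left_mono)
      show "exp (- H) \<le> 1 / H" 
      proof -
        have "H \<le> exp H" using exp_ge_add_one_self[of H] by linarith
        then show ?thesis using H0 by (simp add: exp_minus inverse_eq_divide frac_le)
      qed
    qed auto
    finally show "prob E1 \<le> exp 52 * (exp (- H\<^sup>2/2) / H)" by simp
  qed
  also have "\<dots> = (2 * exp 1 + 2 * exp 48 * (\<Sum>k\<in>{1..<K}. (1/2)^k) + exp 52) * (exp (- H\<^sup>2/2) / H)"
    by (simp only: sum_distrib_left sum_distrib_right distrib_right)
  also have "\<dots> \<le> (100 * exp 48) * (exp (- H\<^sup>2/2) / H)"
  proof (intro mult_right_mono)
    have "(\<Sum>k\<in>{1..<K}. (1/2)^k) \<le> (1::real)"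
    proof -
      have "(\<Sum>k\<in>{1..<Suc n}. (1/2)^k) = 1 - (1/2::real)^n" for n :: nat
        by (induction n) (auto simp: sum.atLeastLessThan_Suc)
      moreover obtain K' where "K = Suc K'" using K(3) by (cases K) auto
      ultimately show ?thesis by simp
    qed
    then have "2 * exp 48 * (\<Sum>k\<in>{1..<K}. (1/2)^k) \<le> 2 * exp (48::real) * 1"
      by (intro mult_left_mono) auto
    moreover have "exp 1 \<le> exp (48::real)" by simp
    moreover have "exp (52::real) \<le> 81 * exp 48"
    proof -
      have "exp (52::real) = exp 1 ^ 4 * exp 48" by (simp add: exp_of_nat_mult[symmetric] exp_add[symmetric])
      also have "\<dots> \<le> 3 ^ 4 * exp 48" by (intro mult_right_mono power_mono exp_le) auto
      finally show ?thesis by simp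
    qed
    moreover have "0 \<le> exp (48::real)" by simp
    ultimately show "2 * exp 1 + 2 * exp 48 * (\<Sum>k\<in>{1..<K}. (1/2)^k) + exp 52 \<le> 100 * exp (48::real)"
      by linarith
  qed (use H0 in auto)
  finally show ?thesis .
qed

end

section \<open>From a single walk time to all earlier ones\<close>

context gaussian_dynamics
begin

text \<open>Levy's maximal inequality, the walks being regarded as walks with values in the functions on \<open>T\<close>.\<close>

lemma levy_finite:
  assumes T: "finite T" "T \<subseteq> {0..}"
  shows "prob {\<omega>\<in>space M. \<exists>n\<le>N. \<exists>t\<in>T. x < S n t \<omega>} \<le> 2 * prob {\<omega>\<in>space M. \<exists>t\<in>T. x < S N t \<omega>}"
proof -
  have [measurable]: "countable T" using T by (simp add: countable_finite)
  let ?PM = "PiM UNIV (\<lambda>_::real. borel :: real measure)"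
  \<comment> \<open>Decomposition by the first walk time with an exceedance and the least time in
    \<open>T\<close> showing it. The event \<open>A (n, t)\<close> depends on the coordinates below
    \<open>n\<close>, while \<open>B (n, t)\<close> depends on the later ones and has probability at
    least one half by symmetry.\<close>
  define A where "A = (\<lambda>(n, t). {\<omega>\<in>space M. (\<forall>m<n. \<forall>u\<in>T. S m u \<omega> \<le> x) \<and> x < S n t \<omega> \<and> (\<forall>u\<in>T. u < t \<longrightarrow> S n u \<omega> \<le> x)})"
  define B where "B = (\<lambda>(n, t). {\<omega>\<in>space M. 0 \<le> (\<Sum>i\<in>{n..<N}. X i t \<omega>)})"
  let ?I = "{..N} \<times> T"
  have [measurable]: "A z \<in> sets M" "B z \<in> sets M" for z
    unfolding A_def B_def by (cases z, simp)+
  have fin: "finite ?I" using T by simp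
  have disj: "disjoint_family_on A ?I"
    unfolding disjoint_family_on_def
  proof (intro ballI impI equals0I)
    fix z z' \<omega> assume *: "z \<in> ?I" "z' \<in> ?I" "z \<noteq> z'" and \<omega>: "\<omega> \<in> A z \<inter> A z'"
    obtain n t n' t' where z: "z = (n, t)" "z' = (n', t')" by (cases z; cases z') auto
    show False
    proof (cases "n = n'")
      case True
      then have "t < t' \<or> t' < t" using * z by auto
      then show ?thesis using * \<omega> True unfolding z A_def by (auto simp: not_less[symmetric])
    next
      case False
      then have "n < n' \<or> n' < n" by auto
      then show ?thesis using * \<omega> unfolding z A_def by (auto simp: not_less[symmetric])
    qed
  qed
  have union: "{\<omega>\<in>space M. \<exists>n\<le>N. \<exists>t\<in>T. x < S n t \<omega>} = (\<Union>z\<in>?I. A z)"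
  proof safe
    fix \<omega> n t assume *: "\<omega> \<in> space M" "n \<le> N" "t \<in> T" "x < S n t \<omega>"
    define m where "m = (LEAST m. \<exists>u\<in>T. x < S m u \<omega>)"
    have m: "\<exists>u\<in>T. x < S m u \<omega>" 
      unfolding m_def by (rule LeastI_ex) (use * in blast)
    have "m \<le> n" unfolding m_def by (rule Least_le) (use * in blast)
    define U where "U = {u\<in>T. x < S m u \<omega>}"
    have U: "finite U" "U \<noteq> {}" using T m by (auto simp: U_def)
    have "\<omega> \<in> A (m, Min U)"
      unfolding A_def prod.case
    proof (intro CollectI conjI allI impI ballI)
      show "x < S m (Min U) \<omega>" using Min_in[OF U] by (simp add: U_def)
      fix k u assume "k < m" "u \<in> T"
      then show "S k u \<omega> \<le> x" using not_less_Least[of k "\<lambda>m. \<exists>u\<in>T. x < S m u \<omega>"] by (auto simp: m_def not_less)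
    next
      fix u assume "u \<in> T" "u < Min U"
      then show "S m u \<omega> \<le> x" using Min_le[OF U(1), of u] by (auto simp: U_def not_less[symmetric])
    qed (use * in auto)
    then show "\<omega> \<in> (\<Union>z\<in>?I. A z)" using \<open>m \<le> n\<close> * Min_in[OF U] by (auto simp: U_def)
  qed (auto simp: A_def)
  have half: "1 / 2 \<le> prob (B z)" if "z \<in> ?I" for z
  proof -
    obtain n t where z: "z = (n, t)" by (cases z)
    have t: "0 \<le> t" using that T z by auto
    show ?thesis
    proof (cases "n < N")
      case True
      let ?Z = "\<lambda>\<omega>. \<Sum>i\<in>{n..<N}. X i t \<omega>"
      have "prob {\<omega>\<in>space M. 0 < ?Z \<omega>} = prob {\<omega>\<in>space M. ?Z \<omega> < - 0}"
        using prob_sum_X[of "{n..<N}" t 0] True t by simp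
      moreover have "1 = prob (B z \<union> {\<omega>\<in>space M. ?Z \<omega> < 0})"
        unfolding prob_space[symmetric] by (intro arg_cong[where f=prob]) (auto simp: B_def z)
      moreover have "\<dots> \<le> prob (B z) + prob {\<omega>\<in>space M. ?Z \<omega> < 0}"
        by (intro measure_Un_le) auto
      moreover have "prob {\<omega>\<in>space M. 0 < ?Z \<omega>} \<le> prob (B z)"
        by (intro finite_measure_mono) (auto simp: B_def z)
      ultimately show ?thesis by simp
    qed (simp add: B_def z prob_space)
  qed
  have indep: "prob (A z \<inter> B z) = prob (A z) * prob (B z)" if "z \<in> ?I" for z
  proof -
    obtain n t where z: "z = (n, t)" by (cases z)
    define SA where "SA = {f\<in>space (PiM {..<n} (\<lambda>_. ?PM)). (\<forall>m\<in>{..<n}. \<forall>u\<in>T. (\<Sum>i<m. f i u) \<le> x) \<and> x < (\<Sum>i<n. f i t) \<and>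
      (\<forall>u\<in>T. u < t \<longrightarrow> (\<Sum>i<n. f i u) \<le> x)}"
    define SB where "SB = {f\<in>space (PiM {n..<N} (\<lambda>_. ?PM)). 0 \<le> (\<Sum>i\<in>{n..<N}. f i t)}"
    have c: "(\<lambda>f. f i u) \<in> borel_measurable (PiM J (\<lambda>_. ?PM))" if "i \<in> J" for i J and u :: real
      using measurable_compose[OF measurable_component_singleton[OF that] measurable_component_singleton[of u UNIV]] by simp
    have c1: "(\<lambda>f. \<Sum>i<m. f i u) \<in> borel_measurable (PiM {..<n} (\<lambda>_. ?PM))" if "m \<le> n" for m u
      using that by (intro borel_measurable_sum c) auto
    have [measurable]: "SA \<in> sets (PiM {..<n} (\<lambda>_. ?PM))"
      unfolding SA_def
    proof (intro sets.sets_Collect_conj)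
      show "{f \<in> space (PiM {..<n} (\<lambda>_. ?PM)). \<forall>m\<in>{..<n}. \<forall>u\<in>T. (\<Sum>i<m. f i u) \<le> x} \<in> sets (PiM {..<n} (\<lambda>_. ?PM))"
        by (intro sets.sets_Collect_finite_All borel_measurable_le c1 T) auto
      show "{f \<in> space (PiM {..<n} (\<lambda>_. ?PM)). x < (\<Sum>i<n. f i t)} \<in> sets (PiM {..<n} (\<lambda>_. ?PM))"
        by (intro borel_measurable_less c1) auto
      show "{f \<in> space (PiM {..<n} (\<lambda>_. ?PM)). \<forall>u\<in>T. u < t \<longrightarrow> (\<Sum>i<n. f i u) \<le> x} \<in> sets (PiM {..<n} (\<lambda>_. ?PM))"
        by (intro sets.sets_Collect_finite_All sets.sets_Collect_imp sets.sets_Collect_const borel_measurable_le c1 T) auto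
    qed
    have [measurable]: "SB \<in> sets (PiM {n..<N} (\<lambda>_. ?PM))"
      unfolding SB_def by (intro borel_measurable_le borel_measurable_sum c) auto
    have "indep_var (PiM {..<n} (\<lambda>_. ?PM)) (\<lambda>\<omega>. restrict (\<lambda>i t. X i t \<omega>) {..<n})
        (PiM {n..<N} (\<lambda>_. ?PM)) (\<lambda>\<omega>. restrict (\<lambda>i t. X i t \<omega>) {n..<N})"
      by (rule indep_var_restrict[OF indep_X]) auto
    from indep_varD[OF this, of SA SB]
    have "prob ((\<lambda>\<omega>. (restrict (\<lambda>i t. X i t \<omega>) {..<n}, restrict (\<lambda>i t. X i t \<omega>) {n..<N})) -` (SA \<times> SB) \<inter> space M)
      = prob ((\<lambda>\<omega>. restrict (\<lambda>i t. X i t \<omega>) {..<n}) -` SA \<inter> space M) * prob ((\<lambda>\<omega>. restrict (\<lambda>i t. X i t \<omega>) {n..<N}) -` SB \<inter> space M)"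
      by simp
    moreover have "(\<lambda>\<omega>. restrict (\<lambda>i t. X i t \<omega>) {..<n}) -` SA \<inter> space M = A z"
      by (auto simp: SA_def A_def z S_def space_PiM)
    moreover have "(\<lambda>\<omega>. restrict (\<lambda>i t. X i t \<omega>) {n..<N}) -` SB \<inter> space M = B z"
      by (auto simp: SB_def B_def z space_PiM)
    moreover have "(\<lambda>\<omega>. (restrict (\<lambda>i t. X i t \<omega>) {..<n}, restrict (\<lambda>i t. X i t \<omega>) {n..<N})) -` (SA \<times> SB) \<inter> space M
      = ((\<lambda>\<omega>. restrict (\<lambda>i t. X i t \<omega>) {..<n}) -` SA \<inter> space M) \<inter> ((\<lambda>\<omega>. restrict (\<lambda>i t. X i t \<omega>) {n..<N}) -` SB \<inter> space M)"
      by auto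
    ultimately show ?thesis by simp
  qed
  have "prob {\<omega>\<in>space M. \<exists>n\<le>N. \<exists>t\<in>T. x < S n t \<omega>} = (\<Sum>z\<in>?I. prob (A z))"
    unfolding union by (rule finite_measure_finite_Union[OF fin _ disj]) auto
  also have "\<dots> \<le> (\<Sum>z\<in>?I. 2 * prob (A z \<inter> B z))"
  proof (rule sum_mono)
    fix z assume z: "z \<in> ?I"
    have "prob (A z) * 1 \<le> prob (A z) * (2 * prob (B z))" using half[OF z] by (intro mult_left_mono) auto
    then show "prob (A z) \<le> 2 * prob (A z \<inter> B z)" unfolding indep[OF z] by simp
  qed
  also have "\<dots> = 2 * prob (\<Union>z\<in>?I. A z \<inter> B z)"
  proof -
    have "disjoint_family_on (\<lambda>z. A z \<inter> B z) ?I" using disj unfolding disjoint_family_on_def by blast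
    then have "prob (\<Union>z\<in>?I. A z \<inter> B z) = (\<Sum>z\<in>?I. prob (A z \<inter> B z))"
      by (intro finite_measure_finite_Union[OF fin]) auto
    then show ?thesis by (simp add: sum_distrib_left)
  qed
  also have "\<dots> \<le> 2 * prob {\<omega>\<in>space M. \<exists>t\<in>T. x < S N t \<omega>}"
  proof (intro mult_left_mono finite_measure_mono subsetI)
    fix \<omega> assume "\<omega> \<in> (\<Union>z\<in>?I. A z \<inter> B z)"
    then obtain n t where nt: "n \<le> N" "t \<in> T" "\<omega> \<in> A (n, t)" "\<omega> \<in> B (n, t)" by auto
    have "S N t \<omega> = S n t \<omega> + (\<Sum>i\<in>{n..<N}. X i t \<omega>)"
      unfolding S_def using nt(1) by (metis atLeast0LessThan le0 sum.atLeastLessThan_concat)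
    then have "x < S N t \<omega>" using nt by (auto simp: A_def B_def)
    then show "\<omega> \<in> {\<omega>\<in>space M. \<exists>t\<in>T. x < S N t \<omega>}" using nt by (auto simp: A_def)
  qed auto
  finally show ?thesis .
qed

lemma maximal_inequality:
  assumes a: "0 \<le> a" and H: "2 \<le> H" "10 * H \<le> sqrt (real N)"
    and T: "countable T" "T \<subseteq> {a..<a + 1 / (100 * H\<^sup>2)}"
  shows "prob {\<omega>\<in>space M. \<exists>n\<le>N. \<exists>t\<in>T. sqrt (real N) * H < S n t \<omega>} \<le> 200 * exp 48 * (exp (- H\<^sup>2/2) / H)"
proof (cases "T = {}")
  case False
  define F where "F m = from_nat_into T ` {..m}" for m
  have FT: "F m \<subseteq> T" for m unfolding F_def using False by (auto intro: from_nat_into)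
  define E where "E m = {\<omega>\<in>space M. \<exists>n\<le>N. \<exists>t\<in>F m. sqrt (real N) * H < S n t \<omega>}" for m
  have fin: "finite (F m)" for m by (simp add: F_def)
  have [measurable]: "countable (F m)" for m using fin by (simp add: countable_finite)
  have [measurable]: "E m \<in> sets M" for m unfolding E_def by measurable
  have "prob (E m) \<le> 200 * exp 48 * (exp (- H\<^sup>2/2) / H)" for m
  proof -
    have "prob (E m) \<le> 2 * prob {\<omega>\<in>space M. \<exists>t\<in>F m. sqrt (real N) * H < S N t \<omega>}"
      unfolding E_def using FT[of m] T(2) a by (intro levy_finite fin) auto
    also have "\<dots> \<le> 2 * (100 * exp 48 * (exp (- H\<^sup>2/2) / H))"
      using FT[of m] T(2) by (intro mult_left_mono sup_tail_finite[OF a H fin]) auto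
    finally show ?thesis by simp
  qed
  moreover have "(\<lambda>m. prob (E m)) \<longlonglongrightarrow> prob (\<Union>m. E m)"
  proof (rule finite_Lim_measure_incseq)
    have "F m \<subseteq> F m'" if "m \<le> m'" for m m' unfolding F_def using that by auto
    then show "incseq E" by (auto simp: incseq_def E_def) blast
  qed auto
  moreover have "{\<omega>\<in>space M. \<exists>n\<le>N. \<exists>t\<in>T. sqrt (real N) * H < S n t \<omega>} = (\<Union>m. E m)"
  proof -
    have "\<exists>m. t \<in> F m" if "t \<in> T" for t
      using from_nat_into_surj[OF T(1) that] by (auto simp: F_def)
    then have "\<exists>m. \<omega> \<in> E m" if "\<omega> \<in> space M" "n \<le> N" "t \<in> T" "sqrt (real N) * H < S n t \<omega>" for \<omega> n t
      using that unfolding E_def by blast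
    note cov = this
    have sub: "E m \<subseteq> {\<omega>\<in>space M. \<exists>n\<le>N. \<exists>t\<in>T. sqrt (real N) * H < S n t \<omega>}" for m
      using FT[of m] unfolding E_def by blast
    show ?thesis
    proof (intro equalityI subsetI)
      fix \<omega> assume "\<omega> \<in> {\<omega>\<in>space M. \<exists>n\<le>N. \<exists>t\<in>T. sqrt (real N) * H < S n t \<omega>}"
      then obtain n t where "\<omega> \<in> space M" "n \<le> N" "t \<in> T" "sqrt (real N) * H < S n t \<omega>" by auto
      then obtain m where "\<omega> \<in> E m" using cov by blast
      then show "\<omega> \<in> (\<Union>m. E m)" by (rule UN_I[OF UNIV_I])
    next
      fix \<omega> assume "\<omega> \<in> (\<Union>m. E m)"
      then obtain m where "\<omega> \<in> E m" by (rule UN_E)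
      then show "\<omega> \<in> {\<omega>\<in>space M. \<exists>n\<le>N. \<exists>t\<in>T. sqrt (real N) * H < S n t \<omega>}" by (rule subsetD[OF sub])
    qed
  qed
  ultimately show ?thesis by (simp add: LIMSEQ_le_const2)
qed (use H in auto)

end

subsection \<open>Capacities\<close>

definition separated :: "real \<Rightarrow> real set \<Rightarrow> bool" where
  "separated r A \<longleftrightarrow> (\<forall>x\<in>A. \<forall>y\<in>A. x \<noteq> y \<longrightarrow> r \<le> \<bar>x - y\<bar>)"

text \<open>\<open>boxed s F\<close> bounds the Kolmogorov capacities of \<open>F\<close>, so the upper Minkowski dimension of \<open>F\<close> is at most \<open>s\<close>.\<close>

definition boxed :: "real \<Rightarrow> real set \<Rightarrow> bool" where
  "boxed s F \<longleftrightarrow> (\<exists>C. \<forall>r\<in>{0<..1}. \<forall>A. finite A \<and> A \<subseteq> F \<and> separated r A \<longrightarrow> real (card A) \<le> C * r powr (- s))"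

text \<open>\<open>thick s D\<close> forces the upper Minkowski dimension of \<open>D\<close> to be at least \<open>s\<close>.\<close>

definition thick :: "real \<Rightarrow> real set \<Rightarrow> bool" where
  "thick s D \<longleftrightarrow> (\<forall>k. \<exists>m\<ge>k. \<exists>A. finite A \<and> A \<subseteq> D \<and> separated (1 / real m) A \<and>
     real m powr s \<le> real (card A) \<and> card A \<le> 2 * m)"

text \<open>For a positive walk and large \<open>n\<close>, exceeding
  \<open>sqrt (n * barrier c n)\<close> means that the ratio in the theorem exceeds
  \<open>c\<close>.\<close>

definition barrier :: "real \<Rightarrow> nat \<Rightarrow> real" where
  "barrier c n = 2 * ln (ln (real n)) + c * ln (ln (ln (real n)))"

text \<open>A separated set of greatest cardinality is also a net, since any uncovered point could
  be added. The alternative \<open>t = a\<close> makes the statement true for every real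
  \<open>r\<close>.\<close>

lemma maximal_separated:
  assumes C: "\<And>A. finite A \<Longrightarrow> A \<subseteq> F \<Longrightarrow> separated r A \<Longrightarrow> real (card A) \<le> C"
  shows "\<exists>A. finite A \<and> A \<subseteq> F \<and> separated r A \<and> (\<forall>t\<in>F. \<exists>a\<in>A. \<bar>t - a\<bar> < r \<or> t = a)"
proof -
  let ?P = "\<lambda>A. finite A \<and> A \<subseteq> F \<and> separated r A"
  have "\<exists>A. ?P A \<and> (\<forall>B. ?P B \<longrightarrow> card B \<le> card A)"
  proof (rule ex_has_greatest_nat[of ?P "{}" card "nat \<lceil>C\<rceil> + 1"])
    show "?P {}" by (simp add: separated_def)
    show "\<forall>A. ?P A \<longrightarrow> card A < nat \<lceil>C\<rceil> + 1"
    proof (intro allI impI)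
      fix A assume "?P A"
      then have "real (card A) \<le> C" using C by blast
      then show "card A < nat \<lceil>C\<rceil> + 1" by linarith
    qed
  qed
  then obtain A where A: "?P A" and max: "\<And>B. ?P B \<Longrightarrow> card B \<le> card A" by blast
  have "\<exists>a\<in>A. \<bar>t - a\<bar> < r \<or> t = a" if t: "t \<in> F" for t
  proof (rule ccontr)
    assume neg: "\<not> (\<exists>a\<in>A. \<bar>t - a\<bar> < r \<or> t = a)"
    then have "t \<notin> A" by auto
    moreover have "?P (insert t A)" using A t neg by (auto simp: separated_def abs_minus_commute not_less)
    ultimately show False using max[of "insert t A"] A by auto
  qed
  then show ?thesis using A by blast
qed

subsection \<open>Upper bound\<close>

text \<open>Cauchy condensation. The shift to \<open>Suc k\<close> moves the argument 1, where the
  logarithm vanishes and the quotient takes the value 0, to the index 0; the sequence is decreasing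
  from index 1 on.\<close>

lemma summable_bertrand:
  fixes p :: real assumes "1 < p"
  shows "summable (\<lambda>k. 1 / (real k * ln (real k) powr p))"
proof -
  define f where "f k = 1 / (real (Suc k) * ln (real (Suc k)) powr p)" for k
  have "summable f \<longleftrightarrow> summable (\<lambda>n. 2 ^ n * f (2 ^ n))"
  proof (rule condensation_test)
    fix m :: nat assume m: "0 < m"
    have "0 < ln (real (Suc m))" using m by simp
    moreover have "ln (real (Suc m)) \<le> ln (real (Suc (Suc m)))" by simp
    ultimately have "ln (real (Suc m)) powr p \<le> ln (real (Suc (Suc m))) powr p"
      using assms by (intro powr_mono2) auto
    then show "f (Suc m) \<le> f m"
      unfolding f_def using m by (intro divide_left_mono mult_mono mult_pos_pos) auto
  qed (simp add: f_def)
  moreover have "summable (\<lambda>n. 2 ^ n * f (2 ^ n))"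
  proof (rule summable_comparison_test_ev)
    show "summable (\<lambda>n. ln 2 powr (- p) * real n powr (- p))"
      using assms by (intro summable_mult) (simp add: summable_real_powr_iff)
    show "eventually (\<lambda>n. norm (2 ^ n * f (2 ^ n)) \<le> ln 2 powr (- p) * real n powr (- p)) sequentially"
      using eventually_gt_at_top[of 0]
    proof eventually_elim
      case (elim n)
      have "ln (2 ^ n) \<le> ln (real (Suc (2 ^ n)))" by (subst ln_le_cancel_iff) (auto intro: add_pos_nonneg)
      then have l: "real n * ln 2 \<le> ln (real (Suc (2 ^ n)))" by (simp add: ln_realpow)
      have pos: "0 < real n * ln 2" using elim by simp
      have "2 ^ n * f (2 ^ n) = (2 ^ n / real (Suc (2 ^ n))) * (1 / ln (real (Suc (2 ^ n))) powr p)"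
        by (simp add: f_def)
      also have "\<dots> \<le> 1 * (1 / (real n * ln 2) powr p)"
      proof (rule mult_mono)
        show "2 ^ n / real (Suc (2 ^ n)) \<le> (1::real)" by (subst divide_le_eq_1_pos) (auto intro: add_pos_nonneg)
        show "1 / ln (real (Suc (2 ^ n))) powr p \<le> 1 / (real n * ln 2) powr p"
          using l pos less_le_trans[OF pos l] assms elim by (intro divide_left_mono powr_mono2 mult_pos_pos) auto
      qed auto
      also have "\<dots> = ln 2 powr (- p) * real n powr (- p)"
        using elim by (simp add: powr_mult powr_minus field_simps)
      finally show ?case by (simp add: f_def)
    qed
  qed
  ultimately have "summable f" by simp
  then show ?thesis unfolding f_def by (subst (asm) summable_Suc_iff)
qed

text \<open>Block \<open>k\<close> consists of the \<open>n\<close> with \<open>ln n\<close> between \<open>block_end k\<close> and \<open>block_end (Suc k)\<close>;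
  this interval has length about \<open>1 / ln (ln n)\<close>.\<close>

definition block_end :: "nat \<Rightarrow> real" where
  "block_end k = real k / ln (real k)"

text \<open>The square root is the level at the left end of the block. The exponential factor pays
  for comparing all walk times of the block with the last one, as \<open>sqrt n\<close> varies in it
  by at most the factor \<open>exp (1 / (2 * ln k))\<close>; squared, it changes the Gaussian
  exponent only by a bounded amount.\<close>

definition block_level :: "real \<Rightarrow> nat \<Rightarrow> real" where
  "block_level c k = exp (- 1 / (2 * ln (real k))) * sqrt (2 * ln (block_end k) + c * ln (ln (block_end k)))"

lemma block_end_at_top: "filterlim block_end at_top sequentially"
  unfolding block_end_def by real_asymp

text \<open>With \<open>block_end k = k / ln k\<close> the level squared is
  \<open>2 * ln k + (c - 2) * ln (ln k)\<close> up to a bounded error, so the exponential is of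
  order \<open>ln k powr (1 - c / 2) / k\<close>, and the power of the level is of order
  \<open>ln k powr (s - 1/2)\<close>. The exponent \<open>c / 2 - s - 1 / 2\<close> exceeds 1 iff
  \<open>c > 3 + 2 * s\<close>.\<close>

lemma block_level_summand:
  "(\<lambda>k. block_level c k powr (2 * s - 1) * exp (- (block_level c k)\<^sup>2 / 2))
    \<in> O(\<lambda>k. 1 / (real k * ln (real k) powr (c / 2 - s - 1 / 2)))"
proof -
  have "(\<lambda>k. block_level c k powr (2 * s - 1)) \<in> O(\<lambda>k. ln (real k) powr (s - 1/2))"
    unfolding block_level_def block_end_def by real_asymp
  moreover have "(\<lambda>k. exp (- (exp (- 1 / ln (real k)) * (2 * ln (block_end k) + c * ln (ln (block_end k)))) / 2))
    \<in> O(\<lambda>k. 1 / (real k * ln (real k) powr (c / 2 - 1)))"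
    unfolding block_end_def by real_asymp
  ultimately have "(\<lambda>k. block_level c k powr (2 * s - 1) * exp (- (exp (- 1 / ln (real k)) * (2 * ln (block_end k) + c * ln (ln (block_end k)))) / 2))
    \<in> O(\<lambda>k. ln (real k) powr (s - 1/2) * (1 / (real k * ln (real k) powr (c / 2 - 1))))"
    by (rule landau_o.big.mult)
  also have "(\<lambda>k. ln (real k) powr (s - 1/2) * (1 / (real k * ln (real k) powr (c / 2 - 1))))
    = (\<lambda>k. 1 / (real k * ln (real k) powr (c / 2 - s - 1 / 2)))"
  proof
    fix k
    have "ln (real k) powr (c / 2 - 1) = ln (real k) powr (s - 1/2) * ln (real k) powr (c / 2 - s - 1 / 2)"
      by (simp add: powr_add[symmetric])
    then show "ln (real k) powr (s - 1/2) * (1 / (real k * ln (real k) powr (c / 2 - 1)))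
      = 1 / (real k * ln (real k) powr (c / 2 - s - 1 / 2))"
      by (cases "ln (real k) powr (s - 1/2) = 0") auto
  qed
  also have "(\<lambda>k. block_level c k powr (2 * s - 1) * exp (- (exp (- 1 / ln (real k)) * (2 * ln (block_end k) + c * ln (ln (block_end k)))) / 2))
    \<in> O(\<lambda>k. 1 / (real k * ln (real k) powr (c / 2 - s - 1 / 2))) \<longleftrightarrow> ?thesis"
  proof (rule landau_o.big.in_cong)
    have "eventually (\<lambda>k. 0 \<le> 2 * ln (block_end k) + c * ln (ln (block_end k))) sequentially"
      unfolding block_end_def by real_asymp
    then show "eventually (\<lambda>k. block_level c k powr (2 * s - 1) * exp (- (exp (- 1 / ln (real k)) * (2 * ln (block_end k) + c * ln (ln (block_end k)))) / 2)
      = block_level c k powr (2 * s - 1) * exp (- (block_level c k)\<^sup>2 / 2)) sequentially"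
    proof eventually_elim
      case (elim k)
      have "(exp (- 1 / (2 * ln (real k))))\<^sup>2 = exp (- 1 / ln (real k))"
        by (simp add: power2_eq_square exp_add[symmetric])
      then show ?case using elim by (simp add: block_level_def power_mult_distrib)
    qed
  qed
  finally show ?thesis .
qed

text \<open>The block of \<open>n\<close> is found through the least \<open>j > k1\<close> with
  \<open>ln n < block_end j\<close>. Minimality supplies the other inequality, so no monotonicity of
  \<open>block_end\<close> enters.\<close>

lemma eventually_in_block:
  assumes k: "eventually P sequentially"
    and P: "\<And>k n. P k \<Longrightarrow> block_end k \<le> ln (real n) \<Longrightarrow> ln (real n) < block_end (Suc k) \<Longrightarrow> Q n"
  shows "eventually Q sequentially"
proof -
  obtain k1 where k1: "\<And>k. k \<ge> k1 \<Longrightarrow> P k" using k by (auto simp: eventually_sequentially)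
  have "eventually (\<lambda>n. block_end k1 \<le> ln (real n)) sequentially" by real_asymp
  then show ?thesis
  proof eventually_elim
    case (elim n)
    have "eventually (\<lambda>j. ln (real n) < block_end j \<and> j > k1) sequentially"
      using block_end_at_top eventually_gt_at_top[of k1]
      by (intro eventually_conj) (auto simp: filterlim_at_top_dense)
    then have ex: "\<exists>j. ln (real n) < block_end j \<and> j > k1"
      using eventually_happens'[OF sequentially_bot] by blast
    define j where "j = (LEAST j. ln (real n) < block_end j \<and> j > k1)"
    have j: "ln (real n) < block_end j" "j > k1" unfolding j_def using LeastI_ex[OF ex] by auto
    then obtain i where i: "j = Suc i" by (cases j) auto
    have "\<not> (ln (real n) < block_end i \<and> i > k1)"
      using not_less_Least[of i "\<lambda>j. ln (real n) < block_end j \<and> j > k1"] i unfolding j_def by simp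
    then have "block_end i \<le> ln (real n)" using elim j i by (cases "i = k1") auto
    then show ?case using P[of i n] k1[of i] j i by simp
  qed
qed

context gaussian_dynamics
begin

lemma S_right_constant:
  assumes "\<forall>i. \<forall>t\<ge>0. \<exists>e>0. \<forall>u\<in>{t..<t + e}. X i u \<omega> = X i t \<omega>" "0 \<le> t"
  shows "\<exists>e>0. \<forall>u\<in>{t..<t + e}. S n u \<omega> = S n t \<omega>"
proof (induction n)
  case 0
  then show ?case by (auto simp: S_def intro: exI[of _ 1])
next
  case (Suc n)
  then obtain e where e: "e > 0" "\<And>u. u \<in> {t..<t + e} \<Longrightarrow> S n u \<omega> = S n t \<omega>" by blast
  obtain e' where e': "e' > 0" "\<And>u. u \<in> {t..<t + e'} \<Longrightarrow> X n u \<omega> = X n t \<omega>" using assms by blast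
  have "S (Suc n) u \<omega> = S (Suc n) t \<omega>" if "u \<in> {t..<t + min e e'}" for u
    using e(2)[of u] e'(2)[of u] that by (auto simp: S_def)
  moreover have "min e e' > 0" using e e' by simp
  ultimately show ?case by blast
qed

text \<open>In block \<open>k\<close> the set \<open>F\<close> is covered by order
  \<open>H powr (2 * s)\<close> windows of length \<open>1 / (100 * H\<^sup>2)\<close>, each of
  which contains an exceedance with probability of order \<open>exp (- H\<^sup>2 / 2) / H\<close>.
  The sum over the blocks is the series of \<open>block_level_summand\<close>.\<close>

theorem upper_bound_AE:
  assumes F: "F \<subseteq> {0..1}" "boxed s F" and s: "0 \<le> s" "3 + 2 * s < c"
  shows "AE \<omega> in M. eventually (\<lambda>n. \<forall>t\<in>F. S n t \<omega> \<le> sqrt (real n * barrier c n)) sequentially"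
proof -
  obtain C where C: "\<And>r A. r \<in> {0<..1} \<Longrightarrow> finite A \<Longrightarrow> A \<subseteq> F \<Longrightarrow> separated r A \<Longrightarrow> real (card A) \<le> C * r powr (- s)"
    using F(2) unfolding boxed_def by blast
  \<comment> \<open>The largest walk time that block \<open>k\<close> can contain; the maximal
    inequality is applied up to this time.\<close>
  define N where "N k = nat \<lfloor>exp (block_end (Suc k))\<rfloor>" for k
  define H where "H k = block_level c k" for k
  \<comment> \<open>Half the window length of the maximal inequality, so that one window covers all
    points within \<rho> of a net point.\<close>
  define \<rho> where "\<rho> k = 1 / (200 * (H k)\<^sup>2)" for k
  define good where "good k \<longleftrightarrow> 2 \<le> H k \<and> (10 * H k)\<^sup>2 \<le> exp (block_end (Suc k)) - 1
    \<and> block_end (Suc k) - block_end k \<le> 1 / ln (real k) \<and> exp 1 \<le> block_end k \<and> 2 \<le> k" for k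
  have good: "eventually good sequentially"
  proof -
    have "eventually (\<lambda>k. 2 \<le> H k) sequentially"
      unfolding H_def block_level_def block_end_def by real_asymp
    moreover have "eventually (\<lambda>k. (10 * H k)\<^sup>2 \<le> exp (block_end (Suc k)) - 1) sequentially"
      unfolding H_def block_level_def block_end_def by real_asymp
    moreover have "eventually (\<lambda>k. block_end (Suc k) - block_end k \<le> 1 / ln (real k)) sequentially"
      unfolding block_end_def by real_asymp
    moreover have "eventually (\<lambda>k. exp 1 \<le> block_end k) sequentially"
      unfolding block_end_def by real_asymp
    ultimately show ?thesis using eventually_ge_at_top[of 2] unfolding good_def by eventually_elim auto
  qed
  have \<rho>: "\<rho> k \<in> {0<..1}" if "good k" for k
  proof -
    have "4 \<le> (H k)\<^sup>2" using power_mono[of 2 "H k" 2] that by (simp add: good_def)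
    then show ?thesis by (auto simp: \<rho>_def divide_le_eq)
  qed
  have "\<exists>A. good k \<longrightarrow> finite A \<and> A \<subseteq> F \<and> separated (\<rho> k) A \<and> (\<forall>t\<in>F. \<exists>a\<in>A. \<bar>t - a\<bar> < \<rho> k \<or> t = a)" for k
    using maximal_separated[of F "\<rho> k" "C * \<rho> k powr (- s)"] C[of "\<rho> k"] \<rho>[of k] by blast
  then obtain A where A: "\<And>k. good k \<Longrightarrow> finite (A k) \<and> A k \<subseteq> F \<and> separated (\<rho> k) (A k) \<and> (\<forall>t\<in>F. \<exists>a\<in>A k. \<bar>t - a\<bar> < \<rho> k \<or> t = a)"
    by metis
  \<comment> \<open>Rational times keep the event countable, and the window is clipped at 0 where
    the clocks start. Clipping moves its right end only to the right, so points close to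
    \<open>a\<close> stay covered.\<close>
  define T where "T k a = {max 0 (a - \<rho> k)..<max 0 (a - \<rho> k) + 1 / (100 * (H k)\<^sup>2)} \<inter> \<rat>" for k a
  have rat: "countable (\<rat> :: real set)" unfolding Rats_def by simp
  have T: "countable (T k a)" for k a
    by (rule countable_subset[OF _ rat]) (simp add: T_def)
  define E1 where "E1 k a = {\<omega>\<in>space M. \<exists>n\<le>N k. \<exists>t\<in>T k a. sqrt (real (N k)) * H k < S n t \<omega>}" for k a
  define E where "E k = (if good k then \<Union>a\<in>A k. E1 k a else {})" for k
  have [measurable]: "E1 k a \<in> sets M" for k a
  proof -
    note [measurable] = T[of k a]
    show ?thesis unfolding E1_def by measurable
  qed
  have Em [measurable]: "E k \<in> sets M" for k
    using A[of k] unfolding E_def by (auto intro!: sets.finite_UN)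
  have E1: "prob (E1 k a) \<le> 200 * exp 48 * (exp (- (H k)\<^sup>2/2) / H k)" if "good k" for k a
    unfolding E1_def
  proof (rule maximal_inequality)
    show "0 \<le> max 0 (a - \<rho> k)" by simp
    show H: "2 \<le> H k" using that by (simp add: good_def)
    have "(10 * H k)\<^sup>2 \<le> real (N k)" using that unfolding good_def N_def by linarith
    then show "10 * H k \<le> sqrt (real (N k))" by (rule real_le_rsqrt)
  qed (rule T, simp add: T_def)
  have sum: "summable (\<lambda>k. prob (E k))"
  proof (rule summable_comparison_test_bigo)
    show "summable (\<lambda>k. norm (1 / (real k * ln (real k) powr (c / 2 - s - 1 / 2))))"
      using summable_bertrand[of "c / 2 - s - 1 / 2"] s by (simp add: abs_mult)
    have "(\<lambda>k. prob (E k)) \<in> O(\<lambda>k. H k powr (2 * s - 1) * exp (- (H k)\<^sup>2 / 2))"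
    proof (rule bigoI)
      show "eventually (\<lambda>k. norm (prob (E k)) \<le> (C * 200 powr s * (200 * exp 48)) * norm (H k powr (2 * s - 1) * exp (- (H k)\<^sup>2 / 2))) sequentially"
        using good
      proof eventually_elim
        case (elim k)
        have H: "2 \<le> H k" using elim by (simp add: good_def)
        have "prob (E k) \<le> (\<Sum>a\<in>A k. prob (E1 k a))"
          using A[OF elim] elim unfolding E_def by (auto intro!: measure_UNION_le)
        also have "\<dots> \<le> (\<Sum>a\<in>A k. 200 * exp 48 * (exp (- (H k)\<^sup>2/2) / H k))"
          by (intro sum_mono E1 elim)
        also have "\<dots> = real (card (A k)) * (200 * exp 48 * (exp (- (H k)\<^sup>2/2) / H k))" by simp
        also have "\<dots> \<le> (C * \<rho> k powr (- s)) * (200 * exp 48 * (exp (- (H k)\<^sup>2/2) / H k))"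
          using A[OF elim] C[OF \<rho>[OF elim]] H by (intro mult_right_mono) auto
        also have "\<rho> k powr (- s) = 200 powr s * H k powr (2 * s)"
        proof -
          have "\<rho> k powr (- s) = (200 * (H k)\<^sup>2) powr s"
            unfolding \<rho>_def using H by (simp add: powr_minus powr_divide)
          also have "\<dots> = 200 powr s * (H k powr 2) powr s" using H by (simp add: powr_mult)
          finally show ?thesis by (simp only: powr_powr)
        qed
        also have "(C * (200 powr s * H k powr (2 * s))) * (200 * exp 48 * (exp (- (H k)\<^sup>2/2) / H k))
          = (C * 200 powr s * (200 * exp 48)) * ((H k powr (2 * s) / H k) * exp (- (H k)\<^sup>2 / 2))"
          by simp
        also have "H k powr (2 * s) / H k = H k powr (2 * s - 1)" using H by (simp add: powr_diff)
        finally show ?case by simp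
      qed
    qed
    also have "(\<lambda>k. H k powr (2 * s - 1) * exp (- (H k)\<^sup>2 / 2)) \<in> O(\<lambda>k. 1 / (real k * ln (real k) powr (c / 2 - s - 1 / 2)))"
      unfolding H_def by (rule block_level_summand)
    finally show "(\<lambda>k. prob (E k)) \<in> O(\<lambda>k. 1 / (real k * ln (real k) powr (c / 2 - s - 1 / 2)))" .
  qed
  have "AE \<omega> in M. eventually (\<lambda>k. \<omega> \<in> space M - E k) sequentially"
    by (rule borel_cantelli_AE1[OF Em _ sum]) (simp add: emeasure_eq_measure)
  then show ?thesis
    using right_continuous
  proof eventually_elim
    case (elim \<omega>)
    from eventually_conj[OF elim(1) good]
    show ?case
    proof (rule eventually_in_block)
      fix k n
      assume k: "\<omega> \<in> space M - E k \<and> good k" and n: "block_end k \<le> ln (real n)" "ln (real n) < block_end (Suc k)"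
      have g: "2 \<le> H k" "block_end (Suc k) - block_end k \<le> 1 / ln (real k)" "exp 1 \<le> block_end k" "2 \<le> k"
        using k by (auto simp: good_def)
      have e1: "(0::real) < exp 1" by simp
      have y: "1 \<le> ln (block_end k)" using g(3) ln_le_cancel_iff[OF e1, of "block_end k"] e1 by (simp add: less_le_trans[OF e1])
      have npos: "0 < real n"
      proof (rule ccontr)
        assume "\<not> 0 < real n"
        then have "n = 0" by simp
        then show False using n(1) g(3) e1 by simp
      qed
      have nN: "n \<le> N k"
      proof -
        have "real n < exp (block_end (Suc k))" using n(2) npos by (metis exp_less_cancel_iff exp_ln)
        then show ?thesis unfolding N_def by linarith
      qed
      have level: "sqrt (real (N k)) * H k \<le> sqrt (real n * barrier c n)"
      proof -
        have b: "0 \<le> 2 * ln (block_end k) + c * ln (ln (block_end k))"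
          using y s by (intro add_nonneg_nonneg mult_nonneg_nonneg) auto
        have "real (N k) \<le> exp (block_end (Suc k))" unfolding N_def by simp
        also have "\<dots> \<le> exp (block_end k + 1 / ln (real k))" using g(2) by simp
        also have "\<dots> = exp (block_end k) * exp (1 / ln (real k))" by (rule exp_add)
        also have "\<dots> \<le> real n * exp (1 / ln (real k))"
          using n(1) npos by (intro mult_right_mono) (auto simp: ln_ge_iff)
        finally have "sqrt (real (N k)) \<le> sqrt (real n * exp (1 / ln (real k)))" by simp
        also have "\<dots> = sqrt (real n) * exp (1 / (2 * ln (real k)))"
        proof -
          have "exp (1 / ln (real k)) = (exp (1 / (2 * ln (real k))))\<^sup>2"
            by (simp add: power2_eq_square exp_add[symmetric])
          then show ?thesis by (simp add: real_sqrt_mult)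
        qed
        finally have "sqrt (real (N k)) * H k \<le> sqrt (real n) * exp (1 / (2 * ln (real k))) * H k"
          using g(1) by (intro mult_right_mono) auto
        also have "\<dots> = sqrt (real n) * sqrt (2 * ln (block_end k) + c * ln (ln (block_end k)))"
          unfolding H_def block_level_def by (simp add: exp_minus)
        also have "\<dots> \<le> sqrt (real n) * sqrt (barrier c n)"
        proof (intro mult_left_mono real_sqrt_le_mono)
          have 1: "ln (block_end k) \<le> ln (ln (real n))" using n(1) g(3) e1 by (simp add: less_le_trans[OF e1])
          then have "ln (ln (block_end k)) \<le> ln (ln (ln (real n)))" using y by simp
          then show "2 * ln (block_end k) + c * ln (ln (block_end k)) \<le> barrier c n"
            unfolding barrier_def using 1 s by (intro add_mono mult_left_mono) auto
        qed simp
        finally show ?thesis by (simp add: real_sqrt_mult)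
      qed
      show "\<forall>t\<in>F. S n t \<omega> \<le> sqrt (real n * barrier c n)"
      proof
        fix t assume t: "t \<in> F"
        then have t0: "0 \<le> t" using F(1) by auto
        obtain a where a: "a \<in> A k" "\<bar>t - a\<bar> < \<rho> k \<or> t = a" using A[of k] k t by blast
        have r0: "0 < \<rho> k" using \<rho>[of k] k by auto
        define b where "b = max 0 (a - \<rho> k)"
        have w: "1 / (100 * (H k)\<^sup>2) = 2 * \<rho> k" by (simp add: \<rho>_def)
        have tb: "b \<le> t" "t < b + 2 * \<rho> k" using a(2) t0 r0 by (auto simp: b_def)
        obtain e where e: "e > 0" "\<And>u. u \<in> {t..<t + e} \<Longrightarrow> S n u \<omega> = S n t \<omega>"
          using S_right_constant[OF elim(2) t0] by blast
        \<comment> \<open>Right continuity replaces \<open>t\<close> by a rational time in the same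
          window at which the walk has the same value.\<close>
        have "t < min (t + e) (b + 2 * \<rho> k)" using tb e by simp
        then obtain q where q: "q \<in> \<rat>" "t < q" "q < min (t + e) (b + 2 * \<rho> k)" using Rats_dense_in_real by blast
        have "q \<in> T k a" unfolding T_def w b_def[symmetric] using q tb by auto
        moreover have "\<omega> \<notin> E1 k a" using k a(1) unfolding E_def by auto
        ultimately have "S n q \<omega> \<le> sqrt (real (N k)) * H k"
          using k nN unfolding E1_def by (auto simp: not_less)
        moreover have "S n q \<omega> = S n t \<omega>" using q by (intro e) auto
        ultimately show "S n t \<omega> \<le> sqrt (real n * barrier c n)" using level by simp
      qed
    qed
  qed
qed

end

subsection \<open>Lower bound\<close>

text \<open>The correction runs over ordered pairs, which counts every intersection twice; this only
  weakens the bound by a constant factor and avoids an order on the index set.\<close>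

lemma (in prob_space) bonferroni_lower:
  assumes "finite I" "\<And>i. i \<in> I \<Longrightarrow> A i \<in> events"
  shows "(\<Sum>i\<in>I. prob (A i)) - (\<Sum>i\<in>I. \<Sum>j\<in>I - {i}. prob (A i \<inter> A j)) \<le> prob (\<Union>i\<in>I. A i)"
  using assms
proof (induction I rule: finite_induct)
  case (insert x I)
  let ?U = "\<Union>i\<in>I. A i"
  have m: "?U \<in> events" "A x \<in> events" using insert by auto
  have "prob (A x \<inter> ?U) \<le> (\<Sum>j\<in>I. prob (A x \<inter> A j))"
  proof -
    have "A x \<inter> ?U = (\<Union>j\<in>I. A x \<inter> A j)" by auto
    moreover have "prob (\<Union>j\<in>I. A x \<inter> A j) \<le> (\<Sum>j\<in>I. prob (A x \<inter> A j))"
      using insert by (intro measure_UNION_le) auto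
    ultimately show ?thesis by simp
  qed
  moreover have "prob (A x \<union> ?U) = prob (A x) + prob ?U - prob (A x \<inter> ?U)"
    using measure_Un3[of "A x" M ?U] m by (simp add: fmeasurable_eq_sets)
  moreover have "(\<Sum>i\<in>insert x I. \<Sum>j\<in>insert x I - {i}. prob (A i \<inter> A j))
    \<ge> (\<Sum>j\<in>I. prob (A x \<inter> A j)) + (\<Sum>i\<in>I. \<Sum>j\<in>I - {i}. prob (A i \<inter> A j))"
  proof -
    have "insert x I - {x} = I" using insert by auto
    moreover have "(\<Sum>i\<in>I. \<Sum>j\<in>I - {i}. prob (A i \<inter> A j)) \<le> (\<Sum>i\<in>I. \<Sum>j\<in>insert x I - {i}. prob (A i \<inter> A j))"
      using insert by (intro sum_mono sum_mono2) auto
    ultimately show ?thesis using insert by simp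
  qed
  ultimately show ?case using insert by simp
qed simp

section \<open>One- and two-point estimates for increments of the walk\<close>

context gaussian_dynamics
begin

lemma S_diff: "q \<le> n \<Longrightarrow> S n t \<omega> - S q t \<omega> = (\<Sum>i\<in>{q..<n}. X i t \<omega>)"
  unfolding S_def using sum.atLeastLessThan_concat[of 0 q n "\<lambda>i. X i t \<omega>"] by (simp add: atLeast0LessThan)

lemma exp_pair_abs:
  assumes "0 \<le> s" "0 \<le> t"
  shows "(\<integral>\<^sup>+\<omega>. ennreal (exp (\<theta> * (X i s \<omega> + X i t \<omega>))) \<partial>M)
        \<le> ennreal (exp (\<theta>\<^sup>2) * (1 + exp (- \<bar>t - s\<bar>) * (exp (\<theta>\<^sup>2) - 1)))"
proof (cases "s \<le> t")
  case True
  then show ?thesis using exp_pair[of s t \<theta> i] assms by simp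
next
  case False
  then have "\<bar>t - s\<bar> = s - t" by simp
  then show ?thesis using exp_pair[of t s \<theta> i] assms False by (simp add: add.commute)
qed

lemma exp_single:
  assumes "0 \<le> t"
  shows "(\<integral>\<^sup>+\<omega>. ennreal (exp (\<theta> * X i t \<omega>)) \<partial>M) = ennreal (exp (\<theta>\<^sup>2 / 2))"
proof -
  have "(\<integral>\<^sup>+\<omega>. ennreal (exp (\<theta> * X i t \<omega>)) \<partial>M) = (\<integral>\<^sup>+x. ennreal (std_normal_density x) * ennreal (exp (\<theta> * x)) \<partial>lborel)"
    by (subst distributed_nn_integral[OF normal_X[OF assms], of "\<lambda>x. ennreal (exp (\<theta> * x))"]) auto
  also have "\<dots> = ennreal (exp (\<theta>\<^sup>2 / 2))"
    using std_normal_exp[of \<theta>] by (subst (asm) nn_integral_density) auto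
  finally show ?thesis .
qed

text \<open>With \<open>x = q / n\<close>, dropping the first \<open>q\<close> steps multiplies the
  normalised threshold by at most \<open>1 + x\<close>, that is, raises it by at most
  \<open>1 / h\<close>. The level \<open>h + 2 / h\<close> costs a factor \<open>exp (-4)\<close>
  compared with \<open>h\<close>, and its denominator a factor 3. The \<open>1 / h\<close> in the
  statement is a reserve against a negative contribution of the dropped steps.\<close>

lemma increment_lower:
  assumes t: "0 \<le> t" and q: "q < n" and h: "1 \<le> h" "real q * (h\<^sup>2 + 1) \<le> real n"
  shows "exp (-4) / 60 * (exp (- h\<^sup>2/2) / h) \<le> prob {\<omega>\<in>space M. sqrt (real n) * (h + 1 / h) < S n t \<omega> - S q t \<omega>}"
proof -
  have n: "0 < real n" using q by simp
  define x where "x = real q / real n"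
  have x0: "0 \<le> x" by (simp add: x_def)
  have xh: "x * (h\<^sup>2 + 1) \<le> 1" using h(2) n by (simp add: x_def divide_le_eq)
  have "x * 2 \<le> x * (h\<^sup>2 + 1)" using h(1) x0 by (intro mult_left_mono) (auto simp: one_le_power)
  then have x: "x \<le> 1 / 2" using xh by simp
  have nq: "real (n - q) = real n * (1 - x)" using q n by (simp add: x_def of_nat_diff field_simps)
  have "1 \<le> ((1 + x) * sqrt (1 - x))\<^sup>2"
  proof -
    have "((1 + x) * sqrt (1 - x))\<^sup>2 = (1 + x)\<^sup>2 * (1 - x)" using x by (simp add: power_mult_distrib)
    also have "\<dots> = 1 + x * (1 - x - x\<^sup>2)" by (simp add: power2_eq_square algebra_simps)
    also have "\<dots> \<ge> 1"
    proof -
      have "x\<^sup>2 \<le> (1/2)\<^sup>2" using x x0 by (intro power_mono)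
      then have "0 \<le> 1 - x - x\<^sup>2" using x by (simp add: power2_eq_square)
      then show ?thesis using x0 by simp
    qed
    finally show ?thesis .
  qed
  then have "1 \<le> (1 + x) * sqrt (1 - x)"
    using x x0 by (intro power2_le_imp_le[of 1]) auto
  then have s: "1 / sqrt (1 - x) \<le> 1 + x" using x by (simp add: divide_le_eq)
  have "sqrt (real n) * (h + 1 / h) / sqrt (real (n - q)) = (1 / sqrt (1 - x)) * (h + 1 / h)"
    unfolding nq using n by (simp add: real_sqrt_mult)
  also have "\<dots> \<le> (1 + x) * (h + 1 / h)" using s h by (intro mult_right_mono) auto
  also have "\<dots> \<le> h + 2 / h"
  proof -
    have "x * (h + 1 / h) = x * (h\<^sup>2 + 1) / h" using h by (simp add: field_simps power2_eq_square)
    moreover have "x * (h\<^sup>2 + 1) / h \<le> 1 / h" using xh h by (intro divide_right_mono) auto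
    moreover have "h + 2 / h = (h + 1 / h) + 1 / h" by simp
    moreover have "(1 + x) * (h + 1 / h) = (h + 1 / h) + x * (h + 1 / h)" by (simp only: distrib_right mult_1)
    ultimately show ?thesis using \<open>x * (h\<^sup>2 + 1) / h \<le> 1 / h\<close> by linarith
  qed
  finally have le: "sqrt (real n) * (h + 1 / h) / sqrt (real (n - q)) \<le> h + 2 / h" .
  have "exp (-4) / 60 * (exp (- h\<^sup>2/2) / h) = exp (- h\<^sup>2/2 - 4) / (20 * (3 * h))"
  proof -
    have "exp (- h\<^sup>2/2 - 4) = exp (- h\<^sup>2/2) * exp (-4)" by (simp add: exp_add[symmetric])
    then show ?thesis by simp
  qed
  also have "\<dots> \<le> exp (- (h + 2 / h)\<^sup>2 / 2) / (20 * (h + 2 / h))"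
  proof (intro frac_le)
    have "(h + 2 / h)\<^sup>2 = h\<^sup>2 + 4 + 4 / h\<^sup>2" using h by (simp add: power2_eq_square field_simps)
    moreover have "4 / h\<^sup>2 \<le> 4" using h by (simp add: divide_le_eq one_le_power)
    ultimately show "exp (- h\<^sup>2/2 - 4) \<le> exp (- (h + 2 / h)\<^sup>2 / 2)" by simp
    have "2 / h \<le> 2 * h" using h mult_mono[of 1 h 1 h] by (simp add: divide_le_eq)
    then show "20 * (h + 2 / h) \<le> 20 * (3 * h)" by simp
  qed (use h in \<open>auto intro!: add_pos_pos\<close>)
  also have "\<dots> \<le> normal_tail (h + 2 / h)" using h by (intro normal_tail_lower) (auto intro: add_increasing2)
  also have "\<dots> \<le> normal_tail (sqrt (real n) * (h + 1 / h) / sqrt (real (n - q)))"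
    by (rule normal_tail_antimono[OF le])
  also have "\<dots> = prob {\<omega>\<in>space M. sqrt (real n) * (h + 1 / h) < (\<Sum>i\<in>{q..<n}. X i t \<omega>)}"
    using prob_sum_X(1)[of "{q..<n}" t "sqrt (real n) * (h + 1 / h)"] t q by simp
  finally show ?thesis using q by (simp add: S_diff)
qed

text \<open>Coordinates below \<open>n\<close> enter with both times, the others only with
  \<open>u\<close>. Apart from \<open>n * \<theta> ^ 4\<close> the exponent is that of a Gaussian
  pair with correlation \<open>exp (- \<bar>u - t\<bar>)\<close> in each coordinate; the extra term
  appears because a mixture over clocks is not jointly Gaussian, and it comes from expanding
  \<open>exp (\<theta>\<^sup>2) - 1\<close> to second order.\<close>

lemma pair_mgf:
  assumes t: "0 \<le> t" "0 \<le> u" and n: "q \<le> n" "n \<le> m" and \<theta>: "0 \<le> \<theta>" "\<theta> \<le> 1"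
  shows "(\<integral>\<^sup>+\<omega>. ennreal (exp (\<theta> * ((S n t \<omega> - S q t \<omega>) + (S m u \<omega> - S q u \<omega>)))) \<partial>M)
    \<le> ennreal (exp (\<theta>\<^sup>2 / 2 * (real n + real m + 2 * real n * exp (- \<bar>u - t\<bar>)) + real n * \<theta> ^ 4))"
proof -
  define \<rho> where "\<rho> = exp (- \<bar>u - t\<bar>)"
  have \<rho>: "0 \<le> \<rho>" "\<rho> \<le> 1" by (auto simp: \<rho>_def)
  let ?Z = "\<lambda>i \<omega>. ennreal (exp (\<theta> * ((if i < n then X i t \<omega> else 0) + X i u \<omega>)))"
  have ind: "indep_vars (\<lambda>_. borel) ?Z {q..<m}"
  proof -
    have "indep_vars (\<lambda>_. borel) (\<lambda>i \<omega>. (\<lambda>f. ennreal (exp (\<theta> * ((if i < n then f t else 0) + f u)))) (\<lambda>t. X i t \<omega>)) {q..<m}"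
      by (rule indep_vars_compose2[OF indep_vars_subset[OF indep_X]]) auto
    then show ?thesis by simp
  qed
  have sum: "(S n t \<omega> - S q t \<omega>) + (S m u \<omega> - S q u \<omega>) = (\<Sum>i\<in>{q..<m}. (if i < n then X i t \<omega> else 0) + X i u \<omega>)" for \<omega>
  proof -
    have "(\<Sum>i\<in>{q..<m}. if i < n then X i t \<omega> else 0) = (\<Sum>i\<in>{q..<n}. X i t \<omega>)"
      using n by (intro sum.mono_neutral_cong_right) auto
    then show ?thesis using n by (simp add: S_diff sum.distrib)
  qed
  have "(\<integral>\<^sup>+\<omega>. ennreal (exp (\<theta> * ((S n t \<omega> - S q t \<omega>) + (S m u \<omega> - S q u \<omega>)))) \<partial>M)
    = (\<integral>\<^sup>+\<omega>. (\<Prod>i\<in>{q..<m}. ?Z i \<omega>) \<partial>M)"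
    unfolding sum by (simp add: sum_distrib_left exp_sum prod_ennreal)
  also have "\<dots> = (\<Prod>i\<in>{q..<m}. \<integral>\<^sup>+\<omega>. ?Z i \<omega> \<partial>M)"
    by (rule indep_vars_nn_integral[OF _ ind]) auto
  also have "\<dots> \<le> (\<Prod>i\<in>{q..<m}. ennreal (exp (\<theta>\<^sup>2 / 2 + (if i < n then \<theta>\<^sup>2 / 2 + \<rho> * \<theta>\<^sup>2 + \<theta> ^ 4 else 0))))"
  proof (rule prod_mono_ennreal)
    fix i
    show "(\<integral>\<^sup>+\<omega>. ?Z i \<omega> \<partial>M) \<le> ennreal (exp (\<theta>\<^sup>2 / 2 + (if i < n then \<theta>\<^sup>2 / 2 + \<rho> * \<theta>\<^sup>2 + \<theta> ^ 4 else 0)))"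
    proof (cases "i < n")
      case True
      have "\<theta>\<^sup>2 \<le> 1" using \<theta> by (simp add: power_le_one)
      then have "exp (\<theta>\<^sup>2) \<le> 1 + \<theta>\<^sup>2 + (\<theta>\<^sup>2)\<^sup>2" by (intro exp_bound) auto
      then have e: "exp (\<theta>\<^sup>2) - 1 \<le> \<theta>\<^sup>2 + \<theta> ^ 4" by simp
      have "(\<integral>\<^sup>+\<omega>. ?Z i \<omega> \<partial>M) \<le> ennreal (exp (\<theta>\<^sup>2) * (1 + \<rho> * (exp (\<theta>\<^sup>2) - 1)))"
        using exp_pair_abs[OF t, of \<theta> i] True by (simp add: \<rho>_def)
      also have "\<dots> \<le> ennreal (exp (\<theta>\<^sup>2) * exp (\<rho> * \<theta>\<^sup>2 + \<theta> ^ 4))"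
      proof (intro ennreal_leI mult_left_mono)
        have "\<rho> * (exp (\<theta>\<^sup>2) - 1) \<le> \<rho> * (\<theta>\<^sup>2 + \<theta> ^ 4)" using e \<rho> by (intro mult_left_mono)
        also have "\<dots> \<le> \<rho> * \<theta>\<^sup>2 + \<theta> ^ 4" using \<rho> mult_right_mono[of \<rho> 1 "\<theta> ^ 4"] by (simp add: distrib_left)
        finally show "1 + \<rho> * (exp (\<theta>\<^sup>2) - 1) \<le> exp (\<rho> * \<theta>\<^sup>2 + \<theta> ^ 4)"
          using exp_ge_add_one_self[of "\<rho> * \<theta>\<^sup>2 + \<theta> ^ 4"] by linarith
      qed simp
      finally show ?thesis using True by (simp add: exp_add[symmetric] algebra_simps)
    next
      case False
      then show ?thesis using exp_single[OF t(2), of \<theta> i] by simp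
    qed
  qed
  also have "\<dots> = ennreal (exp (\<Sum>i\<in>{q..<m}. \<theta>\<^sup>2 / 2 + (if i < n then \<theta>\<^sup>2 / 2 + \<rho> * \<theta>\<^sup>2 + \<theta> ^ 4 else 0)))"
    by (simp add: exp_sum prod_ennreal)
  also have "\<dots> \<le> ennreal (exp (\<theta>\<^sup>2 / 2 * (real n + real m + 2 * real n * \<rho>) + real n * \<theta> ^ 4))"
  proof (intro ennreal_leI exp_mono)
    have "(\<Sum>i\<in>{q..<m}. \<theta>\<^sup>2 / 2 + (if i < n then \<theta>\<^sup>2 / 2 + \<rho> * \<theta>\<^sup>2 + \<theta> ^ 4 else 0))
      \<le> (\<Sum>i<m. \<theta>\<^sup>2 / 2 + (if i < n then \<theta>\<^sup>2 / 2 + \<rho> * \<theta>\<^sup>2 + \<theta> ^ 4 else 0))"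
      using \<rho> by (intro sum_mono2) auto
    also have "\<dots> = real m * (\<theta>\<^sup>2 / 2) + (\<Sum>i<n. \<theta>\<^sup>2 / 2 + \<rho> * \<theta>\<^sup>2 + \<theta> ^ 4)"
    proof -
      have "(\<Sum>i<m. if i < n then \<theta>\<^sup>2 / 2 + \<rho> * \<theta>\<^sup>2 + \<theta> ^ 4 else 0) = (\<Sum>i<n. \<theta>\<^sup>2 / 2 + \<rho> * \<theta>\<^sup>2 + \<theta> ^ 4)"
        using n by (intro sum.mono_neutral_cong_right) auto
      then show ?thesis by (simp only: sum.distrib) simp
    qed
    also have "\<dots> = \<theta>\<^sup>2 / 2 * (real n + real m + 2 * real n * \<rho>) + real n * \<theta> ^ 4"
      by (simp add: algebra_simps)
    finally show "(\<Sum>i\<in>{q..<m}. \<theta>\<^sup>2 / 2 + (if i < n then \<theta>\<^sup>2 / 2 + \<rho> * \<theta>\<^sup>2 + \<theta> ^ 4 else 0))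
      \<le> \<theta>\<^sup>2 / 2 * (real n + real m + 2 * real n * \<rho>) + real n * \<theta> ^ 4" .
  qed
  finally show ?thesis by (simp add: \<rho>_def)
qed

text \<open>Chernoff bound for the sum of the two increments. Under perfect correlation the variance
  of the sum would be the square of \<open>r\<close>, which yields
  \<open>exp (- h\<^sup>2 / 2)\<close>. The hypothesis \<open>sep\<close> says that \<open>W\<close>
  falls short of it by at least \<open>n / (4 * K)\<close>, and this is the gain in the exponent.
  The condition \<open>h ^ 4 \<le> n\<close> keeps the non-Gaussian error below 1.\<close>

lemma pair_upper:
  assumes t: "0 \<le> t" "0 \<le> u" and n: "q \<le> n" "n \<le> m" "m \<le> 2 * n" and h: "0 < h" "h ^ 4 \<le> real n"
    and K: "1 \<le> K" and sep: "real n / (8 * K) \<le> sqrt (real n * real m) - real n * exp (- \<bar>u - t\<bar>)"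
  shows "prob {\<omega>\<in>space M. sqrt (real n) * h < S n t \<omega> - S q t \<omega> \<and> sqrt (real m) * h < S m u \<omega> - S q u \<omega>}
    \<le> exp (1 - h\<^sup>2 / 2 - h\<^sup>2 / (40 * K))"
proof -
  define \<rho> where "\<rho> = exp (- \<bar>u - t\<bar>)"
  have \<rho>: "0 \<le> \<rho>" "\<rho> \<le> 1" by (auto simp: \<rho>_def)
  have n0: "0 < real n" using h zero_less_power[of h 4] by linarith
  define W where "W = real n + real m + 2 * real n * \<rho>"
  have W: "0 < W" "real n + real m \<le> W" "W \<le> 5 * real n"
  proof -
    have "0 \<le> 2 * real n * \<rho>" "2 * real n * \<rho> \<le> 2 * real n" using \<rho> n0 by (auto simp: mult_left_le)
    moreover have "real m \<le> 2 * real n" using n(3) by linarith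
    ultimately show "0 < W" "real n + real m \<le> W" "W \<le> 5 * real n" using n0 unfolding W_def by linarith+
  qed
  define r where "r = sqrt (real n) + sqrt (real m)"
  define gm where "gm = sqrt (real n * real m)"
  have r2: "r\<^sup>2 = real n + real m + 2 * gm"
    by (simp add: r_def gm_def power2_sum real_sqrt_mult)
  have r0: "0 \<le> r" by (simp add: r_def)
  \<comment> \<open>The minimiser of the quadratic exponent
    \<open>- \<theta> * h * r + \<theta>\<^sup>2 * W / 2\<close>.\<close>
  define \<theta> where "\<theta> = h * r / W"
  have \<theta>2: "\<theta>\<^sup>2 \<le> h\<^sup>2 / real n"
  proof -
    have "2 * gm \<le> real n + real m"
      using arith_geo_mean_sqrt[of "real n" "real m"] unfolding gm_def by simp
    then have "r\<^sup>2 \<le> 2 * (real n + real m)" unfolding r2 by (simp add: algebra_simps)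
    also have "\<dots> \<le> 2 * W" using W by simp
    finally have "r\<^sup>2 / W\<^sup>2 \<le> 2 * W / W\<^sup>2" by (intro divide_right_mono) auto
    also have "\<dots> = 2 / W" using W by (simp add: power2_eq_square)
    also have "\<dots> \<le> 2 / (2 * real n)" using W n0 n(2) by (intro divide_left_mono) auto
    finally have "r\<^sup>2 / W\<^sup>2 \<le> 1 / real n" by simp
    then have "h\<^sup>2 * (r\<^sup>2 / W\<^sup>2) \<le> h\<^sup>2 * (1 / real n)" by (intro mult_left_mono) auto
    then show ?thesis by (simp add: \<theta>_def power_divide power_mult_distrib)
  qed
  have \<theta>0: "0 \<le> \<theta>" using h W r0 by (simp add: \<theta>_def)
  have h4: "h ^ 4 = (h\<^sup>2)\<^sup>2" by simp
  have n\<theta>4: "real n * \<theta> ^ 4 \<le> 1"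
  proof -
    have "(\<theta>\<^sup>2)\<^sup>2 \<le> (h\<^sup>2 / real n)\<^sup>2" using \<theta>2 by (intro power_mono) auto
    then have "\<theta> ^ 4 \<le> h ^ 4 / (real n)\<^sup>2" by (simp add: power_divide)
    then have "real n * \<theta> ^ 4 \<le> real n * (h ^ 4 / (real n)\<^sup>2)" by (intro mult_left_mono) auto
    also have "\<dots> = h ^ 4 / real n" using n0 by (simp add: power2_eq_square)
    also have "\<dots> \<le> 1" using h(2) n0 by simp
    finally show ?thesis .
  qed
  have \<theta>1: "\<theta> \<le> 1"
  proof -
    have "1 \<le> real n" using n0 by (simp add: Suc_le_eq)
    then have "\<theta> ^ 4 \<le> real n * \<theta> ^ 4" using \<theta>0 by (simp add: mult_right_le_one_le mult_le_cancel_right1)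
    then have "\<theta> ^ 4 \<le> 1 ^ 4" using n\<theta>4 by simp
    then show ?thesis using power_mono_iff[of \<theta> 1 4] \<theta>0 by simp
  qed
  let ?D = "\<lambda>\<omega>. (S n t \<omega> - S q t \<omega>) + (S m u \<omega> - S q u \<omega>)"
  have "ennreal (prob {\<omega>\<in>space M. sqrt (real n) * h < S n t \<omega> - S q t \<omega> \<and> sqrt (real m) * h < S m u \<omega> - S q u \<omega>})
    = (\<integral>\<^sup>+\<omega>. indicator {\<omega>\<in>space M. sqrt (real n) * h < S n t \<omega> - S q t \<omega> \<and> sqrt (real m) * h < S m u \<omega> - S q u \<omega>} \<omega> \<partial>M)"
    by (simp add: emeasure_eq_measure)
  also have "\<dots> \<le> (\<integral>\<^sup>+\<omega>. ennreal (exp (- \<theta> * (h * r))) * ennreal (exp (\<theta> * ?D \<omega>)) \<partial>M)"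
  proof (rule nn_integral_mono)
    fix \<omega>
    have "1 \<le> ennreal (exp (- \<theta> * (h * r))) * ennreal (exp (\<theta> * ?D \<omega>))"
      if "sqrt (real n) * h < S n t \<omega> - S q t \<omega>" "sqrt (real m) * h < S m u \<omega> - S q u \<omega>"
    proof -
      have "h * r \<le> ?D \<omega>" using that by (simp add: r_def algebra_simps)
      then have "\<theta> * (h * r) \<le> \<theta> * ?D \<omega>" using \<theta>0 by (rule mult_left_mono)
      then have "1 \<le> exp (- \<theta> * (h * r)) * exp (\<theta> * ?D \<omega>)" by (simp add: exp_add[symmetric])
      then show ?thesis by (simp add: ennreal_mult[symmetric] ennreal_1[symmetric] del: ennreal_1)
    qed
    then show "indicator {\<omega>\<in>space M. sqrt (real n) * h < S n t \<omega> - S q t \<omega> \<and> sqrt (real m) * h < S m u \<omega> - S q u \<omega>} \<omega>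
      \<le> ennreal (exp (- \<theta> * (h * r))) * ennreal (exp (\<theta> * ?D \<omega>))"
      by (auto split: split_indicator)
  qed
  also have "\<dots> = ennreal (exp (- \<theta> * (h * r))) * (\<integral>\<^sup>+\<omega>. ennreal (exp (\<theta> * ?D \<omega>)) \<partial>M)"
    by (rule nn_integral_cmult) measurable
  also have "\<dots> \<le> ennreal (exp (- \<theta> * (h * r))) * ennreal (exp (\<theta>\<^sup>2 / 2 * W + real n * \<theta> ^ 4))"
    unfolding W_def \<rho>_def by (intro mult_left_mono pair_mgf t n(1,2) \<theta>0 \<theta>1) simp
  also have "\<dots> = ennreal (exp (- \<theta> * (h * r) + \<theta>\<^sup>2 / 2 * W + real n * \<theta> ^ 4))"
    by (simp add: ennreal_mult[symmetric] exp_add[symmetric] add.assoc)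
  also have "\<dots> \<le> ennreal (exp (1 - h\<^sup>2 / 2 - h\<^sup>2 / (40 * K)))"
  proof (intro ennreal_leI exp_mono)
    have e: "- \<theta> * (h * r) + \<theta>\<^sup>2 / 2 * W = - (h\<^sup>2 / 2 * (r\<^sup>2 / W))"
      unfolding \<theta>_def using W by (simp add: power2_eq_square field_simps)
    have "1 + 1 / (20 * K) \<le> r\<^sup>2 / W"
    proof -
      have "(1 + 1 / (20 * K)) * W = W + W / (20 * K)" by (simp add: algebra_simps)
      also have "\<dots> \<le> W + 5 * real n / (20 * K)" using W K by (intro add_left_mono divide_right_mono) auto
      also have "\<dots> = W + 2 * (real n / (8 * K))" by simp
      also have "\<dots> \<le> W + 2 * (gm - real n * \<rho>)" 
        using sep unfolding \<rho>_def gm_def[symmetric] by (intro add_left_mono mult_left_mono) auto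
      also have "\<dots> = r\<^sup>2" unfolding r2 W_def by simp
      finally show ?thesis using W by (simp add: le_divide_eq)
    qed
    then have "h\<^sup>2 / 2 * (1 + 1 / (20 * K)) \<le> h\<^sup>2 / 2 * (r\<^sup>2 / W)" by (intro mult_left_mono) auto
    then have "h\<^sup>2 / 2 + h\<^sup>2 / (40 * K) \<le> h\<^sup>2 / 2 * (r\<^sup>2 / W)" by (simp add: algebra_simps)
    then show "- \<theta> * (h * r) + \<theta>\<^sup>2 / 2 * W + real n * \<theta> ^ 4 \<le> 1 - h\<^sup>2 / 2 - h\<^sup>2 / (40 * K)"
      using n\<theta>4 unfolding e by linarith
  qed
  finally show ?thesis by (simp add: ennreal_le_iff)
qed

end

text \<open>
  Group \<open>k\<close> of the walk times: \<open>time_point K k i\<close> runs through a grid of \<open>{K ^ (4 * k)..<2 * K ^ (4 * k)}\<close>, and all earlier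
  groups lie below \<open>group_start K k\<close>.
\<close>

definition time_point :: "nat \<Rightarrow> nat \<Rightarrow> nat \<Rightarrow> nat" where
  "time_point K k i = K ^ (4 * k - 1) * (K + i)"

definition group_start :: "nat \<Rightarrow> nat \<Rightarrow> nat" where
  "group_start K k = 2 * K ^ (4 * k - 4)"

lemma time_point_bounds:
  assumes "1 \<le> k" "i < K"
  shows "K ^ (4 * k) \<le> time_point K k i" "time_point K k i \<le> 2 * K ^ (4 * k)"
    "time_point K k i = K ^ (4 * k) + K ^ (4 * k - 1) * i"
proof -
  have "4 * k = Suc (4 * k - 1)" using assms by simp
  then have "K ^ (4 * k) = K ^ Suc (4 * k - 1)" by simp
  then have e: "K ^ (4 * k) = K ^ (4 * k - 1) * K" by simp
  show eq: "time_point K k i = K ^ (4 * k) + K ^ (4 * k - 1) * i"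
    unfolding e time_point_def by (simp add: distrib_left)
  have "K ^ (4 * k - 1) * i \<le> K ^ (4 * k)" unfolding e using assms by simp
  then show "K ^ (4 * k) \<le> time_point K k i" "time_point K k i \<le> 2 * K ^ (4 * k)" unfolding eq by auto
qed

lemma group_start_power:
  assumes "1 \<le> k" shows "K ^ 4 * group_start K k = 2 * K ^ (4 * k)"
proof -
  have "4 * k = 4 + (4 * k - 4)" using assms by simp
  then have "K ^ (4 * k) = K ^ (4 + (4 * k - 4))" by simp
  then show ?thesis by (simp add: group_start_def power_add)
qed

lemma time_point_less:
  assumes "1 \<le> k" "i < j" "j < K"
  shows "real (time_point K k i) * (1 + 1 / (2 * real K)) \<le> real (time_point K k j)"
proof -
  have K: "0 < real K" using assms by simp
  have "time_point K k i + K ^ (4 * k - 1) \<le> time_point K k j"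
  proof -
    have "time_point K k i + K ^ (4 * k - 1) = K ^ (4 * k - 1) * (K + Suc i)" by (simp add: time_point_def)
    also have "\<dots> \<le> time_point K k j" unfolding time_point_def using assms by (intro mult_left_mono) auto
    finally show ?thesis .
  qed
  then have "real (time_point K k i) + real (K ^ (4 * k - 1)) \<le> real (time_point K k j)"
    by (simp only: of_nat_add[symmetric] of_nat_le_iff)
  moreover have "real (time_point K k i) * (1 / (2 * real K)) \<le> real (K ^ (4 * k - 1))"
  proof -
    have "time_point K k i \<le> K ^ (4 * k - 1) * (2 * K)" unfolding time_point_def using assms by (intro mult_left_mono) auto
    then have "real (time_point K k i) \<le> real (K ^ (4 * k - 1) * (2 * K))" by (simp only: of_nat_le_iff)
    also have "\<dots> = real (K ^ (4 * k - 1)) * (2 * real K)" by simp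
    finally show ?thesis using K by (simp add: divide_le_eq)
  qed
  ultimately show ?thesis by (simp only: distrib_left mult_1_right)
qed

lemma exp_neg_le: "exp (- x) \<le> 1 - x / 2" if "0 \<le> x" "x \<le> 1" for x :: real
proof -
  have "exp (- x) \<le> 1 / (1 + x)" using exp_ge_add_one_self[of x] that by (simp add: exp_minus inverse_eq_divide frac_le)
  also have "\<dots> \<le> 1 - x / 2"
  proof -
    have "x\<^sup>2 \<le> x" using that by (simp add: power2_eq_square mult_left_le)
    then have "1 \<le> (1 - x / 2) * (1 + x)" by (simp add: power2_eq_square algebra_simps)
    then show ?thesis using that by (simp add: divide_le_eq)
  qed
  finally show ?thesis .
qed

section \<open>Second-moment bound on a group of walk times and independence of the groups\<close>

context gaussian_dynamics
begin

text \<open>Increments from \<open>group_start\<close> on are used in place of the walk itself, so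
  that different groups involve disjoint sets of coordinates.\<close>

definition group_event :: "nat \<Rightarrow> nat \<Rightarrow> real \<Rightarrow> real set \<Rightarrow> 'w set" where
  "group_event K k h A = {\<omega>\<in>space M. \<exists>i<K. \<exists>t\<in>A. sqrt (real (time_point K k i)) * (h + 1 / h)
     < S (time_point K k i) t \<omega> - S (group_start K k) t \<omega>}"

text \<open>Bonferroni over the \<open>K * card A\<close> grid points. Two points exceed jointly
  with probability at most \<open>exp (1 - h\<^sup>2 / 2 - h\<^sup>2 / (40 * K))\<close>, and there
  are at most \<open>2 * K\<^sup>2\<close> partners for each point; the hypothesis
  \<open>small\<close> makes this correction at most half of the main term.\<close>

lemma group_lower:
  assumes K: "2 \<le> K" and k: "2 \<le> k" and A: "finite A" "A \<subseteq> {0..1}" "separated (1 / real K) A" "card A \<le> 2 * K"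
    and h: "1 \<le> h" "2 * (h\<^sup>2 + 1) \<le> real K ^ 4"
    and small: "2 * (real K)\<^sup>2 * exp (1 - h\<^sup>2 / (40 * real K)) \<le> exp (-4) / 120 / h"
  shows "real K * real (card A) * (exp (-4) / 120 / h) * exp (- h\<^sup>2 / 2) \<le> prob (group_event K k h A)"
proof -
  let ?n = "\<lambda>i. time_point K k i" and ?q = "group_start K k"
  have k1: "1 \<le> k" using k by simp
  have K0: "0 < real K" using K by simp
  define E where "E = (\<lambda>(i, t). {\<omega>\<in>space M. sqrt (real (?n i)) * (h + 1 / h) < S (?n i) t \<omega> - S ?q t \<omega>})"
  have [measurable]: "E z \<in> sets M" for z unfolding E_def by (cases z) simp
  define I where "I = {..<K} \<times> A"
  have finI: "finite I" using A by (simp add: I_def)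
  have cardI: "real (card I) = real K * real (card A)" by (simp add: I_def card_cartesian_product)
  have union: "group_event K k h A = (\<Union>z\<in>I. E z)"
    by (auto simp: group_event_def E_def I_def)
  have qh: "real ?q * (h\<^sup>2 + 1) \<le> real (?n i)" if "i < K" for i
  proof -
    have "2 * (real ?q * (h\<^sup>2 + 1)) \<le> real K ^ 4 * real ?q"
      using mult_right_mono[OF h(2), of "real ?q"] by (simp add: algebra_simps)
    also have "\<dots> = real (K ^ 4 * ?q)" by simp
    also have "\<dots> = 2 * real (K ^ (4 * k))" unfolding group_start_power[OF k1] by simp
    also have "real (K ^ (4 * k)) \<le> real (?n i)"
      using time_point_bounds(1)[OF k1 that] by (simp only: of_nat_le_iff)
    finally show ?thesis by simp
  qed
  have qn: "?q < ?n i" if "i < K" for i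
  proof -
    have "real ?q * 2 \<le> real ?q * (h\<^sup>2 + 1)" using h(1) by (intro mult_left_mono) (auto simp: one_le_power)
    then have "real (2 * ?q) \<le> real (?n i)" using qh[OF that] by simp
    then have "2 * ?q \<le> ?n i" by (simp only: of_nat_le_iff)
    moreover have "0 < ?q" using K by (simp add: group_start_def)
    ultimately show ?thesis by linarith
  qed
  have single: "2 * (exp (-4) / 120 / h * exp (- h\<^sup>2/2)) \<le> prob (E z)" if "z \<in> I" for z
  proof -
    obtain i t where z: "z = (i, t)" "i < K" "t \<in> A" using \<open>z \<in> I\<close> by (auto simp: I_def)
    have "0 \<le> t" using z A by auto
    from increment_lower[OF this qn[OF z(2)] h(1) qh[OF z(2)]]
    show ?thesis by (simp add: z E_def)
  qed
  have h4: "h ^ 4 \<le> real (?n i)" if "i < K" for i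
  proof -
    have "h\<^sup>2 \<le> 2 * (h\<^sup>2 + 1)" by simp
    then have "h\<^sup>2 \<le> real K ^ 4" using h(2) by (rule order_trans)
    then have "(h\<^sup>2)\<^sup>2 \<le> (real K ^ 4)\<^sup>2" by (intro power_mono) auto
    also have "\<dots> = real K ^ 8" by simp
    also have "\<dots> \<le> real K ^ (4 * k)" using K k by (intro power_increasing) auto
    also have "\<dots> = real (K ^ (4 * k))" by simp
    also have "\<dots> \<le> real (?n i)" using time_point_bounds(1)[OF k1 that] by (simp only: of_nat_le_iff)
    finally show ?thesis by simp
  qed
  have pair_ordered: "prob (E (i, t) \<inter> E (j, u)) \<le> exp (1 - h\<^sup>2 / 2 - h\<^sup>2 / (40 * real K))"
    if *: "(i, t) \<in> I" "(j, u) \<in> I" "(i, t) \<noteq> (j, u)" "i \<le> j" for i j t u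
  proof -
    have ij: "i < K" "j < K" "t \<in> A" "u \<in> A" using * by (auto simp: I_def)
    then have tu: "0 \<le> t" "0 \<le> u" using A by auto
    have nm: "?n i \<le> ?n j" unfolding time_point_def using *(4) by (intro mult_left_mono) auto
    have n0: "0 < real (?n i)" using qn[OF ij(1)] by simp
    have m2: "?n j \<le> 2 * ?n i" using time_point_bounds(2)[OF k1 ij(2)] time_point_bounds(1)[OF k1 ij(1)] by linarith
    \<comment> \<open>Two grid points differ either in the walk time, and then the ratio of the two
      walk times is at least \<open>1 + 1 / (2 * K)\<close>, or in the dynamical time, and then the
      correlation is at most \<open>exp (- 1 / K)\<close>. Both give a gap of order
      \<open>1 / K\<close>.\<close>
    have sep: "real (?n i) / (8 * real K) \<le> sqrt (real (?n i) * real (?n j)) - real (?n i) * exp (- \<bar>u - t\<bar>)"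
    proof (cases "t = u")
      case True
      then have "i < j" using * by auto
      from time_point_less[OF k1 this ij(2)]
      have m: "real (?n i) * (1 + 1 / (2 * real K)) \<le> real (?n j)" .
      have "(1 + 1 / (8 * real K))\<^sup>2 \<le> 1 + 1 / (2 * real K)"
      proof -
        define y where "y = 1 / (8 * real K)"
        have "0 \<le> y" "y \<le> 1" using K by (auto simp: y_def divide_le_eq)
        then have "y\<^sup>2 \<le> y" by (simp add: power2_eq_square mult_left_le)
        moreover have "1 / (2 * real K) = 4 * y" by (simp add: y_def)
        ultimately show ?thesis unfolding y_def[symmetric] using \<open>0 \<le> y\<close> by (simp add: power2_sum)
      qed
      then have "(real (?n i))\<^sup>2 * (1 + 1 / (8 * real K))\<^sup>2 \<le> (real (?n i))\<^sup>2 * (1 + 1 / (2 * real K))"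
        by (intro mult_left_mono) auto
      also have "\<dots> = real (?n i) * (real (?n i) * (1 + 1 / (2 * real K)))" by (simp add: power2_eq_square mult.assoc)
      also have "\<dots> \<le> real (?n i) * real (?n j)" using m by (intro mult_left_mono) auto
      finally have "real (?n i) * (1 + 1 / (8 * real K)) \<le> sqrt (real (?n i) * real (?n j))"
        by (intro real_le_rsqrt) (simp add: power_mult_distrib)
      then show ?thesis using True by (simp add: distrib_left)
    next
      case False
      then have "1 / real K \<le> \<bar>u - t\<bar>" using A(3) ij unfolding separated_def by (auto simp: abs_minus_commute)
      then have "exp (- \<bar>u - t\<bar>) \<le> exp (- (1 / real K))" by simp
      also have "\<dots> \<le> 1 - 1 / real K / 2" using K by (intro exp_neg_le) auto
      finally have "real (?n i) * exp (- \<bar>u - t\<bar>) \<le> real (?n i) * (1 - 1 / real K / 2)" by (intro mult_left_mono) auto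
      moreover have "real (?n i) \<le> sqrt (real (?n i) * real (?n j))"
        using nm by (intro real_le_rsqrt) (simp add: power2_eq_square mult_left_mono)
      moreover have "real (?n i) * (1 - 1 / real K / 2) = real (?n i) - real (?n i) / (2 * real K)"
        by (simp add: algebra_simps)
      moreover have "real (?n i) / (8 * real K) \<le> real (?n i) / (2 * real K)"
        using K0 by (intro divide_left_mono) auto
      moreover have "c \<le> g - p" if "p \<le> r" "x \<le> g" "r = x - d" "c \<le> d" for c g p r x d :: real
        using that by linarith
      ultimately show ?thesis by blast
    qed
    have h0: "0 < h" using h by simp
    have "prob (E (i, t) \<inter> E (j, u)) \<le> prob {\<omega>\<in>space M. sqrt (real (?n i)) * h < S (?n i) t \<omega> - S ?q t \<omega> \<and> sqrt (real (?n j)) * h < S (?n j) u \<omega> - S ?q u \<omega>}"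
    proof (intro finite_measure_mono subsetI)
      fix \<omega> assume "\<omega> \<in> E (i, t) \<inter> E (j, u)"
      moreover have "sqrt (real l) * h \<le> sqrt (real l) * (h + 1 / h)" for l using h0 by (intro mult_left_mono) auto
      ultimately show "\<omega> \<in> {\<omega>\<in>space M. sqrt (real (?n i)) * h < S (?n i) t \<omega> - S ?q t \<omega> \<and> sqrt (real (?n j)) * h < S (?n j) u \<omega> - S ?q u \<omega>}"
        unfolding E_def prod.case by (auto intro: le_less_trans)
    qed measurable
    also have "\<dots> \<le> exp (1 - h\<^sup>2 / 2 - h\<^sup>2 / (40 * real K))"
      using qn[OF ij(1)] K by (intro pair_upper tu nm m2 h0 h4 ij sep) auto
    finally show ?thesis .
  qed
  have pair: "prob (E z \<inter> E z') \<le> exp (1 - h\<^sup>2 / 2 - h\<^sup>2 / (40 * real K))" if zz: "z \<in> I" "z' \<in> I" "z \<noteq> z'" for z z'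
  proof -
    obtain i t j u where z: "z = (i, t)" "z' = (j, u)" by (cases z; cases z') auto
    show ?thesis
    proof (cases "i \<le> j")
      case True
      then show ?thesis using pair_ordered[of i t j u] zz z by simp
    next
      case False
      then show ?thesis using pair_ordered[of j u i t] zz z by (simp add: Int_commute)
    qed
  qed
  let ?e = "exp (1 - h\<^sup>2 / 2 - h\<^sup>2 / (40 * real K))"
  have "(\<Sum>z\<in>I. \<Sum>z'\<in>I - {z}. prob (E z \<inter> E z')) \<le> (\<Sum>z\<in>I. \<Sum>z'\<in>I - {z}. ?e)"
    by (intro sum_mono pair) auto
  also have "\<dots> \<le> (\<Sum>z\<in>I. \<Sum>z'\<in>I. ?e)"
    using finI by (intro sum_mono sum_mono2) auto
  also have "\<dots> = real (card I) * (real (card I) * ?e)" by simp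
  also have "\<dots> \<le> real (card I) * (exp (-4) / 120 / h * exp (- h\<^sup>2/2))"
  proof (intro mult_left_mono)
    have "real (card A) \<le> 2 * real K" using A(4) by (metis of_nat_le_iff of_nat_mult of_nat_numeral)
    then have "real (card I) \<le> 2 * (real K)\<^sup>2" unfolding cardI power2_eq_square using K0 by (simp add: mult.left_commute)
    then have 1: "real (card I) * ?e \<le> 2 * (real K)\<^sup>2 * ?e" by (intro mult_right_mono) auto
    have e: "?e = exp (1 - h\<^sup>2 / (40 * real K)) * exp (- h\<^sup>2/2)" by (simp add: exp_add[symmetric])
    have "2 * (real K)\<^sup>2 * ?e \<le> exp (-4) / 120 / h * exp (- h\<^sup>2/2)"
      using mult_right_mono[OF small, of "exp (- h\<^sup>2/2)"] unfolding e by (simp add: mult.assoc)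
    with 1 show "real (card I) * ?e \<le> exp (-4) / 120 / h * exp (- h\<^sup>2/2)" by (rule order_trans)
  qed simp
  finally have pairs: "(\<Sum>z\<in>I. \<Sum>z'\<in>I - {z}. prob (E z \<inter> E z')) \<le> real (card I) * (exp (-4) / 120 / h * exp (- h\<^sup>2/2))" .
  have "real (card I) * (2 * (exp (-4) / 120 / h * exp (- h\<^sup>2/2))) = (\<Sum>z\<in>I. 2 * (exp (-4) / 120 / h * exp (- h\<^sup>2/2)))" by simp
  also have "\<dots> \<le> (\<Sum>z\<in>I. prob (E z))" by (intro sum_mono single)
  finally have "real (card I) * (2 * (exp (-4) / 120 / h * exp (- h\<^sup>2/2))) \<le> (\<Sum>z\<in>I. prob (E z))" .
  moreover have "(\<Sum>z\<in>I. prob (E z)) - (\<Sum>z\<in>I. \<Sum>z'\<in>I - {z}. prob (E z \<inter> E z')) \<le> prob (group_event K k h A)"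
    unfolding union by (rule bonferroni_lower[OF finI]) auto
  ultimately have "real (card I) * (exp (-4) / 120 / h * exp (- h\<^sup>2/2)) \<le> prob (group_event K k h A)"
    using pairs by linarith
  then show ?thesis unfolding cardI by (simp add: mult.assoc)
qed

lemma rv_path_sum:
  assumes "I \<subseteq> J"
  shows "(\<lambda>f. \<Sum>i\<in>I. f i u) \<in> borel_measurable (PiM J (\<lambda>_. PiM UNIV (\<lambda>_::real. borel :: real measure)))"
proof (rule borel_measurable_sum)
  fix i assume "i \<in> I"
  then have "i \<in> J" using assms by blast
  then show "(\<lambda>f. f i u) \<in> borel_measurable (PiM J (\<lambda>_. PiM UNIV (\<lambda>_::real. borel :: real measure)))"
    using measurable_compose[OF measurable_component_singleton[OF \<open>i \<in> J\<close>] measurable_component_singleton[of u UNIV]] by simp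
qed

lemma group_event_measurable [measurable]: "finite A \<Longrightarrow> group_event K k h A \<in> sets M"
proof -
  assume "finite A"
  then have [measurable]: "countable A" by (rule countable_finite)
  show ?thesis unfolding group_event_def by measurable
qed

text \<open>The coordinate ranges of different groups are disjoint because every group ends before
  the next \<open>group_start\<close>. Hence the probabilities of the complements multiply, and
  \<open>1 - x \<le> exp (- x)\<close> turns the product into a sum.\<close>

lemma prob_no_group_event:
  assumes K: "2 \<le> K" and Ks: "finite Ks" "\<And>k. k \<in> Ks \<Longrightarrow> 2 \<le> k" and A: "finite A"
    and q: "\<And>k i. k \<in> Ks \<Longrightarrow> i < K \<Longrightarrow> group_start K k \<le> time_point K k i"
  shows "prob {\<omega>\<in>space M. \<forall>k\<in>Ks. \<omega> \<notin> group_event K k (h k) A} \<le> exp (- (\<Sum>k\<in>Ks. prob (group_event K k (h k) A)))"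
proof (cases "Ks = {}")
  case False
  let ?PM = "PiM UNIV (\<lambda>_::real. borel :: real measure)"
  let ?J = "\<lambda>k. {group_start K k..<2 * K ^ (4 * k)}"
  let ?n = "\<lambda>k i. time_point K k i"
  let ?X = "\<lambda>k \<omega>. restrict (\<lambda>i t. X i t \<omega>) (?J k)"
  define B where "B k = {f\<in>space (PiM (?J k) (\<lambda>_. ?PM)). \<forall>i\<in>{..<K}. \<forall>t\<in>A.
     (\<Sum>l\<in>{group_start K k..<?n k i}. f l t) \<le> sqrt (real (?n k i)) * (h k + 1 / h k)}" for k
  have sub: "{group_start K k..<?n k i} \<subseteq> ?J k" if "k \<in> Ks" "i < K" for k i
    using time_point_bounds(2)[of k i K] Ks(2)[OF that(1)] that by auto
  have B: "B k \<in> sets (PiM (?J k) (\<lambda>_. ?PM))" if "k \<in> Ks" for k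
    unfolding B_def using sub[OF that]
    by (intro sets.sets_Collect_finite_All borel_measurable_le rv_path_sum A) auto
  have disj: "disjoint_family_on ?J Ks"
  proof -
    have "2 * K ^ (4 * k) \<le> group_start K k'" if "k < k'" for k k'
      unfolding group_start_def using that K by (intro mult_left_mono power_increasing) auto
    then have "?J k \<inter> ?J k' = {}" if "k < k'" for k k' using that by force
    then show ?thesis unfolding disjoint_family_on_def by (metis Int_commute nat_neq_iff)
  qed
  have "indep_vars (\<lambda>k. PiM (?J k) (\<lambda>_. ?PM)) ?X Ks"
    by (rule indep_vars_restrict[OF indep_X _ disj]) auto
  from indep_varsD[OF this False Ks(1) order_refl, of B]
  have "prob (\<Inter>k\<in>Ks. ?X k -` B k \<inter> space M) = (\<Prod>k\<in>Ks. prob (?X k -` B k \<inter> space M))"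
    using B by blast
  moreover have eq: "?X k -` B k \<inter> space M = space M - group_event K k (h k) A" if k: "k \<in> Ks" for k
  proof -
    have sum_eq: "(\<Sum>l\<in>{group_start K k..<?n k i}. ?X k \<omega> l t) = S (?n k i) t \<omega> - S (group_start K k) t \<omega>" if "i < K" for i t \<omega>
    proof -
      have "(\<Sum>l\<in>{group_start K k..<?n k i}. ?X k \<omega> l t) = (\<Sum>l\<in>{group_start K k..<?n k i}. X l t \<omega>)"
        using sub[OF k that] by (intro sum.cong) auto
      then show ?thesis using S_diff[OF q[OF k that]] by simp
    qed
    have sp: "?X k \<omega> \<in> space (PiM (?J k) (\<lambda>_. ?PM))" for \<omega> by (simp add: space_PiM)
    have "?X k \<omega> \<in> B k \<longleftrightarrow> (\<forall>i\<in>{..<K}. \<forall>t\<in>A. S (?n k i) t \<omega> - S (group_start K k) t \<omega> \<le> sqrt (real (?n k i)) * (h k + 1 / h k))" for \<omega>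
    proof -
      have "?X k \<omega> \<in> B k \<longleftrightarrow> (\<forall>i\<in>{..<K}. \<forall>t\<in>A.
          (\<Sum>l\<in>{group_start K k..<?n k i}. ?X k \<omega> l t) \<le> sqrt (real (?n k i)) * (h k + 1 / h k))"
        unfolding B_def mem_Collect_eq using sp by blast
      also have "\<dots> \<longleftrightarrow> (\<forall>i\<in>{..<K}. \<forall>t\<in>A. S (?n k i) t \<omega> - S (group_start K k) t \<omega> \<le> sqrt (real (?n k i)) * (h k + 1 / h k))"
        by (intro ball_cong refl) (subst sum_eq, auto)
      finally show ?thesis .
    qed
    then have iff: "?X k \<omega> \<in> B k \<longleftrightarrow> \<not> (\<exists>i<K. \<exists>t\<in>A. sqrt (real (?n k i)) * (h k + 1 / h k) < S (?n k i) t \<omega> - S (group_start K k) t \<omega>)" for \<omega>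
      by (meson lessThan_iff not_less)
    show ?thesis unfolding group_event_def vimage_def iff by blast
  qed
  moreover have "(\<Inter>k\<in>Ks. ?X k -` B k \<inter> space M) = {\<omega>\<in>space M. \<forall>k\<in>Ks. \<omega> \<notin> group_event K k (h k) A}"
    using False by (auto simp: eq)
  ultimately have "prob {\<omega>\<in>space M. \<forall>k\<in>Ks. \<omega> \<notin> group_event K k (h k) A} = (\<Prod>k\<in>Ks. 1 - prob (group_event K k (h k) A))"
    using A by (simp add: prob_compl)
  also have "\<dots> \<le> (\<Prod>k\<in>Ks. exp (- prob (group_event K k (h k) A)))"
  proof (rule prod_mono)
    fix k
    show "0 \<le> 1 - prob (group_event K k (h k) A) \<and> 1 - prob (group_event K k (h k) A) \<le> exp (- prob (group_event K k (h k) A))"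
      using exp_ge_add_one_self[of "- prob (group_event K k (h k) A)"] by simp
  qed
  also have "\<dots> = exp (- (\<Sum>k\<in>Ks. prob (group_event K k (h k) A)))"
    using Ks(1) by (simp add: exp_sum sum_negf[symmetric])
  finally show ?thesis .
qed simp

text \<open>Unless no group event occurs, some increment exceeds \<open>h + 1 / h\<close> in
  normalised units. The steps before the group then spoil the exceedance of \<open>h\<close> only if
  they are very negative; as \<open>group_start\<close> is smaller than the group by the factor
  \<open>K ^ 4 / 2\<close>, this is a Gaussian deviation of squared size
  \<open>K ^ 4 / (2 * h\<^sup>2)\<close>.\<close>

lemma blocks_lower:
  assumes K: "2 \<le> K" and Ks: "finite Ks" "\<And>k. k \<in> Ks \<Longrightarrow> 2 \<le> k"
    and A: "finite A" "A \<subseteq> {0..1}" "separated (1 / real K) A" "card A \<le> 2 * K"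
    and h: "\<And>k. k \<in> Ks \<Longrightarrow> 1 \<le> h k" "\<And>k. k \<in> Ks \<Longrightarrow> 2 * ((h k)\<^sup>2 + 1) \<le> real K ^ 4"
    and small: "\<And>k. k \<in> Ks \<Longrightarrow> 2 * (real K)\<^sup>2 * exp (1 - (h k)\<^sup>2 / (40 * real K)) \<le> exp (-4) / 120 / h k"
  shows "1 - exp (- (\<Sum>k\<in>Ks. real K * real (card A) * (exp (-4) / 120 / h k) * exp (- (h k)\<^sup>2 / 2)))
      - (\<Sum>k\<in>Ks. 2 * real K * exp (- (real K ^ 4 / (4 * (h k)\<^sup>2))))
    \<le> prob {\<omega>\<in>space M. \<exists>k\<in>Ks. \<exists>i<K. \<exists>t\<in>A. sqrt (real (time_point K k i)) * h k < S (time_point K k i) t \<omega>}"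
proof -
  note [measurable] = countable_finite[OF A(1)] countable_finite[OF Ks(1)]
  let ?n = "\<lambda>k i. time_point K k i" and ?q = "\<lambda>k. group_start K k"
  define G where "G = {\<omega>\<in>space M. \<forall>k\<in>Ks. \<omega> \<notin> group_event K k (h k) A}"
  \<comment> \<open>The event that the steps before group \<open>k\<close> use up more than the
    reserve \<open>1 / h k\<close>.\<close>
  define B where "B k t = {\<omega>\<in>space M. S (?q k) t \<omega> < - (sqrt (real (K ^ (4 * k))) / h k)}" for k t
  define Z where "Z = {\<omega>\<in>space M. \<exists>k\<in>Ks. \<exists>i<K. \<exists>t\<in>A. sqrt (real (?n k i)) * h k < S (?n k i) t \<omega>}"
  have [measurable]: "B k t \<in> sets M" "Z \<in> sets M" for k t unfolding B_def Z_def by measurable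
  have [measurable]: "G \<in> sets M"
  proof -
    have "G = space M - (\<Union>k\<in>Ks. group_event K k (h k) A)" unfolding G_def by auto
    also have "\<dots> \<in> sets M" using Ks(1) A(1) by (intro sets.Diff sets.top sets.finite_UN) auto
    finally show ?thesis .
  qed
  have q0: "0 < ?q k" for k using K by (simp add: group_start_def)
  have Nq: "real K ^ 4 * real (?q k) = 2 * real (K ^ (4 * k))" if "k \<in> Ks" for k
  proof -
    have "real (K ^ 4 * ?q k) = real (2 * K ^ (4 * k))" using group_start_power[of k K] Ks(2)[OF that] by simp
    then show ?thesis by simp
  qed
  have qn: "?q k \<le> ?n k i" if "k \<in> Ks" "i < K" for k i
  proof -
    have "2 * 1 \<le> (2::nat) ^ 4" by simp
    also have "\<dots> \<le> K ^ 4" using K by (rule power_mono) simp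
    finally have "2 * ?q k \<le> K ^ 4 * ?q k" by (intro mult_right_mono) auto
    then have "?q k \<le> K ^ (4 * k)" using group_start_power[of k K] Ks(2)[OF that(1)] by simp
    also have "\<dots> \<le> ?n k i" using time_point_bounds(1)[of k i K] Ks(2)[OF that(1)] that by simp
    finally show ?thesis .
  qed
  have "space M \<subseteq> G \<union> (\<Union>k\<in>Ks. \<Union>t\<in>A. B k t) \<union> Z"
  proof
    fix \<omega> assume \<omega>: "\<omega> \<in> space M"
    show "\<omega> \<in> G \<union> (\<Union>k\<in>Ks. \<Union>t\<in>A. B k t) \<union> Z"
    proof (cases "\<omega> \<in> G")
      case False
      then obtain k i t where kit: "k \<in> Ks" "i < K" "t \<in> A"
        "sqrt (real (?n k i)) * (h k + 1 / h k) < S (?n k i) t \<omega> - S (?q k) t \<omega>"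
        using \<omega> by (auto simp: G_def group_event_def)
      show ?thesis
      proof (cases "\<omega> \<in> B k t")
        case False
        then have "- (sqrt (real (K ^ (4 * k))) / h k) \<le> S (?q k) t \<omega>" using \<omega> by (simp add: B_def not_less)
        moreover have "sqrt (real (K ^ (4 * k))) / h k \<le> sqrt (real (?n k i)) / h k"
        proof (intro divide_right_mono real_sqrt_le_mono)
          show "real (K ^ (4 * k)) \<le> real (?n k i)"
            using time_point_bounds(1)[of k i K] Ks(2)[OF kit(1)] kit(2) by (simp only: of_nat_le_iff)
        qed (use h(1)[OF kit(1)] in simp)
        ultimately have "sqrt (real (?n k i)) * h k < S (?n k i) t \<omega>"
          using kit(4) by (simp add: distrib_left)
        then show ?thesis using kit \<omega> unfolding Z_def by blast
      qed (use kit in blast)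
    qed simp
  qed
  moreover have [measurable]: "(\<Union>k\<in>Ks. \<Union>t\<in>A. B k t) \<in> sets M"
    by (intro sets.finite_UN Ks(1) A(1)) auto
  ultimately have "1 \<le> prob (G \<union> (\<Union>k\<in>Ks. \<Union>t\<in>A. B k t) \<union> Z)"
    unfolding prob_space[symmetric] by (intro finite_measure_mono) auto
  also have "\<dots> \<le> prob (G \<union> (\<Union>k\<in>Ks. \<Union>t\<in>A. B k t)) + prob Z"
    by (rule measure_Un_le) auto
  also have "prob (G \<union> (\<Union>k\<in>Ks. \<Union>t\<in>A. B k t)) \<le> prob G + prob (\<Union>k\<in>Ks. \<Union>t\<in>A. B k t)"
    by (rule measure_Un_le) auto
  also have "prob G \<le> exp (- (\<Sum>k\<in>Ks. prob (group_event K k (h k) A)))"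
    unfolding G_def by (rule prob_no_group_event[OF K Ks A(1) qn])
  also have "\<dots> \<le> exp (- (\<Sum>k\<in>Ks. real K * real (card A) * (exp (-4) / 120 / h k) * exp (- (h k)\<^sup>2 / 2)))"
    by (intro exp_mono le_imp_neg_le sum_mono group_lower K Ks(2) A h small)
  also have "prob (\<Union>k\<in>Ks. \<Union>t\<in>A. B k t) \<le> (\<Sum>k\<in>Ks. prob (\<Union>t\<in>A. B k t))"
    by (rule measure_UNION_le[OF Ks(1)]) (intro sets.finite_UN A(1), auto)
  also have "\<dots> \<le> (\<Sum>k\<in>Ks. 2 * real K * exp (- (real K ^ 4 / (4 * (h k)\<^sup>2))))"
  proof (rule sum_mono)
    fix k assume k: "k \<in> Ks"
    have h1: "1 \<le> h k" using h(1)[OF k] .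
    have Bt: "prob (B k t) \<le> exp (- (real K ^ 4 / (4 * (h k)\<^sup>2)))" if "t \<in> A" for t
    proof -
      define x where "x = sqrt (real (K ^ (4 * k))) / h k / sqrt (real (?q k))"
      have x2: "x\<^sup>2 = real K ^ 4 / (2 * (h k)\<^sup>2)"
        using Nq[OF k] q0[of k] h1 by (simp add: x_def power_divide divide_simps)
      have x0: "0 \<le> x" using h1 by (simp add: x_def)
      have "1 * (2 * (h k)\<^sup>2) \<le> real K ^ 4" using h(2)[OF k] by simp
      then have "1\<^sup>2 \<le> x\<^sup>2" unfolding x2 using h1 by (subst pos_le_divide_eq) auto
      then have x1: "1 \<le> x" using x0 by (rule power2_le_imp_le)
      have ne: "{..<?q k} \<noteq> {}" "0 \<le> t" using q0[of k] that A(2) by auto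
      have "prob (B k t) = normal_tail x"
        unfolding B_def S_def x_def
        using prob_sum_X(2)[OF finite_lessThan ne, of "sqrt (real (K ^ (4 * k))) / h k"] by simp
      also have "\<dots> \<le> exp (- x\<^sup>2 / 2) / x" using x1 by (intro normal_tail_upper) auto
      also have "\<dots> \<le> exp (- x\<^sup>2 / 2) / 1" using x1 by (intro divide_left_mono) auto
      finally show ?thesis unfolding x2 by simp
    qed
    have "prob (\<Union>t\<in>A. B k t) \<le> (\<Sum>t\<in>A. prob (B k t))" by (rule measure_UNION_le[OF A(1)]) auto
    also have "\<dots> \<le> (\<Sum>t\<in>A. exp (- (real K ^ 4 / (4 * (h k)\<^sup>2))))" by (intro sum_mono Bt)
    also have "\<dots> = real (card A) * exp (- (real K ^ 4 / (4 * (h k)\<^sup>2)))" by simp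
    also have "\<dots> \<le> 2 * real K * exp (- (real K ^ 4 / (4 * (h k)\<^sup>2)))"
      using A(4) by (intro mult_right_mono) (simp_all flip: of_nat_le_iff[where 'a=real])
    finally show "prob (\<Union>t\<in>A. B k t) \<le> 2 * real K * exp (- (real K ^ 4 / (4 * (h k)\<^sup>2)))" .
  qed
  finally show ?thesis unfolding Z_def by simp
qed

end

text \<open>Comparison with the telescoping sum of logarithms; rounding \<open>exp v\<close> up to
  an integer costs at most 1 in the logarithm, and \<open>v - 1 \<ge> v / 2\<close>.\<close>

lemma harmonic_sum_lower:
  fixes v :: real assumes v: "4 \<le> v"
  shows "v / 2 \<le> (\<Sum>k | exp v \<le> real k \<and> real k \<le> exp (2 * v). 1 / real k)"
proof -
  define a where "a = nat \<lceil>exp v\<rceil>"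
  define b where "b = nat \<lfloor>exp (2 * v)\<rfloor>"
  have "exp v \<le> real k \<longleftrightarrow> a \<le> k" for k unfolding a_def by (simp add: nat_ceiling_le_eq)
  moreover have "real k \<le> exp (2 * v) \<longleftrightarrow> k < Suc b" for k
    unfolding b_def by (simp add: less_Suc_eq_le le_nat_iff le_floor_iff)
  ultimately have set_eq: "{k. exp v \<le> real k \<and> real k \<le> exp (2 * v)} = {a..<Suc b}" by auto
  have ev: "1 \<le> exp v" using v by simp
  then have a: "0 < a" "real a \<le> exp v + 1" unfolding a_def by (auto simp: less_le_trans[OF zero_less_one])
  have b: "exp (2 * v) \<le> real (Suc b)" unfolding b_def by linarith
  have tele: "ln (real n) - ln (real a) \<le> (\<Sum>k\<in>{a..<n}. 1 / real k)" if "a \<le> n" for n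
    using that
  proof (induction n rule: dec_induct)
    case (step n)
    have n: "0 < real n" using step a by simp
    have "ln (real (Suc n)) - ln (real n) = ln (1 + 1 / real n)"
    proof -
      have "real (Suc n) / real n = 1 + 1 / real n" using n by (simp add: field_simps)
      moreover have "ln (real (Suc n) / real n) = ln (real (Suc n)) - ln (real n)" using n by (simp add: ln_div del: of_nat_Suc)
      ultimately show ?thesis by simp
    qed
    also have "\<dots> \<le> 1 / real n" using n by (intro ln_add_one_self_le_self) auto
    finally show ?case using step by simp
  qed simp
  have "exp v + 1 \<le> exp (v + 1)"
  proof -
    have "exp v + 1 \<le> exp v * 2" using ev by simp
    also have "\<dots> \<le> exp v * exp 1" using exp_ge_add_one_self[of 1] by (intro mult_left_mono) auto
    finally show ?thesis by (simp add: exp_add)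
  qed
  then have la: "ln (real a) \<le> v + 1" using a by (subst ln_exp[of "v + 1", symmetric], subst ln_le_cancel_iff) auto
  have lb: "2 * v \<le> ln (real (Suc b))" using b by (subst ln_ge_iff) auto
  have "a \<le> Suc b"
  proof -
    have "exp v + 1 \<le> exp (2 * v)" using \<open>exp v + 1 \<le> exp (v + 1)\<close> v by (rule_tac order_trans) auto
    then have "real a \<le> real (Suc b)" using a(2) b by linarith
    then show ?thesis by simp
  qed
  from tele[OF this] la lb v show ?thesis unfolding set_eq by linarith
qed

context gaussian_dynamics
begin

text \<open>For a scale \<open>K\<close> at which \<open>D\<close> contains \<open>K powr s\<close>
  points of mutual distance \<open>1 / K\<close>, the groups \<open>k\<close> with
  \<open>ln k\<close> between \<open>V K\<close> and \<open>2 * V K\<close> are used. The expected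
  number of exceedances is at least of order
  \<open>K * K powr s * V powr (1 / 2 - c / 2) / ln K\<close>, a positive power of \<open>K\<close>
  up to the logarithm. So a single scale gives probability at least \<open>1 - err K\<close>, and
  \<open>thick\<close> provides such scales beyond every bound.\<close>

theorem lower_bound_AE:
  assumes D: "countable D" "D \<subseteq> {0..1}" "thick s D" and s: "0 \<le> s" and c: "0 < c" "c < 3 + 2 * s"
  shows "AE \<omega> in M. \<forall>m. \<exists>n\<ge>m. \<exists>t\<in>D. sqrt (real n * barrier c n) < S n t \<omega>"
proof -
  define g where "g = 3 / 2 + s - c / 2"
  have g: "0 < g" using c by (simp add: g_def)
  \<comment> \<open>The bound by 1/2 makes \<open>K ^ 4 / V\<close> outgrow \<open>V\<close>, which
    is needed for the second term of \<open>err\<close>; the other bound keeps \<kappa> positive.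
    For \<open>d = 0\<close> the exponent \<kappa> would be \<open>g\<close>.\<close>
  define d where "d = min (1 / 2) (g / (c + 1))"
  have d: "0 < d" "d < 1" using g c by (auto simp: d_def)
  define \<kappa> where "\<kappa> = 1 + s + (1 + d) * (1 / 2 - c / 2)"
  have \<kappa>: "0 < \<kappa>"
  proof -
    have "d * (c / 2) \<le> g / (c + 1) * (c / 2)" using c by (intro mult_right_mono) (auto simp: d_def)
    also have "\<dots> = g * (c / (2 * (c + 1)))" by simp
    also have "\<dots> \<le> g * (1 / 2)" using g c by (intro mult_left_mono) (auto simp: field_simps)
    finally have "d * (c / 2) \<le> g / 2" by simp
    moreover have "\<kappa> = g + d / 2 - d * (c / 2)" by (simp add: \<kappa>_def g_def field_simps)
    ultimately show ?thesis using g d by simp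
  qed
  define V where "V K = real K powr (1 + d)" for K :: nat
  \<comment> \<open>Chosen so that \<open>2 * ln k + b K\<close> dominates the barrier at all walk
    times \<open>n\<close> of group \<open>k\<close>: there \<open>ln n \<le> 5 * k * ln K\<close>,
    hence \<open>ln (ln n) \<le> ln k + ln (5 * ln K)\<close>, which is at most
    \<open>3 * V K\<close>.\<close>
  define b where "b K = 2 * ln (5 * ln (real K)) + c * ln (3 * V K)" for K
  \<comment> \<open>The factor \<open>exp (-4) / 120\<close> stems from \<open>group_lower\<close>,
    \<open>sqrt 5\<close> from \<open>h k \<le> sqrt (5 * V K)\<close>, the 2 from the harmonic sum,
    and the last bracket from \<open>exp (- b K / 2)\<close>.\<close>
  define C where "C = exp (-4) / 120 / sqrt 5 / 2 / (5 * 3 powr (c / 2))"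
  have C: "0 < C" by (simp add: C_def)
  \<comment> \<open>The first term bounds the probability that no group event occurs, the second
    that the steps before one of the groups use up the reserve; the number of groups is at most
    \<open>exp (2 * V K)\<close>.\<close>
  define err where "err K = exp (- (C * real K powr \<kappa> / ln (real K)))
     + exp (2 * V K) * (2 * real K) * exp (- (real K ^ 4 / (20 * V K)))" for K
  define good where "good K \<longleftrightarrow> 2 * (4 * V K + b K + 1) \<le> real K ^ 4
    \<and> 2 * (real K)\<^sup>2 * exp (1 - V K / (20 * real K)) * sqrt (5 * V K) \<le> exp (-4) / 120
    \<and> 0 \<le> b K \<and> b K \<le> V K \<and> 4 \<le> V K \<and> ln (5 * ln (real K)) \<le> V K \<and> 3 \<le> K" for K
  have good: "eventually good sequentially"
  proof -
    have "eventually (\<lambda>K. 2 * (4 * V K + b K + 1) \<le> real K ^ 4) sequentially"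
      using d c unfolding b_def V_def by real_asymp
    moreover have "eventually (\<lambda>K. 2 * (real K)\<^sup>2 * exp (1 - V K / (20 * real K)) * sqrt (5 * V K) \<le> exp (-4) / 120) sequentially"
      using d c unfolding V_def by real_asymp
    moreover have "eventually (\<lambda>K. 0 \<le> b K) sequentially" "eventually (\<lambda>K. b K \<le> V K) sequentially"
      using d c unfolding b_def V_def by real_asymp+
    moreover have "eventually (\<lambda>K. 4 \<le> V K) sequentially" "eventually (\<lambda>K. ln (5 * ln (real K)) \<le> V K) sequentially"
      using d c unfolding V_def by real_asymp+
    ultimately show ?thesis using eventually_ge_at_top[of 3] unfolding good_def by eventually_elim auto
  qed
  have err: "err \<longlonglongrightarrow> 0"
  proof -
    have "((\<lambda>K::nat. exp (- (C * real K powr \<kappa> / ln (real K)))) \<longlongrightarrow> 0) sequentially"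
      using C \<kappa> by real_asymp
    moreover have "((\<lambda>K. exp (2 * V K) * (2 * real K) * exp (- (real K ^ 4 / (20 * V K)))) \<longlongrightarrow> 0) sequentially"
      using d unfolding V_def by real_asymp
    ultimately show ?thesis unfolding err_def using tendsto_add by fastforce
  qed
  define Z where "Z m = {\<omega>\<in>space M. \<exists>n\<ge>m. \<exists>t\<in>D. sqrt (real n * barrier c n) < S n t \<omega>}" for m
  have [measurable]: "Z m \<in> sets M" for m
  proof -
    note [measurable] = D(1)
    show ?thesis unfolding Z_def by measurable
  qed
  have main: "1 - err K \<le> prob (Z m)"
    if K: "good K" "m \<le> K" and A: "finite A" "A \<subseteq> D" "separated (1 / real K) A" "real K powr s \<le> real (card A)" "card A \<le> 2 * K" for K m A
  proof -
    have G: "2 * (4 * V K + b K + 1) \<le> real K ^ 4"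
      "2 * (real K)\<^sup>2 * exp (1 - V K / (20 * real K)) * sqrt (5 * V K) \<le> exp (-4) / 120"
      "0 \<le> b K" "b K \<le> V K" "4 \<le> V K" "ln (5 * ln (real K)) \<le> V K" "3 \<le> K"
      using K(1) by (auto simp: good_def)
    have K0: "0 < real K" using G by simp
    define h where "h k = sqrt (2 * ln (real k) + b K)" for k :: nat
    \<comment> \<open>A range on which \<open>ln k\<close> doubles: the harmonic sum gains a factor
      of order \<open>V K\<close>, while all levels \<open>h k\<close> remain comparable with
      \<open>sqrt (V K)\<close>.\<close>
    define Ks where "Ks = {k. exp (V K) \<le> real k \<and> real k \<le> exp (2 * V K)}"
    have Ks_sub: "Ks \<subseteq> {1..nat \<lfloor>exp (2 * V K)\<rfloor>}"
    proof
      fix k assume k: "k \<in> Ks"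
      have "0 < exp (V K)" by simp
      also have "\<dots> \<le> real k" using k by (simp add: Ks_def)
      finally have "0 < real k" .
      then show "k \<in> {1..nat \<lfloor>exp (2 * V K)\<rfloor>}" using k by (auto simp: Ks_def le_nat_floor)
    qed
    have finKs: "finite Ks" using Ks_sub by (rule finite_subset) simp
    have cardKs: "real (card Ks) \<le> exp (2 * V K)"
    proof -
      have "card Ks \<le> nat \<lfloor>exp (2 * V K)\<rfloor>" using card_mono[OF _ Ks_sub] by simp
      then have "real (card Ks) \<le> real (nat \<lfloor>exp (2 * V K)\<rfloor>)" by (simp only: of_nat_le_iff)
      also have "\<dots> \<le> exp (2 * V K)" by (rule of_nat_floor) simp
      finally show ?thesis .
    qed
    have lnk: "V K \<le> ln (real k)" "ln (real k) \<le> 2 * V K" "0 < real k" if "k \<in> Ks" for k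
    proof -
      show k0: "0 < real k" using that Ks_sub by auto
      show "V K \<le> ln (real k)" using that k0 by (simp add: Ks_def ln_ge_iff)
      have "ln (real k) \<le> ln (exp (2 * V K))" using that k0 by (subst ln_le_cancel_iff) (auto simp: Ks_def)
      then show "ln (real k) \<le> 2 * V K" by simp
    qed
    have k2: "2 \<le> k" if "k \<in> Ks" for k
    proof -
      have "real 2 \<le> exp 1" using exp_ge_add_one_self[of 1] by simp
      also have "\<dots> \<le> exp (V K)" using G(5) by simp
      also have "\<dots> \<le> real k" using that by (simp add: Ks_def)
      finally show ?thesis by (simp only: of_nat_le_iff)
    qed
    have h2: "(h k)\<^sup>2 = 2 * ln (real k) + b K" "2 * V K \<le> (h k)\<^sup>2" "(h k)\<^sup>2 \<le> 5 * V K" "(h k)\<^sup>2 \<le> 4 * V K + b K" "1 \<le> h k" "h k \<le> sqrt (5 * V K)"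
      if "k \<in> Ks" for k
    proof -
      have pos: "0 \<le> 2 * ln (real k) + b K" using lnk(1)[OF that] G by linarith
      show e: "(h k)\<^sup>2 = 2 * ln (real k) + b K" using pos by (simp add: h_def)
      show "2 * V K \<le> (h k)\<^sup>2" "(h k)\<^sup>2 \<le> 5 * V K" "(h k)\<^sup>2 \<le> 4 * V K + b K" unfolding e using lnk[OF that] G by linarith+
      have "1 \<le> 2 * ln (real k) + b K" using lnk(1)[OF that] G by linarith
      then show "1 \<le> h k" by (simp add: h_def)
      show "h k \<le> sqrt (5 * V K)" using \<open>(h k)\<^sup>2 \<le> 5 * V K\<close> by (rule real_le_rsqrt)
    qed
    have h4: "2 * ((h k)\<^sup>2 + 1) \<le> real K ^ 4" if "k \<in> Ks" for k
      using G(1) h2(4)[OF that] by (intro order_trans[OF _ G(1)]) simp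
    have small: "2 * (real K)\<^sup>2 * exp (1 - (h k)\<^sup>2 / (40 * real K)) \<le> exp (-4) / 120 / h k" if "k \<in> Ks" for k
    proof -
      have "V K / (20 * real K) = 2 * V K / (40 * real K)" by simp
      also have "\<dots> \<le> (h k)\<^sup>2 / (40 * real K)" using h2(2)[OF that] K0 by (intro divide_right_mono) auto
      finally have "exp (1 - (h k)\<^sup>2 / (40 * real K)) \<le> exp (1 - V K / (20 * real K))" by simp
      then have "2 * (real K)\<^sup>2 * exp (1 - (h k)\<^sup>2 / (40 * real K)) * h k \<le> 2 * (real K)\<^sup>2 * exp (1 - V K / (20 * real K)) * sqrt (5 * V K)"
        using h2(5,6)[OF that] by (intro mult_mono) auto
      also have "\<dots> \<le> exp (-4) / 120" by (rule G(2))
      finally show ?thesis using h2(5)[OF that] by (simp add: le_divide_eq)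
    qed
    have K2: "2 \<le> K" using G by simp
    have AD: "A \<subseteq> {0..1}" using A D by auto
    let ?Z = "{\<omega>\<in>space M. \<exists>k\<in>Ks. \<exists>i<K. \<exists>t\<in>A. sqrt (real (time_point K k i)) * h k < S (time_point K k i) t \<omega>}"
    have lower: "1 - exp (- (\<Sum>k\<in>Ks. real K * real (card A) * (exp (-4) / 120 / h k) * exp (- (h k)\<^sup>2 / 2)))
      - (\<Sum>k\<in>Ks. 2 * real K * exp (- (real K ^ 4 / (4 * (h k)\<^sup>2)))) \<le> prob ?Z"
      by (rule blocks_lower[OF K2 finKs k2 A(1) AD A(3,5) h2(5) h4 small])
    have V0: "0 < V K" using G by simp
    have lnK: "0 < ln (real K)" using G by simp
    have sum: "C * real K powr \<kappa> / ln (real K) \<le> (\<Sum>k\<in>Ks. real K * real (card A) * (exp (-4) / 120 / h k) * exp (- (h k)\<^sup>2 / 2))"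
    proof -
      have eb: "exp (- b K / 2) = 1 / (5 * ln (real K) * (3 * V K) powr (c / 2))"
      proof -
        have "exp (- b K / 2) = exp (- ln (5 * ln (real K))) * exp (- (c / 2 * ln (3 * V K)))"
          by (simp add: b_def exp_add[symmetric] add_divide_distrib)
        also have "exp (- (c / 2 * ln (3 * V K))) = 1 / (3 * V K) powr (c / 2)"
          using V0 by (simp add: powr_def exp_minus inverse_eq_divide)
        also have "exp (- ln (5 * ln (real K))) = 1 / (5 * ln (real K))"
          using lnK by (simp add: exp_minus inverse_eq_divide)
        finally show ?thesis by simp
      qed
      have eh: "exp (- (h k)\<^sup>2 / 2) = exp (- b K / 2) * (1 / real k)" if "k \<in> Ks" for k
      proof -
        have "- (h k)\<^sup>2 / 2 = - b K / 2 + - ln (real k)" unfolding h2(1)[OF that] by (simp add: field_simps)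
        then have "exp (- (h k)\<^sup>2 / 2) = exp (- b K / 2) * exp (- ln (real k))" by (simp only: exp_add)
        then show ?thesis using lnk(3)[OF that] by (simp add: exp_minus inverse_eq_divide)
      qed
      have pK: "real K powr \<kappa> = real K * real K powr s * (V K * V K powr (- (1 / 2)) * V K powr (- (c / 2)))"
      proof -
        have "V K * V K powr (- (1 / 2)) * V K powr (- (c / 2)) = V K powr (1 + - (1/2) + - (c / 2))"
          using V0 by (simp only: powr_add powr_one)
        also have "\<dots> = real K powr ((1 + d) * (1 / 2 - c / 2))" unfolding V_def by (simp add: powr_powr)
        finally have e: "V K * V K powr (- (1 / 2)) * V K powr (- (c / 2)) = real K powr ((1 + d) * (1 / 2 - c / 2))" .
        show ?thesis unfolding e \<kappa>_def using K0 by (simp only: powr_add powr_one)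
      qed
      have "C * real K powr \<kappa> / ln (real K) = (real K * real K powr s * (exp (-4) / 120 / sqrt (5 * V K)) * exp (- b K / 2)) * (V K / 2)"
        unfolding C_def pK eb using V0 lnK by (simp add: real_sqrt_mult powr_mult powr_minus powr_half_sqrt field_simps)
      also have "\<dots> \<le> (real K * real K powr s * (exp (-4) / 120 / sqrt (5 * V K)) * exp (- b K / 2)) * (\<Sum>k\<in>Ks. 1 / real k)"
        unfolding Ks_def using V0 by (intro mult_left_mono harmonic_sum_lower G(5)) auto
      also have "\<dots> = (\<Sum>k\<in>Ks. real K * real K powr s * (exp (-4) / 120 / sqrt (5 * V K)) * (exp (- b K / 2) * (1 / real k)))"
        by (simp add: sum_distrib_left mult.assoc)
      also have "\<dots> \<le> (\<Sum>k\<in>Ks. real K * real (card A) * (exp (-4) / 120 / h k) * exp (- (h k)\<^sup>2 / 2))"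
      proof (rule sum_mono)
        fix k assume k: "k \<in> Ks"
        have "exp (-4) / 120 / sqrt (5 * V K) \<le> exp (-4) / 120 / h k"
          using h2(5,6)[OF k] V0 by (intro divide_left_mono) auto
        moreover have "0 < h k" using h2(5)[OF k] by simp
        ultimately show "real K * real K powr s * (exp (-4) / 120 / sqrt (5 * V K)) * (exp (- b K / 2) * (1 / real k))
          \<le> real K * real (card A) * (exp (-4) / 120 / h k) * exp (- (h k)\<^sup>2 / 2)"
          unfolding eh[OF k] using A(4) V0 by (intro mult_mono mult_nonneg_nonneg) auto
      qed
      finally show ?thesis .
    qed
    have bad: "(\<Sum>k\<in>Ks. 2 * real K * exp (- (real K ^ 4 / (4 * (h k)\<^sup>2)))) \<le> exp (2 * V K) * (2 * real K) * exp (- (real K ^ 4 / (20 * V K)))"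
    proof -
      have "(\<Sum>k\<in>Ks. 2 * real K * exp (- (real K ^ 4 / (4 * (h k)\<^sup>2)))) \<le> (\<Sum>k\<in>Ks. 2 * real K * exp (- (real K ^ 4 / (20 * V K))))"
      proof (intro sum_mono mult_left_mono exp_mono le_imp_neg_le divide_left_mono)
        fix k assume k: "k \<in> Ks"
        show "4 * (h k)\<^sup>2 \<le> 20 * V K" using h2(3)[OF k] by simp
        have "0 < h k" using h2(5)[OF k] by simp
        then show "0 < 20 * V K * (4 * (h k)\<^sup>2)" using V0 by simp
      qed auto
      also have "\<dots> = real (card Ks) * (2 * real K * exp (- (real K ^ 4 / (20 * V K))))" by simp
      also have "\<dots> \<le> exp (2 * V K) * (2 * real K * exp (- (real K ^ 4 / (20 * V K))))"
        using cardKs by (intro mult_right_mono) auto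
      finally show ?thesis by (simp add: mult.assoc)
    qed
    have "?Z \<subseteq> Z m"
    proof
      fix \<omega> assume "\<omega> \<in> ?Z"
      then obtain k i t where kit: "\<omega> \<in> space M" "k \<in> Ks" "i < K" "t \<in> A" "sqrt (real (time_point K k i)) * h k < S (time_point K k i) t \<omega>"
        by auto
      define n where "n = time_point K k i"
      have k1: "1 \<le> k" using k2[OF kit(2)] by simp
      have nl: "K ^ (4 * k) \<le> n" "n \<le> 2 * K ^ (4 * k)" using time_point_bounds(1,2)[OF k1 kit(3)] by (simp_all add: n_def)
      have "K ^ 1 \<le> K ^ (4 * k)" using k1 K2 by (intro power_increasing) auto
      then have nK: "K \<le> n" using nl(1) by simp
      have n0: "0 < real n" using nK K2 by simp
      have lnK1: "1 \<le> ln (real K)"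
      proof -
        have "exp 1 \<le> real K" using exp_le G(7) by (rule_tac order_trans[of _ 3]) auto
        then show ?thesis using K0 by (simp add: ln_ge_iff)
      qed
      have lower_n: "4 * real k * ln (real K) \<le> ln (real n)"
      proof -
        have "real (K ^ (4 * k)) \<le> real n" using nl(1) by (simp only: of_nat_le_iff)
        then have "ln (real (K ^ (4 * k))) \<le> ln (real n)" using K0 n0 by (subst ln_le_cancel_iff) auto
        then show ?thesis using K0 by (simp add: ln_realpow)
      qed
      have upper_n: "ln (real n) \<le> real k * (5 * ln (real K))"
      proof -
        \<comment> \<open>The factor 2 in the upper end of the group is absorbed by one more power
          of \<open>K\<close>, and \<open>1 + 4 * k \<le> 5 * k\<close>.\<close>
        have "n \<le> K ^ 1 * K ^ (4 * k)" using nl(2) K2 by (auto intro: order_trans[OF _ mult_right_mono])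
        also have "\<dots> = K ^ (1 + 4 * k)" by (simp only: power_add)
        also have "\<dots> \<le> K ^ (5 * k)" using k1 K2 by (intro power_increasing) auto
        finally have "real n \<le> real (K ^ (5 * k))" by (simp only: of_nat_le_iff)
        then have "ln (real n) \<le> ln (real (K ^ (5 * k)))" using K0 n0 by (subst ln_le_cancel_iff) auto
        then show ?thesis using K0 by (simp add: ln_realpow)
      qed
      have "4 * 1 * 1 \<le> 4 * real k * ln (real K)" using k1 lnK1 by (intro mult_mono) auto
      then have ln4: "4 \<le> ln (real n)" using lower_n by simp
      then have llpos: "0 < ln (ln (real n))" by simp
      have ll: "ln (ln (real n)) \<le> ln (real k) + ln (5 * ln (real K))"
      proof -
        have "ln (ln (real n)) \<le> ln (real k * (5 * ln (real K)))" using upper_n ln4 by (subst ln_le_cancel_iff) auto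
        also have "\<dots> = ln (real k) + ln (5 * ln (real K))" using lnK lnk(3)[OF kit(2)] by (simp add: ln_mult)
        finally show ?thesis .
      qed
      have "ln (ln (real n)) \<le> 3 * V K" using ll lnk(2)[OF kit(2)] G(6) by linarith
      then have lll: "ln (ln (ln (real n))) \<le> ln (3 * V K)" using llpos by (subst ln_le_cancel_iff) auto
      have "barrier c n \<le> 2 * (ln (real k) + ln (5 * ln (real K))) + c * ln (3 * V K)"
        unfolding barrier_def using ll lll c by (intro add_mono mult_left_mono) auto
      also have "\<dots> = (h k)\<^sup>2" unfolding h2(1)[OF kit(2)] b_def by (simp add: algebra_simps)
      finally have "real n * barrier c n \<le> real n * (h k)\<^sup>2" using n0 by (intro mult_left_mono) auto
      then have "sqrt (real n * barrier c n) \<le> sqrt (real n * (h k)\<^sup>2)" by (rule real_sqrt_le_mono)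
      also have "\<dots> = sqrt (real n) * h k" using h2(5)[OF kit(2)] by (simp add: real_sqrt_mult)
      also have "\<dots> < S n t \<omega>" using kit(5) by (simp add: n_def)
      finally show "\<omega> \<in> Z m" using kit A(2) nK K(2) by (auto simp: Z_def intro!: exI[of _ n])
    qed
    then have "prob ?Z \<le> prob (Z m)" by (intro finite_measure_mono) auto
    moreover have "exp (- (\<Sum>k\<in>Ks. real K * real (card A) * (exp (-4) / 120 / h k) * exp (- (h k)\<^sup>2 / 2))) \<le> exp (- (C * real K powr \<kappa> / ln (real K)))"
      using sum by simp
    ultimately show ?thesis using lower bad unfolding err_def by linarith
  qed
  \<comment> \<open>The event \<open>Z m\<close> does not depend on \<open>K\<close>, so the scales
    from \<open>thick\<close> with \<open>err K\<close> arbitrarily small suffice, however sparse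
    they are.\<close>
  have "1 \<le> prob (Z m)" for m
  proof (rule field_le_epsilon)
    fix e :: real assume "0 < e"
    then have "eventually (\<lambda>K. good K \<and> err K < e \<and> m \<le> K) sequentially"
      using good order_tendstoD(2)[OF err, of e] eventually_ge_at_top[of m] by (intro eventually_conj) auto
    then obtain K0 where K0: "\<And>K. K \<ge> K0 \<Longrightarrow> good K \<and> err K < e \<and> m \<le> K" by (auto simp: eventually_sequentially)
    obtain K A where "K \<ge> K0" "finite A" "A \<subseteq> D" "separated (1 / real K) A" "real K powr s \<le> real (card A)" "card A \<le> 2 * K"
      using D(3) unfolding thick_def by blast
    then have "1 - err K \<le> prob (Z m)" using K0 by (intro main) auto
    then show "1 \<le> prob (Z m) + e" using K0[OF \<open>K \<ge> K0\<close>] by linarith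
  qed
  then have "prob (Z m) = 1" for m by (intro antisym) auto
  then have "AE \<omega> in M. \<omega> \<in> Z m" for m by (subst prob_eq_1[symmetric]) auto
  then have "AE \<omega> in M. \<forall>m. \<omega> \<in> Z m" by (simp add: AE_all_countable)
  then show ?thesis by eventually_elim (auto simp: Z_def)
qed

end

subsection \<open>Packing measure and capacities\<close>

text \<open>The countable unions of sets of bounded capacity form a \<sigma>-ideal whose critical
  exponent is the packing dimension. It replaces the packing measure in the probabilistic
  part.\<close>

definition small :: "real \<Rightarrow> real set \<Rightarrow> bool" where
  "small s E \<longleftrightarrow> (\<exists>F :: nat \<Rightarrow> real set. E \<subseteq> (\<Union>i. F i) \<and> (\<forall>i. boxed s (F i)))"

lemma boxed_mono: "boxed s F \<Longrightarrow> G \<subseteq> F \<Longrightarrow> boxed s G"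
  unfolding boxed_def by (meson order_trans)

lemma boxed_imp_small: "boxed s F \<Longrightarrow> small s F"
  unfolding small_def by (intro exI[of _ "\<lambda>_. F"]) auto

lemma small_mono: "small s F \<Longrightarrow> G \<subseteq> F \<Longrightarrow> small s G"
  unfolding small_def by (meson order_trans)

lemma small_empty: "small s {}"
  by (rule boxed_imp_small) (auto simp: boxed_def intro!: exI[of _ 0])

lemma small_UN_nat:
  fixes E :: "nat \<Rightarrow> real set"
  assumes "\<And>i. small s (E i)" shows "small s (\<Union>i. E i)"
proof -
  obtain F :: "nat \<Rightarrow> nat \<Rightarrow> real set" where F: "\<And>i. E i \<subseteq> (\<Union>j. F i j)" "\<And>i j. boxed s (F i j)"
    using assms unfolding small_def by metis
  define G where "G k = F (fst (prod_decode k)) (snd (prod_decode k))" for k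
  have G: "F i j = G (prod_encode (i, j))" for i j by (simp add: G_def)
  have "(\<Union>i. E i) \<subseteq> (\<Union>k. G k)"
  proof
    fix x assume "x \<in> (\<Union>i. E i)"
    then obtain i where "x \<in> E i" by (rule UN_E)
    then obtain j where "x \<in> F i j" using F(1)[of i] by auto
    then show "x \<in> (\<Union>k. G k)" unfolding G by (rule UN_I[OF UNIV_I])
  qed
  moreover have "boxed s (G k)" for k using F(2) by (simp add: G_def)
  ultimately show ?thesis unfolding small_def by blast
qed

lemma small_UN:
  assumes "countable I" "\<And>i. i \<in> I \<Longrightarrow> small s (E i)" shows "small s (\<Union>i\<in>I. E i)"
proof (cases "I = {}")
  case True then show ?thesis by (simp add: small_empty)
next
  case False
  have "small s (\<Union>n. E (from_nat_into I n))"
    using assms False by (intro small_UN_nat) (simp add: from_nat_into)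
  moreover have "(\<Union>i\<in>I. E i) \<subseteq> (\<Union>n. E (from_nat_into I n))"
    using from_nat_into_surj[OF assms(1)] by blast
  ultimately show ?thesis by (rule small_mono)
qed

lemma small_Un: "small s A \<Longrightarrow> small s B \<Longrightarrow> small s (A \<union> B)"
  using small_UN[of "{A, B}" s id] by auto

text \<open>Some cover has total premeasure below 1, so each piece has a \<delta> for which all
  packing sums are at most 1. An \<open>r\<close>-separated subset is the set of centres of a
  packing by equal balls, and its cardinality is bounded by the inverse of one summand.\<close>

lemma packing_measure_0_imp_small:
  assumes E: "packing_measure s E = 0" and s: "0 \<le> s"
  shows "small s E"
proof -
  have "packing_measure s E < 1" using E by simp
  then obtain F :: "nat \<Rightarrow> real set" where F: "E \<subseteq> (\<Union>i. F i)" "(\<Sum>i. packing_premeasure s (F i)) < 1"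
    unfolding packing_measure_def INF_less_iff by blast
  have "boxed s (F i)" for i
  proof -
    have "packing_premeasure s (F i) = (\<Sum>j\<in>{i}. packing_premeasure s (F j))" by simp
    also have "\<dots> \<le> (\<Sum>j. packing_premeasure s (F j))" by (rule sum_le_suminf) auto
    finally have "packing_premeasure s (F i) < 1" using F(2) by simp
    then obtain \<delta> :: real where \<delta>: "0 < \<delta>"
      "(SUP P\<in>packings \<delta> (F i). \<Sum>\<^sub>\<infinity>(x, r)\<in>P. ennreal ((2 * r) powr s)) < 1"
      unfolding packing_premeasure_def INF_less_iff by auto
    define \<epsilon> where "\<epsilon> = min \<delta> 1"
    have \<epsilon>: "0 < \<epsilon>" "\<epsilon> \<le> 1" "\<epsilon> \<le> \<delta>" using \<delta> by (auto simp: \<epsilon>_def)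
    have fine: "real (card A) \<le> (3 / 2) powr s * r powr (- s)"
      if r: "0 < r" "r \<le> \<epsilon>" and A: "finite A" "A \<subseteq> F i" "separated r A" for r A
    proof -
      \<comment> \<open>Radius \<open>r / 3\<close>, because closed balls of radius
        \<open>r / 2\<close> around points at distance \<open>r\<close> would touch.\<close>
      define P where "P = (\<lambda>x. (x, r / 3)) ` A"
      have inj: "inj_on (\<lambda>x. (x, r / 3)) A" by (auto simp: inj_on_def)
      have "disjoint_family_on (\<lambda>(x, r). cball x r) P"
        unfolding disjoint_family_on_def
      proof (intro ballI impI)
        fix p q assume "p \<in> P" "q \<in> P" "p \<noteq> q"
        then obtain x y where xy: "p = (x, r / 3)" "q = (y, r / 3)" "x \<in> A" "y \<in> A" "x \<noteq> y" by (auto simp: P_def)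
        then have "r \<le> \<bar>x - y\<bar>" using A(3) by (auto simp: separated_def)
        show "(case p of (x, r) \<Rightarrow> cball x r) \<inter> (case q of (x, r) \<Rightarrow> cball x r) = {}"
          unfolding xy prod.case
        proof (rule equals0I)
          fix z assume "z \<in> cball x (r / 3) \<inter> cball y (r / 3)"
          then have "\<bar>x - z\<bar> \<le> r / 3" "\<bar>y - z\<bar> \<le> r / 3" by (auto simp: dist_real_def)
          moreover have "\<bar>x - y\<bar> \<le> \<bar>x - z\<bar> + \<bar>y - z\<bar>" by simp
          ultimately show False using \<open>r \<le> \<bar>x - y\<bar>\<close> r by simp
        qed
      qed
      then have "P \<in> packings \<delta> (F i)"
        unfolding packings_def using A r \<epsilon> by (auto simp: P_def countable_finite)
      then have "(\<Sum>\<^sub>\<infinity>(x, r)\<in>P. ennreal ((2 * r) powr s)) \<le> 1"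
        using \<delta>(2) by (meson SUP_upper less_imp_le order_trans)
      also have "(\<Sum>\<^sub>\<infinity>(x, r)\<in>P. ennreal ((2 * r) powr s)) = (\<Sum>(x, r)\<in>P. ennreal ((2 * r) powr s))"
        using A by (intro infsum_finite) (simp add: P_def)
      also have "\<dots> = (\<Sum>x\<in>A. ennreal ((2 * (r / 3)) powr s))"
        unfolding P_def by (subst sum.reindex[OF inj]) simp
      also have "\<dots> = ennreal (real (card A) * (2 * (r / 3)) powr s)"
        by (simp add: ennreal_mult ennreal_of_nat_eq_real_of_nat)
      finally have le: "real (card A) * (2 * (r / 3)) powr s \<le> 1" by simp
      have "(2 * (r / 3)) powr s * ((3 / 2) powr s * r powr (- s)) = 1"
      proof -
        have "(2 * (r / 3)) powr s * ((3 / 2) powr s * r powr (- s)) = ((2 * (r / 3)) * (3 / 2)) powr s * r powr (- s)"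
          unfolding mult.assoc[symmetric] by (subst powr_mult[symmetric]) (use r in auto)
        also have "(2 * (r / 3)) * (3 / 2) = r" by simp
        finally show ?thesis using r by (simp add: powr_minus)
      qed
      note one = this
      have "real (card A) * ((2 * (r / 3)) powr s * ((3 / 2) powr s * r powr (- s))) \<le> 1 * ((3 / 2) powr s * r powr (- s))"
        unfolding mult.assoc[of "real (card A)", symmetric] by (rule mult_right_mono[OF le]) auto
      then show ?thesis unfolding one by simp
    qed
    have "real (card A) \<le> ((3 / 2) powr s * \<epsilon> powr (- s)) * r powr (- s)"
      if r: "r \<in> {0<..1}" and A: "finite A" "A \<subseteq> F i" "separated r A" for r A
    proof (cases "r \<le> \<epsilon>")
      case True
      have "1 \<le> \<epsilon> powr (- s)" using \<epsilon> s by (simp add: powr_minus one_le_inverse_iff powr_le1)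
      have "real (card A) \<le> (3 / 2) powr s * 1 * r powr (- s)" using fine[of r A] r True A by simp
      also have "\<dots> \<le> (3 / 2) powr s * \<epsilon> powr (- s) * r powr (- s)"
        using \<open>1 \<le> \<epsilon> powr (- s)\<close> by (intro mult_right_mono mult_left_mono) auto
      finally show ?thesis .
    next
      case False
      have "1 \<le> r powr (- s)" using r s by (simp add: powr_minus one_le_inverse_iff powr_le1)
      \<comment> \<open>A coarse separation is in particular an \<epsilon>-separation, so scales
        above \<epsilon> cost only the constant \<open>\<epsilon> powr (- s)\<close>.\<close>
      have "separated \<epsilon> A" using A(3) False unfolding separated_def by fastforce
      then have "real (card A) \<le> (3 / 2) powr s * \<epsilon> powr (- s) * 1" using fine[of \<epsilon> A] \<epsilon> A by simp
      also have "\<dots> \<le> (3 / 2) powr s * \<epsilon> powr (- s) * r powr (- s)"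
        using \<open>1 \<le> r powr (- s)\<close> by (intro mult_left_mono) auto
      finally show ?thesis .
    qed
    then show ?thesis unfolding boxed_def by blast
  qed
  then show ?thesis using F(1) unfolding small_def by blast
qed

text \<open>The balls of a packing are sorted by the dyadic order of their radii. Disjointness makes
  the centres of order \<open>k\<close> separated by \<open>1 / 2 ^ k\<close>, so there are at most
  \<open>C * 2 powr (k * s')\<close> of them, and they contribute at most a constant times
  \<open>2 powr (k * (s' - s))\<close>. A packing of mesh \<open>2 / 2 ^ n\<close> uses only orders
  from \<open>n\<close> on, and the tail of this geometric series vanishes.\<close>

lemma boxed_imp_packing_premeasure_0:
  assumes F: "boxed s' F" and s: "0 \<le> s'" "s' < s"
  shows "packing_premeasure s F = 0"
proof -
  obtain C where C: "\<And>r A. r \<in> {0<..1} \<Longrightarrow> finite A \<Longrightarrow> A \<subseteq> F \<Longrightarrow> separated r A \<Longrightarrow> real (card A) \<le> C * r powr (- s')"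
    using F unfolding boxed_def by blast
  define q where "q = 2 powr (s' - s)"
  have q: "0 < q" "q < 1" using s by (auto simp: q_def powr_less_one)
  have C0: "0 \<le> C" using C[of 1 "{}"] by (simp add: separated_def)
  have bound: "(\<Sum>\<^sub>\<infinity>(x, r)\<in>P. ennreal ((2 * r) powr s)) \<le> ennreal (C * 2 powr s * (q ^ n / (1 - q)))"
    if P: "P \<in> packings (2 / 2 ^ n) F" for P n
  proof (rule infsum_le_finite_sums)
    show "(\<lambda>(x, r). ennreal ((2 * r) powr s)) summable_on P" by (rule nonneg_summable_on_complete) auto
    fix Q assume Q: "finite Q" "Q \<subseteq> P"
    have Qr: "x \<in> F" "0 < r" "r \<le> 1 / 2 ^ n" if "(x, r) \<in> Q" for x r
    proof -
      have "x \<in> F \<and> 0 < r \<and> 2 * r \<le> 2 / 2 ^ n" using that Q(2) P unfolding packings_def by auto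
      moreover have "2 / 2 ^ n = 2 * (1 / 2 ^ n :: real)" by simp
      ultimately show "x \<in> F" "0 < r" "r \<le> 1 / 2 ^ n" by (auto simp del: times_divide_eq_right)
    qed
    have disj: "cball x r \<inter> cball y r' = {}" if "(x, r) \<in> Q" "(y, r') \<in> Q" "(x, r) \<noteq> (y, r')" for x r y r'
    proof -
      have "disjoint_family_on (\<lambda>(x, r). cball x r) P" using P unfolding packings_def by blast
      from disjoint_family_onD[OF this, of "(x, r)" "(y, r')"] show ?thesis using that Q(2) by auto
    qed
    \<comment> \<open>The dyadic order:
      \<open>1 / 2 ^ Suc (lev r) < r \<le> 1 / 2 ^ lev r\<close>.\<close>
    define lev where "lev r = nat \<lfloor>- log 2 r\<rfloor>" for r
    have lev: "n \<le> lev r" "1 / 2 ^ Suc (lev r) < r" "r \<le> 1 / 2 ^ lev r" if "0 < r" "r \<le> 1 / 2 ^ n" for r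
    proof -
      have "log 2 r \<le> log 2 (1 / 2 ^ n)" using that by (subst log_le_cancel_iff) auto
      also have "\<dots> = - real n" by (simp add: log_divide log_nat_power)
      finally have l: "real n \<le> - log 2 r" by simp
      then show "n \<le> lev r" unfolding lev_def by (simp add: le_nat_floor)
      have f: "real (lev r) \<le> - log 2 r" "- log 2 r < real (lev r) + 1" using l unfolding lev_def by linarith+
      have r: "r = 2 powr (log 2 r)" using that by simp
      have "2 powr (log 2 r) \<le> 2 powr (- real (lev r))" using f(1) by (intro powr_mono) auto
      then show "r \<le> 1 / 2 ^ lev r" using r by (simp add: powr_minus powr_realpow divide_inverse)
      have "2 powr (- real (Suc (lev r))) < 2 powr (log 2 r)" using f(2) by (intro powr_less_mono) auto
      then show "1 / 2 ^ Suc (lev r) < r" using r by (simp only: powr_minus powr_realpow divide_inverse)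
    qed
    define m where "m = Suc (Max (insert n (lev ` snd ` Q)))"
    have lm: "lev r \<in> {n..<m}" if "(x, r) \<in> Q" for x r
    proof -
      have "lev r \<in> insert n (lev ` snd ` Q)" using that by force
      then have "lev r \<le> Max (insert n (lev ` snd ` Q))" using Q by (intro Max_ge) auto
      then show ?thesis using lev(1)[of r] Qr[OF that] by (simp add: m_def)
    qed
    have level: "(\<Sum>(x, r)\<in>{p\<in>Q. lev (snd p) = k}. (2 * r) powr s) \<le> C * 2 powr s * q ^ k" for k
    proof -
      let ?Q = "{p\<in>Q. lev (snd p) = k}"
      have Qk: "x \<in> F" "1 / 2 ^ Suc k < r" "r \<le> 1 / 2 ^ k" "(x, r) \<in> Q" if "(x, r) \<in> ?Q" for x r
        using that Qr[of x r] lev(2,3)[of r] by auto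
      \<comment> \<open>Otherwise the midpoint of the centres would lie in both balls. Equal centres
        with different radii are excluded by the same argument, which gives the injectivity
        below.\<close>
      have far: "1 / 2 ^ k \<le> \<bar>x - y\<bar>" if "(x, r) \<in> ?Q" "(y, r') \<in> ?Q" "(x, r) \<noteq> (y, r')" for x r y r'
      proof (rule ccontr)
        assume "\<not> 1 / 2 ^ k \<le> \<bar>x - y\<bar>"
        then have "\<bar>x - y\<bar> < 2 * (1 / 2 ^ Suc k)" by simp
        then have "\<bar>x - y\<bar> / 2 \<le> r" "\<bar>x - y\<bar> / 2 \<le> r'"
          using Qk(2)[OF that(1)] Qk(2)[OF that(2)] by simp_all
        moreover have "x - (x + y) / 2 = (x - y) / 2" "y - (x + y) / 2 = - ((x - y) / 2)" by (simp_all add: field_simps)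
        then have "dist x ((x + y) / 2) = \<bar>x - y\<bar> / 2" "dist y ((x + y) / 2) = \<bar>x - y\<bar> / 2"
          unfolding dist_real_def by (simp_all only: abs_minus_cancel abs_divide abs_numeral)
        ultimately have "(x + y) / 2 \<in> cball x r \<inter> cball y r'" by (simp only: mem_cball Int_iff)
        then show False using disj[OF Qk(4)[OF that(1)] Qk(4)[OF that(2)] that(3)] by blast
      qed
      have inj: "inj_on fst ?Q"
      proof (rule inj_onI)
        fix a b assume *: "a \<in> ?Q" "b \<in> ?Q" "fst a = fst b"
        show "a = b"
        proof (rule ccontr)
          assume "a \<noteq> b"
          obtain x r y r' where ab: "a = (x, r)" "b = (y, r')" by (cases a; cases b)
          have "1 / 2 ^ k \<le> \<bar>x - y\<bar>" using far[of x r y r'] *(1,2) \<open>a \<noteq> b\<close> unfolding ab by blast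
          moreover have "(0::real) < 1 / 2 ^ k" by simp
          moreover have "\<bar>x - y\<bar> = 0" using *(3) ab by simp
          ultimately show False by linarith
        qed
      qed
      have sep: "separated (1 / 2 ^ k) (fst ` ?Q)"
        unfolding separated_def
      proof (intro ballI impI)
        fix x y assume "x \<in> fst ` ?Q" "y \<in> fst ` ?Q" "x \<noteq> y"
        then obtain r r' where "(x, r) \<in> ?Q" "(y, r') \<in> ?Q" by force
        then show "1 / 2 ^ k \<le> \<bar>x - y\<bar>" using far[of x r y r'] \<open>x \<noteq> y\<close> by blast
      qed
      have "real (card ?Q) = real (card (fst ` ?Q))" by (simp add: card_image[OF inj])
      also have "\<dots> \<le> C * (1 / 2 ^ k) powr (- s')"
        using Q Qk(1) by (intro C sep) (auto simp: divide_le_eq)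
      finally have card: "real (card ?Q) \<le> C * (1 / 2 ^ k) powr (- s')" .
      have "(\<Sum>(x, r)\<in>?Q. (2 * r) powr s) \<le> (\<Sum>p\<in>?Q. (2 * (1 / 2 ^ k)) powr s)"
      proof (rule sum_mono)
        fix p assume p: "p \<in> ?Q"
        obtain x r where xr: "p = (x, r)" by (cases p)
        have "0 < r" "r \<le> 1 / 2 ^ k" using Qk[of x r] Qr[of x r] p xr by auto
        then show "(case p of (x, r) \<Rightarrow> (2 * r) powr s) \<le> (2 * (1 / 2 ^ k)) powr s"
          unfolding xr prod.case using s by (intro powr_mono2) auto
      qed
      also have "\<dots> = real (card ?Q) * (2 * (1 / 2 ^ k)) powr s" by simp
      also have "\<dots> \<le> (C * (1 / 2 ^ k) powr (- s')) * (2 * (1 / 2 ^ k)) powr s"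
        using card by (intro mult_right_mono) auto
      also have "\<dots> = C * 2 powr s * ((1 / 2 ^ k) powr (- s') * (1 / 2 ^ k) powr s)"
      proof -
        have "(2 * (1 / 2 ^ k)) powr s = 2 powr s * (1 / 2 ^ k) powr s" by (rule powr_mult)
        then show ?thesis by simp
      qed
      also have "(1 / 2 ^ k) powr (- s') * (1 / 2 ^ k) powr s = (1 / 2 ^ k) powr (s - s')"
        by (simp add: powr_add[symmetric])
      also have "\<dots> = q ^ k"
      proof -
        have "(1 / 2 ^ k :: real) = 2 powr (- real k)" by (simp add: powr_minus powr_realpow divide_inverse)
        then have "(1 / 2 ^ k) powr (s - s') = 2 powr (- real k * (s - s'))" by (simp only: powr_powr)
        also have "\<dots> = q powr (real k)" by (simp add: q_def powr_powr algebra_simps)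
        finally show ?thesis using q by (simp add: powr_realpow)
      qed
      finally show ?thesis .
    qed
    have "(\<Sum>(x, r)\<in>Q. (2 * r) powr s) = (\<Sum>k\<in>{n..<m}. \<Sum>(x, r)\<in>{p\<in>Q. lev (snd p) = k}. (2 * r) powr s)"
      using lm Q by (intro sum.group[symmetric]) auto
    also have "\<dots> \<le> (\<Sum>k\<in>{n..<m}. C * 2 powr s * q ^ k)" by (intro sum_mono level)
    also have "\<dots> = C * 2 powr s * (\<Sum>k\<in>{n..<m}. q ^ k)" by (simp add: sum_distrib_left)
    also have "\<dots> \<le> C * 2 powr s * (q ^ n / (1 - q))"
    proof (intro mult_left_mono)
      show "(\<Sum>k\<in>{n..<m}. q ^ k) \<le> q ^ n / (1 - q)"
      proof (cases "n \<le> m")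
        case True
        have "(\<Sum>k\<in>{n..<m}. q ^ k) = (q ^ n - q ^ m) / (1 - q)"
          using True
        proof (induction m rule: dec_induct)
          case (step k)
          have "(\<Sum>k\<in>{n..<Suc k}. q ^ k) = (q ^ n - q ^ k) / (1 - q) + q ^ k" using step by simp
          also have "\<dots> = (q ^ n - q ^ Suc k) / (1 - q)" using q by (simp add: field_simps)
          finally show ?case .
        qed simp
        also have "\<dots> \<le> q ^ n / (1 - q)" using q by (intro divide_right_mono) auto
        finally show ?thesis .
      qed (use q in auto)
    qed (use C0 in auto)
    finally have "(\<Sum>(x, r)\<in>Q. (2 * r) powr s) \<le> C * 2 powr s * (q ^ n / (1 - q))" .
    moreover have "(\<Sum>(x, r)\<in>Q. ennreal ((2 * r) powr s)) = ennreal (\<Sum>(x, r)\<in>Q. (2 * r) powr s)"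
      by (simp add: case_prod_beta sum_ennreal)
    ultimately show "(\<Sum>(x, r)\<in>Q. ennreal ((2 * r) powr s)) \<le> ennreal (C * 2 powr s * (q ^ n / (1 - q)))"
      by (simp add: ennreal_leI)
  qed
  have "packing_premeasure s F \<le> ennreal (C * 2 powr s * (q ^ n / (1 - q)))" for n
  proof -
    have "packing_premeasure s F \<le> (SUP P\<in>packings (2 / 2 ^ n) F. \<Sum>\<^sub>\<infinity>(x, r)\<in>P. ennreal ((2 * r) powr s))"
      unfolding packing_premeasure_def by (rule INF_lower) simp
    also have "\<dots> \<le> ennreal (C * 2 powr s * (q ^ n / (1 - q)))" by (intro SUP_least bound)
    finally show ?thesis .
  qed
  moreover have "(\<lambda>n. ennreal (C * 2 powr s * (q ^ n / (1 - q)))) \<longlonglongrightarrow> ennreal (C * 2 powr s * (0 / (1 - q)))"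
    using q by (intro tendsto_ennrealI tendsto_intros LIMSEQ_power_zero) auto
  ultimately have "packing_premeasure s F \<le> ennreal (C * 2 powr s * (0 / (1 - q)))"
    by (intro LIMSEQ_le_const) auto
  then show ?thesis by simp
qed

lemma small_imp_packing_measure_0:
  assumes E: "small s' E" and s: "0 \<le> s'" "s' < s"
  shows "packing_measure s E = 0"
proof -
  obtain F :: "nat \<Rightarrow> real set" where F: "E \<subseteq> (\<Union>i. F i)" "\<And>i. boxed s' (F i)" using E unfolding small_def by blast
  have "packing_measure s E \<le> (\<Sum>i. packing_premeasure s (F i))"
    unfolding packing_measure_def using F(1) by (intro INF_lower) auto
  also have "\<dots> = 0" using boxed_imp_packing_premeasure_0[OF F(2) s] by simp
  finally show ?thesis by simp
qed

text \<open>A violation of the capacity bound is taken with a constant \<open>C\<close> that serves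
  two purposes: \<open>2 powr s\<close> absorbs the rounding of \<open>1 / r\<close> to the integer
  \<open>m \<le> 2 / r\<close>, and \<open>k + 1\<close> forces \<open>m \<ge> k\<close>, because a
  separated subset of the unit interval has at most \<open>1 / r + 1\<close> points.\<close>

lemma not_boxed_imp_thick:
  assumes D: "D \<subseteq> {0..1}" "\<not> boxed s D" and s: "0 \<le> s"
  shows "thick s D"
  unfolding thick_def
proof
  fix k :: nat
  define C where "C = max (2 powr s) (real k + 1)"
  obtain r A where r: "r \<in> {0<..1}" and A: "finite A" "A \<subseteq> D" "separated r A" "C * r powr (- s) < real (card A)"
    using D(2) unfolding boxed_def by (auto simp: not_le dest!: spec[of _ C])
  define m where "m = nat \<lceil>1 / r\<rceil>"
  have r1: "1 \<le> 1 / r" using r by simp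
  have m: "1 / r \<le> real m" "real m \<le> 1 / r + 1" "1 \<le> real m" using r1 unfolding m_def by linarith+
  have card: "real (card A) \<le> 1 / r + 1"
  proof (cases "A = {}")
    case False
    have "inj_on (\<lambda>x. \<lfloor>x / r\<rfloor>) A"
    proof (rule inj_onI, rule ccontr)
      fix x y assume xy: "x \<in> A" "y \<in> A" "\<lfloor>x / r\<rfloor> = \<lfloor>y / r\<rfloor>" "x \<noteq> y"
      then have "\<bar>x / r - y / r\<bar> < 1" by linarith
      then have "\<bar>x - y\<bar> / r < 1" using r by (simp add: diff_divide_distrib[symmetric] abs_divide)
      then have "\<bar>x - y\<bar> < r" using r by (simp add: divide_less_eq)
      then show False using A(3) xy unfolding separated_def by fastforce
    qed
    moreover have "(\<lambda>x. \<lfloor>x / r\<rfloor>) ` A \<subseteq> {0..\<lfloor>1 / r\<rfloor>}"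
    proof
      fix z assume "z \<in> (\<lambda>x. \<lfloor>x / r\<rfloor>) ` A"
      then obtain x where x: "z = \<lfloor>x / r\<rfloor>" "x \<in> A" by auto
      then have "0 \<le> x / r" "x / r \<le> 1 / r" using A(2) D(1) r by (auto intro!: divide_right_mono divide_nonneg_pos)
      then show "z \<in> {0..\<lfloor>1 / r\<rfloor>}" unfolding x by (auto intro: floor_mono)
    qed
    ultimately have "card A \<le> card {0..\<lfloor>1 / r\<rfloor>}" by (intro card_inj_on_le) auto
    also have "\<dots> = nat (\<lfloor>1 / r\<rfloor> + 1)" by simp
    finally show ?thesis using r1 by linarith
  qed (use r1 in simp)
  have "1 \<le> r powr (- s)" using r s by (simp add: powr_minus one_le_inverse_iff powr_le1)
  then have "(real k + 1) * 1 \<le> C * r powr (- s)" by (intro mult_mono) (auto simp: C_def)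
  then have "real k + 1 \<le> C * r powr (- s)" by simp
  also have "\<dots> < real (card A)" by (rule A(4))
  also have "\<dots> \<le> 1 / r + 1" by (rule card)
  also have "\<dots> \<le> real m + 1" using m(1) by simp
  finally have "k \<le> m" by simp
  moreover have "separated (1 / real m) A"
  proof -
    have "1 / real m \<le> r" using m r by (simp add: divide_le_eq mult.commute)
    then show ?thesis using A(3) unfolding separated_def by (meson order_trans)
  qed
  moreover have "real m powr s \<le> real (card A)"
  proof -
    have "real m \<le> 2 * (1 / r)" using m r1 by linarith
    then have "real m powr s \<le> (2 * (1 / r)) powr s" using s m by (intro powr_mono2) auto
    also have "\<dots> = 2 powr s * r powr (- s)" using r by (simp add: powr_mult powr_divide powr_minus_divide)
    also have "\<dots> \<le> C * r powr (- s)" by (intro mult_right_mono) (auto simp: C_def)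
    finally show ?thesis using A(4) by simp
  qed
  moreover have "card A \<le> 2 * m"
  proof -
    have "real (card A) \<le> real (2 * m)" using card m by (simp only: of_nat_mult of_nat_numeral)
    then show ?thesis by (simp only: of_nat_le_iff)
  qed
  ultimately show "\<exists>m\<ge>k. \<exists>A. finite A \<and> A \<subseteq> D \<and> separated (1 / real m) A \<and> real m powr s \<le> real (card A) \<and> card A \<le> 2 * m"
    using A(1,2) by blast
qed

text \<open>The union of the finite witnesses is itself thick; a countable set of times keeps the
  exceedance events measurable.\<close>

lemma thick_countable_subset:
  assumes "thick s D" shows "\<exists>D'. countable D' \<and> D' \<subseteq> D \<and> thick s D'"
proof -
  obtain m A where A: "\<And>k. m k \<ge> k \<and> finite (A k) \<and> A k \<subseteq> D \<and> separated (1 / real (m k)) (A k) \<and>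
     real (m k) powr s \<le> real (card (A k)) \<and> card (A k) \<le> 2 * m k"
    using assms unfolding thick_def by metis
  have "countable (\<Union>k::nat. A k)" using A by (intro countable_UN) (auto simp: countable_finite)
  moreover have "(\<Union>k. A k) \<subseteq> D" using A by blast
  moreover have "thick s (\<Union>k. A k)" unfolding thick_def using A by (metis UN_upper UNIV_I)
  ultimately show ?thesis by blast
qed

text \<open>With exponent 0 the lower bound becomes a statement about a fixed time and reaches every
  level \<open>c < 3\<close>, whatever the dimension of the set.\<close>

lemma thick_singleton: "thick 0 {t}"
  unfolding thick_def
proof
  fix k :: nat
  show "\<exists>m\<ge>k. \<exists>A. finite A \<and> A \<subseteq> {t} \<and> separated (1 / real m) A \<and> real m powr 0 \<le> real (card A) \<and> card A \<le> 2 * m"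
    by (intro exI[of _ "Suc k"] conjI exI[of _ "{t}"]) (auto simp: separated_def)
qed

subsection \<open>Souslin sets\<close>

text \<open>Projections of closed sets along the Baire space, i.e. the Souslin sets.\<close>

definition analytic :: "real set \<Rightarrow> bool" where
  "analytic A \<longleftrightarrow> (\<exists>C :: (real \<times> (nat \<Rightarrow> nat)) set. closed C \<and> A = fst ` C)"

lemma analytic_closed: "closed A \<Longrightarrow> analytic A"
  unfolding analytic_def
  by (intro exI[of _ "A \<times> UNIV"]) (auto intro: closed_Times simp: fst_image_times)

lemma continuous_reindex:
  "continuous_on UNIV (\<lambda>p :: real \<times> (nat \<Rightarrow> nat). (fst p, \<lambda>k. snd p (f k)))"
proof (intro continuous_on_Pair continuous_on_coordinatewise_then_product)
  show "continuous_on UNIV (\<lambda>p :: real \<times> (nat \<Rightarrow> nat). snd p (f i))" for i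
    by (rule continuous_on_product_then_coordinatewise) (intro continuous_intros)
qed (intro continuous_intros)

text \<open>The first entry of the sequence selects the index of the set, the remaining entries form
  the point of the corresponding closed set.\<close>

lemma analytic_Union:
  fixes A :: "nat \<Rightarrow> real set"
  assumes "\<And>i. analytic (A i)" shows "analytic (\<Union>i. A i)"
proof -
  obtain C :: "nat \<Rightarrow> (real \<times> (nat \<Rightarrow> nat)) set" where C: "\<And>i. closed (C i)" "\<And>i. A i = fst ` (C i :: (real \<times> (nat \<Rightarrow> nat)) set)"
    using assms unfolding analytic_def by metis
  let ?f = "\<lambda>p :: real \<times> (nat \<Rightarrow> nat). (fst p, \<lambda>k. snd p (Suc k))"
  let ?g = "\<lambda>p :: real \<times> (nat \<Rightarrow> nat). snd p 0"
  define B where "B = {p. ?f p \<in> C (?g p)}"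
  have g: "continuous_on UNIV ?g"
    by (rule continuous_on_product_then_coordinatewise) (intro continuous_intros)
  \<comment> \<open>The selecting entry takes values in a discrete space, so the complement is a
    union, over the values of this entry, of open sets.\<close>
  have "open (- B)"
  proof -
    have "- B = (\<Union>i. (?g -` {i}) \<inter> (?f -` (- C i)))" by (auto simp: B_def)
    moreover have "open (?g -` {i} \<inter> ?f -` (- C i))" for i
    proof (intro open_Int open_vimage continuous_reindex g)
      show "open ({i} :: nat set)" by (simp add: Topological_Spaces.open_discrete)
      show "open (- C i)" using C(1) by (simp add: open_Compl)
    qed
    ultimately show ?thesis by auto
  qed
  then have "closed B" by (simp add: closed_def)
  moreover have "(\<Union>i. A i) = fst ` B"
  proof (intro equalityI subsetI)
    fix x assume "x \<in> (\<Union>i. A i)"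
    then obtain i z where "(x, z) \<in> C i" using C(2) by auto
    then have "(x, case_nat i z) \<in> B" by (simp add: B_def)
    then show "x \<in> fst ` B" by force
  next
    fix x assume "x \<in> fst ` B"
    then obtain z where "(x, \<lambda>k. z (Suc k)) \<in> C (z 0)" by (auto simp: B_def)
    then have "x \<in> A (z 0)" unfolding C(2) by force
    then show "x \<in> (\<Union>i. A i)" by blast
  qed
  ultimately show ?thesis unfolding analytic_def by blast
qed

text \<open>One sequence encodes infinitely many witnesses through \<open>prod_encode\<close>, one
  for each set; all of the closed conditions are imposed on it at once.\<close>

lemma analytic_Inter:
  fixes A :: "nat \<Rightarrow> real set"
  assumes "\<And>i. analytic (A i)" shows "analytic (\<Inter>i. A i)"
proof -
  obtain C :: "nat \<Rightarrow> (real \<times> (nat \<Rightarrow> nat)) set" where C: "\<And>i. closed (C i)" "\<And>i. A i = fst ` (C i :: (real \<times> (nat \<Rightarrow> nat)) set)"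
    using assms unfolding analytic_def by metis
  let ?f = "\<lambda>i (p :: real \<times> (nat \<Rightarrow> nat)). (fst p, \<lambda>k. snd p (prod_encode (i, k)))"
  define B where "B = (\<Inter>i. ?f i -` C i)"
  have "closed B" unfolding B_def using C(1) by (intro closed_INT ballI closed_vimage continuous_reindex) auto
  moreover have "(\<Inter>i. A i) = fst ` B"
  proof (intro equalityI subsetI)
    fix x assume "x \<in> (\<Inter>i. A i)"
    then have "\<forall>i. \<exists>z. (x, z) \<in> C i" using C(2) by force
    then obtain z where z: "\<And>i. (x, z i) \<in> C i" by metis
    define y where "y n = z (fst (prod_decode n)) (snd (prod_decode n))" for n
    have "(\<lambda>k. y (prod_encode (i, k))) = z i" for i by (simp add: y_def)
    then have "(x, y) \<in> B" using z by (simp add: B_def)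
    then show "x \<in> fst ` B" by force
  next
    fix x assume "x \<in> fst ` B"
    then obtain z where "\<And>i. (x, \<lambda>k. z (prod_encode (i, k))) \<in> C i" by (auto simp: B_def)
    then have "x \<in> A i" for i unfolding C(2) by force
    then show "x \<in> (\<Inter>i. A i)" by blast
  qed
  ultimately show ?thesis unfolding analytic_def by blast
qed

lemma analytic_open:
  assumes "open U" shows "analytic U"
proof -
  define F where "F n = (\<Inter>y\<in>- U. {x :: real. 1 / real (Suc n) \<le> dist x y})" for n
  have "closed (F n)" for n
    unfolding F_def by (intro closed_INT ballI closed_Collect_le continuous_intros)
  then have "analytic (\<Union>n. F n)" by (intro analytic_Union analytic_closed)
  moreover have "U = (\<Union>n. F n)"
  proof (intro equalityI subsetI)
    fix x assume "x \<in> U"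
    then obtain e where e: "e > 0" "\<And>y. dist y x < e \<Longrightarrow> y \<in> U" using assms unfolding open_dist by blast
    obtain n where "1 / real (Suc n) < e" using e(1) nat_approx_posE by blast
    then have "x \<in> F n" unfolding F_def using e(2) by (force simp: dist_commute not_less[symmetric])
    then show "x \<in> (\<Union>n. F n)" by blast
  next
    fix x assume "x \<in> (\<Union>n. F n)"
    then obtain n where n: "x \<in> F n" by blast
    show "x \<in> U"
    proof (rule ccontr)
      assume "x \<notin> U"
      then have "1 / real (Suc n) \<le> dist x x" using n unfolding F_def by blast
      then show False by simp
    qed
  qed
  ultimately show ?thesis by simp
qed

text \<open>Souslin sets are not closed under complements, so the induction carries a set together
  with its complement.\<close>

lemma borel_imp_analytic:
  fixes A :: "real set" assumes "A \<in> sets borel" shows "analytic A"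
proof -
  have "A \<in> sigma_sets UNIV {S :: real set. open S}"
    using assms by (simp add: borel_def)
  then have "analytic A \<and> analytic (- A)"
  proof induction
    case (Basic a)
    then show ?case by (auto intro: analytic_open analytic_closed)
  next
    case Empty
    then show ?case by (auto intro: analytic_closed)
  next
    case (Compl a)
    then show ?case by (simp add: Compl_eq_Diff_UNIV[symmetric])
  next
    case (Union a)
    then show ?case by (auto intro: analytic_Union simp: Compl_UN intro!: analytic_Inter)
  qed
  then show ?thesis ..
qed

subsection \<open>Exceptional times\<close>

text \<open>As in the Cantor-Bendixson argument, the basic open sets whose part of \<open>C0\<close>
  has a small projection are removed. They are countably many, so their total projection is small,
  and a basic set meeting the rest in a small portion would itself have been removed. This takes
  place in the product with the Baire space because \<open>E\<close> itself need not be
  closed.\<close>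

lemma nowhere_small_kernel:
  assumes E: "analytic E" "\<not> small s E"
  shows "\<exists>C :: (real \<times> (nat \<Rightarrow> nat)) set. closed C \<and> C \<noteq> {} \<and> fst ` C \<subseteq> E \<and>
    (\<forall>U. open U \<and> U \<inter> C \<noteq> {} \<longrightarrow> \<not> small s (fst ` (C \<inter> U)))"
proof -
  obtain C0 :: "(real \<times> (nat \<Rightarrow> nat)) set" where C0: "closed C0" "E = fst ` C0"
    using E(1) unfolding analytic_def by blast
  obtain \<B> :: "(real \<times> (nat \<Rightarrow> nat)) set set" where \<B>: "countable \<B>" "\<And>B. B \<in> \<B> \<Longrightarrow> open B"
    "\<And>S. open S \<Longrightarrow> \<exists>\<U>. \<U> \<subseteq> \<B> \<and> S = \<Union>\<U>"
    by (rule univ_second_countable) blast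
  define N where "N = {B\<in>\<B>. small s (fst ` (C0 \<inter> B))}"
  define C where "C = C0 - \<Union>N"
  have N: "countable N" using \<B>(1) unfolding N_def by (rule countable_subset[rotated]) auto
  have "small s (\<Union>B\<in>N. fst ` (C0 \<inter> B))" by (rule small_UN[OF N]) (simp add: N_def)
  then have rest: "small s (fst ` (C0 \<inter> \<Union>N))" by (rule small_mono) auto
  have "closed C" unfolding C_def using C0(1) \<B>(2) by (intro closed_Diff open_Union) (auto simp: N_def)
  moreover have "C \<noteq> {}"
  proof
    assume "C = {}"
    then have "E \<subseteq> fst ` (C0 \<inter> \<Union>N)" unfolding C0(2) C_def by blast
    then show False using E(2) small_mono[OF rest] by blast
  qed
  moreover have "fst ` C \<subseteq> E" unfolding C0(2) C_def by blast
  moreover have "\<not> small s (fst ` (C \<inter> U))" if U: "open U" "U \<inter> C \<noteq> {}" for U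
  proof
    assume sm: "small s (fst ` (C \<inter> U))"
    obtain x where x: "x \<in> U" "x \<in> C" using U by blast
    obtain B where B: "B \<in> \<B>" "x \<in> B" "B \<subseteq> U" using \<B>(3)[OF U(1)] x(1) by blast
    have "fst ` (C0 \<inter> B) \<subseteq> fst ` (C \<inter> U) \<union> fst ` (C0 \<inter> \<Union>N)" using B(3) unfolding C_def by blast
    then have "small s (fst ` (C0 \<inter> B))" using small_Un[OF sm rest] small_mono by blast
    then have "B \<in> N" using B(1) by (simp add: N_def)
    then show False using x(2) B(2) unfolding C_def by blast
  qed
  ultimately show ?thesis by blast
qed

lemma completely_metrizable_Baire_space_real:
  "completely_metrizable_space (euclidean :: (real \<times> (nat \<Rightarrow> nat)) topology)"
proof -
  have nat: "(euclidean :: nat topology) = discrete_topology UNIV"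
    by (simp add: topology_eq Topological_Spaces.open_discrete)
  have "completely_metrizable_space (euclidean :: (nat \<Rightarrow> nat) topology)"
    unfolding euclidean_product_topology[symmetric]
    by (simp add: completely_metrizable_space_product_topology nat completely_metrizable_space_discrete_topology)
  then have "completely_metrizable_space (prod_topology (euclidean :: real topology) (euclidean :: (nat \<Rightarrow> nat) topology))"
    by (intro completely_metrizable_space_prod_topology[THEN iffD2] disjI2 conjI completely_metrizable_space_euclidean)
  then show ?thesis by simp
qed

lemma Baire_closed:
  fixes C :: "'a :: topological_space set" and G :: "nat \<Rightarrow> 'a set"
  assumes X: "completely_metrizable_space (euclidean :: 'a topology)" and C: "closed C" "C \<noteq> {}"
    and G: "\<And>m. openin (top_of_set C) (G m)" "\<And>m U. open U \<Longrightarrow> U \<inter> C \<noteq> {} \<Longrightarrow> U \<inter> G m \<noteq> {}"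
  shows "\<exists>x\<in>C. \<forall>m. x \<in> G m"
proof -
  have sub: "G m \<subseteq> C" for m using openin_imp_subset[OF G(1)] .
  have "completely_metrizable_space (top_of_set C)"
    by (intro completely_metrizable_space_closedin X) (use C in simp)
  then have "top_of_set C closure_of \<Inter>(range G) = topspace (top_of_set C)"
  proof (intro Baire_category disjI1)
    fix T assume "T \<in> range G"
    then obtain m where T: "T = G m" by blast
    have "C \<subseteq> closure (G m)"
      unfolding closure_iff_nhds_not_empty subset_iff
      using G(2)[of _ m] by (metis (no_types, opaque_lifting) IntI disjoint_iff empty_iff interior_subset open_interior subset_iff)
    then show "openin (top_of_set C) T \<and> top_of_set C closure_of T = topspace (top_of_set C)"
      using G(1) sub[of m] unfolding T by (auto simp: closure_of_subtopology Int_absorb1)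
  qed auto
  then have "C = {}" if "C \<inter> \<Inter>(range G) = {}" using that by (simp add: closure_of_subtopology)
  then have "C \<inter> \<Inter>(range G) \<noteq> {}" using C(2) by blast
  then show ?thesis by blast
qed

context gaussian_dynamics
begin

lemma S_locally_constant:
  assumes "\<forall>i. \<exists>e>0. \<forall>u\<ge>0. \<bar>u - t\<bar> < e \<longrightarrow> X i u \<omega> = X i t \<omega>"
  shows "\<exists>e>0. \<forall>u\<ge>0. \<bar>u - t\<bar> < e \<longrightarrow> S n u \<omega> = S n t \<omega>"
proof (induction n)
  case 0
  then show ?case by (auto simp: S_def intro: exI[of _ 1])
next
  case (Suc n)
  then obtain e where e: "e > 0" "\<And>u. 0 \<le> u \<Longrightarrow> \<bar>u - t\<bar> < e \<Longrightarrow> S n u \<omega> = S n t \<omega>" by blast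
  obtain e' where e': "e' > 0" "\<And>u. 0 \<le> u \<Longrightarrow> \<bar>u - t\<bar> < e' \<Longrightarrow> X n u \<omega> = X n t \<omega>" using assms by blast
  have "S (Suc n) u \<omega> = S (Suc n) t \<omega>" if "0 \<le> u" "\<bar>u - t\<bar> < min e e'" for u
    using e(2)[of u] e'(2)[of u] that by (auto simp: S_def)
  moreover have "min e e' > 0" using e e' by simp
  ultimately show ?case by blast
qed

text \<open>
  The random sets of those points of the kernel at which the barrier is exceeded after time \<open>m\<close> are relatively
  open up to the jump times, and they are dense by the lower bound; hence Baire's theorem applies.
\<close>

theorem exceptional_time_AE:
  assumes E: "analytic E" "E \<subseteq> {0..1}" "\<not> small s E" and s: "0 \<le> s" and c: "0 < c" "c < 3 + 2 * s"
  shows "AE \<omega> in M. \<exists>t\<in>E. \<forall>m. \<exists>n\<ge>m. sqrt (real n * barrier c n) < S n t \<omega>"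
proof -
  obtain C :: "(real \<times> (nat \<Rightarrow> nat)) set" where C: "closed C" "C \<noteq> {}" "fst ` C \<subseteq> E"
    "\<And>U. open U \<Longrightarrow> U \<inter> C \<noteq> {} \<Longrightarrow> \<not> small s (fst ` (C \<inter> U))"
    using nowhere_small_kernel[OF E(1,3)] by blast
  obtain \<B> :: "(real \<times> (nat \<Rightarrow> nat)) set set" where \<B>: "countable \<B>" "\<And>B. B \<in> \<B> \<Longrightarrow> open B"
    "\<And>S. open S \<Longrightarrow> \<exists>\<U>. \<U> \<subseteq> \<B> \<and> S = \<Union>\<U>"
    by (rule univ_second_countable) blast
  define \<B>' where "\<B>' = {B\<in>\<B>. B \<inter> C \<noteq> {}}"
  have \<B>'c: "countable \<B>'" using \<B>(1) unfolding \<B>'_def by (rule countable_subset[rotated]) auto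
  have "\<exists>D. countable D \<and> D \<subseteq> fst ` (C \<inter> B) \<and> thick s D" if "B \<in> \<B>'" for B
  proof -
    have "\<not> boxed s (fst ` (C \<inter> B))"
      using C(4)[of B] \<B>(2)[of B] that boxed_imp_small by (auto simp: \<B>'_def)
    moreover have "fst ` (C \<inter> B) \<subseteq> {0..1}" using C(3) E(2) by blast
    ultimately have "thick s (fst ` (C \<inter> B))" by (intro not_boxed_imp_thick s)
    then show ?thesis by (rule thick_countable_subset)
  qed
  then obtain D where D: "\<And>B. B \<in> \<B>' \<Longrightarrow> countable (D B) \<and> D B \<subseteq> fst ` (C \<inter> B) \<and> thick s (D B)"
    by metis
  have D01: "D B \<subseteq> {0..1}" if "B \<in> \<B>'" for B using D[OF that] C(3) E(2) by blast
  \<comment> \<open>Countably many basic sets leave a single null set outside of which every portion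
    of the kernel contains an exceedance beyond every \<open>m\<close>; this is the density required
    by Baire's theorem.\<close>
  have "AE \<omega> in M. \<forall>B\<in>\<B>'. \<forall>m. \<exists>n\<ge>m. \<exists>t\<in>D B. sqrt (real n * barrier c n) < S n t \<omega>"
    using D D01 by (intro AE_ball_countable[THEN iffD2] \<B>'c ballI lower_bound_AE[OF _ _ _ s c]) auto
  \<comment> \<open>No clock jumps at any of the countably many times in the sets
    \<open>D B\<close>, so an exceedance there persists in a neighbourhood.\<close>
  moreover have "AE \<omega> in M. \<forall>t\<in>(\<Union>B\<in>\<B>'. D B). \<forall>i. \<exists>e>0. \<forall>u\<ge>0. \<bar>u - t\<bar> < e \<longrightarrow> X i u \<omega> = X i t \<omega>"
  proof (subst AE_ball_countable)
    show "countable (\<Union>B\<in>\<B>'. D B)" using \<B>'c D by (intro countable_UN) auto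
    show "\<forall>t\<in>(\<Union>B\<in>\<B>'. D B). AE \<omega> in M. \<forall>i. \<exists>e>0. \<forall>u\<ge>0. \<bar>u - t\<bar> < e \<longrightarrow> X i u \<omega> = X i t \<omega>"
    proof
      fix t assume "t \<in> (\<Union>B\<in>\<B>'. D B)"
      then have "0 \<le> t" using D01 by fastforce
      then show "AE \<omega> in M. \<forall>i. \<exists>e>0. \<forall>u\<ge>0. \<bar>u - t\<bar> < e \<longrightarrow> X i u \<omega> = X i t \<omega>" by (rule locally_constant)
    qed
  qed
  ultimately show ?thesis
  proof eventually_elim
    case (elim \<omega>)
    \<comment> \<open>Only points are kept at which the same \<open>n\<close> works on a whole
      relative neighbourhood; thus \<open>G m\<close> is relatively open by construction.\<close>
    define G where "G m = {x\<in>C. \<exists>n\<ge>m. \<exists>V. open V \<and> x \<in> V \<and> (\<forall>y\<in>V \<inter> C. sqrt (real n * barrier c n) < S n (fst y) \<omega>)}" for m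
    have "\<exists>x\<in>C. \<forall>m. x \<in> G m"
    proof (rule Baire_closed[OF completely_metrizable_Baire_space_real C(1,2)])
      fix m
      have "G m = C \<inter> \<Union>{V. open V \<and> (\<exists>n\<ge>m. \<forall>y\<in>V \<inter> C. sqrt (real n * barrier c n) < S n (fst y) \<omega>)}"
        unfolding G_def by blast
      then show "openin (top_of_set C) (G m)" unfolding openin_open by (intro exI conjI) auto
    next
      fix m and U :: "(real \<times> (nat \<Rightarrow> nat)) set" assume U: "open U" "U \<inter> C \<noteq> {}"
      then obtain x where x: "x \<in> U" "x \<in> C" by blast
      obtain B where B: "B \<in> \<B>" "x \<in> B" "B \<subseteq> U" using \<B>(3)[OF U(1)] x(1) by blast
      then have B': "B \<in> \<B>'" using x by (auto simp: \<B>'_def)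
      then obtain n t where nt: "n \<ge> m" "t \<in> D B" "sqrt (real n * barrier c n) < S n t \<omega>" using elim(1) by blast
      then obtain z where z: "z \<in> C" "z \<in> B" "t = fst z" using D[OF B'] by blast
      have "\<forall>i. \<exists>e>0. \<forall>u\<ge>0. \<bar>u - t\<bar> < e \<longrightarrow> X i u \<omega> = X i t \<omega>" using elim(2) nt(2) B' by blast
      then obtain e where e: "e > 0" "\<And>u. 0 \<le> u \<Longrightarrow> \<bar>u - t\<bar> < e \<Longrightarrow> S n u \<omega> = S n t \<omega>"
        using S_locally_constant by blast
      define V where "V = fst -` ball t e \<inter> (UNIV :: (real \<times> (nat \<Rightarrow> nat)) set)"
      have "open V" unfolding V_def by (intro open_Int open_vimage_fst) auto
      moreover have "z \<in> V" using e(1) z by (simp add: V_def)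
      moreover have "sqrt (real n * barrier c n) < S n (fst y) \<omega>" if "y \<in> V \<inter> C" for y
      proof -
        have "0 \<le> fst y" using that C(3) E(2) by force
        moreover have "\<bar>fst y - t\<bar> < e" using that by (auto simp: V_def dist_real_def)
        ultimately show ?thesis using e(2) nt(3) by simp
      qed
      ultimately have "z \<in> G m" unfolding G_def using z(1) nt(1) by blast
      then show "U \<inter> G m \<noteq> {}" using B(3) z(2) by blast
    qed
    then obtain x where x: "x \<in> C" "\<And>m. x \<in> G m" by blast
    have "\<exists>n\<ge>m. sqrt (real n * barrier c n) < S n (fst x) \<omega>" for m
      using x(2)[of m] x(1) unfolding G_def by blast
    moreover have "fst x \<in> E" using x(1) C(3) by blast
    ultimately show ?case by blast
  qed
qed

end

text \<open>For \<open>c > 0\<close> the barrier is eventually nonnegative, so an exceedance may be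
  squared. Infinitely many exceedances bound the limes superior from below.\<close>

lemma less_limsup_ratio:
  assumes "0 < c" "\<forall>m. \<exists>n\<ge>m. sqrt (real n * barrier c n) < x n"
  shows "ereal c \<le> limsup (\<lambda>n. ereal (((x n)\<^sup>2 - 2 * real n * ln (ln (real n))) / (real n * ln (ln (ln (real n))))))"
proof -
  have "eventually (\<lambda>n. 0 < real n * ln (ln (ln (real n)))) sequentially"
    "eventually (\<lambda>n. 0 < ln (ln (real n))) sequentially" by real_asymp+
  then have ev: "eventually (\<lambda>n. 0 < real n * ln (ln (ln (real n))) \<and> 0 < ln (ln (real n))) sequentially"
    by (rule eventually_conj)
  have "frequently (\<lambda>n. sqrt (real n * barrier c n) < x n) sequentially"
    using assms(2) by (simp add: frequently_sequentially)
  then have "frequently (\<lambda>n. ereal c \<le> ereal (((x n)\<^sup>2 - 2 * real n * ln (ln (real n))) / (real n * ln (ln (ln (real n)))))) sequentially"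
  proof (rule frequently_rev_mp)
    show "eventually (\<lambda>n. sqrt (real n * barrier c n) < x n \<longrightarrow>
      ereal c \<le> ereal (((x n)\<^sup>2 - 2 * real n * ln (ln (real n))) / (real n * ln (ln (ln (real n)))))) sequentially"
      using ev
    proof eventually_elim
      case (elim n)
      show ?case
      proof
        assume *: "sqrt (real n * barrier c n) < x n"
        have "0 < real n" using elim by (cases "n = 0") auto
        then have l: "0 < ln (ln (ln (real n)))" using elim by (simp add: zero_less_mult_iff)
        have b: "real n * barrier c n = 2 * real n * ln (ln (real n)) + c * (real n * ln (ln (ln (real n))))"
          by (simp add: barrier_def algebra_simps)
        have "0 \<le> real n * barrier c n" unfolding b using elim assms(1) l by (intro add_nonneg_nonneg mult_nonneg_nonneg) auto
        then have "real n * barrier c n = (sqrt (real n * barrier c n))\<^sup>2" by simp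
        also have "\<dots> \<le> (x n)\<^sup>2" using * \<open>0 \<le> real n * barrier c n\<close> by (intro power_mono) auto
        finally show "ereal c \<le> ereal (((x n)\<^sup>2 - 2 * real n * ln (ln (real n))) / (real n * ln (ln (ln (real n)))))"
          using elim unfolding b by (simp add: le_divide_eq)
      qed
    qed
  qed
  note freq = this
  show ?thesis
  proof (rule ccontr)
    assume "\<not> ?thesis"
    then have "eventually (\<lambda>n. ereal (((x n)\<^sup>2 - 2 * real n * ln (ln (real n))) / (real n * ln (ln (ln (real n))))) < ereal c) sequentially"
      by (intro Limsup_lessD) (simp add: not_le)
    then show False using freq unfolding frequently_def by (simp add: not_le)
  qed
qed

text \<open>A bound on the square requires the barrier for the walk and for its negative.\<close>

lemma limsup_ratio_le:
  assumes "eventually (\<lambda>n. x n \<le> sqrt (real n * barrier c n)) sequentially"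
    and "eventually (\<lambda>n. - x n \<le> sqrt (real n * barrier c n)) sequentially" and "0 < c"
  shows "limsup (\<lambda>n. ereal (((x n)\<^sup>2 - 2 * real n * ln (ln (real n))) / (real n * ln (ln (ln (real n)))))) \<le> ereal c"
proof (rule Limsup_bounded)
  have "eventually (\<lambda>n. 0 < real n * ln (ln (ln (real n)))) sequentially"
    "eventually (\<lambda>n. 0 \<le> real n * barrier c n) sequentially"
    using assms(3) unfolding barrier_def by real_asymp+
  with assms(1,2) show "eventually (\<lambda>n. ereal (((x n)\<^sup>2 - 2 * real n * ln (ln (real n))) / (real n * ln (ln (ln (real n))))) \<le> ereal c) sequentially"
  proof eventually_elim
    case (elim n)
    have b: "real n * barrier c n = 2 * real n * ln (ln (real n)) + c * (real n * ln (ln (ln (real n))))"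
      by (simp add: barrier_def algebra_simps)
    have "\<bar>x n\<bar> \<le> sqrt (real n * barrier c n)" using elim by (simp add: abs_le_iff)
    then have "\<bar>x n\<bar>\<^sup>2 \<le> (sqrt (real n * barrier c n))\<^sup>2" by (intro power_mono) auto
    then have "(x n)\<^sup>2 \<le> real n * barrier c n" using elim by simp
    then show ?case using elim unfolding b by (simp add: divide_le_eq)
  qed
qed

section \<open>Assembly: the given walk, rational levels and the packing dimension\<close>

context normal_walk
begin

lemma dyn_walk_eq: "dyn_walk \<xi> \<tau> n t \<omega> = S n t \<omega>"
  unfolding dyn_walk_def S_def by (rule sum.reindex_bij_witness[where i=Suc and j="\<lambda>i. i - 1"]) auto

end

lemma packing_dim_less:
  assumes "packing_dim E < ereal s"
  obtains s' where "0 \<le> s'" "s' < s" "packing_measure s' E = 0"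
  using assms unfolding packing_dim_def INF_less_iff by auto

lemma packing_dim_le:
  assumes "0 \<le> s" "packing_measure s E = 0" shows "packing_dim E \<le> ereal s"
  unfolding packing_dim_def using assms by (intro INF_lower) auto

lemma packing_dim_nonneg: "0 \<le> packing_dim E"
  unfolding packing_dim_def by (intro INF_greatest) auto

theorem mainTheorem7:
  fixes M :: "'w measure"
    and \<xi> \<tau> :: "nat \<Rightarrow> nat \<Rightarrow> 'w \<Rightarrow> real"
    and E :: "real set"
  assumes "dynamical_walk M std_normal_distribution \<xi> \<tau>"
    and "E \<in> sets borel" and "E \<noteq> {}" and "E \<subseteq> {0..1}"
  shows "AE \<omega> in M.
    (SUP t\<in>E. limsup (\<lambda>n. ereal
        (((dyn_walk \<xi> \<tau> n t \<omega>)\<^sup>2 - 2 * real n * ln (ln (real n)))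
          / (real n * ln (ln (ln (real n)))))))
    = 3 + 2 * packing_dim E"
proof -
  interpret normal_walk M \<xi> \<tau> using assms(1) by (simp add: normal_walk_def)
  \<comment> \<open>The negated walk provides the lower barrier.\<close>
  interpret neg: normal_walk M "\<lambda>n k \<omega>. - \<xi> n k \<omega>" \<tau> by (rule normal_walk_uminus)
  have negS: "neg.S n t \<omega> = - S n t \<omega>" for n t \<omega>
    unfolding neg.S_def S_def by (simp add: dyn_increment_def sum_negf)
  let ?L = "\<lambda>\<omega> t. limsup (\<lambda>n. ereal (((dyn_walk \<xi> \<tau> n t \<omega>)\<^sup>2 - 2 * real n * ln (ln (real n))) / (real n * ln (ln (ln (real n))))))"
  let ?d = "3 + 2 * packing_dim E"
  have upper: "AE \<omega> in M. \<forall>t\<in>E. ?L \<omega> t \<le> ereal c" if c: "?d < ereal c" for c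
  proof -
    have "packing_dim E < ereal ((c - 3) / 2)"
      using c packing_dim_nonneg[of E] by (cases "packing_dim E") auto
    then obtain s where s: "0 \<le> s" "s < (c - 3) / 2" "packing_measure s E = 0" by (rule packing_dim_less)
    have sc: "3 + 2 * s < c" "0 < c" using s by auto
    obtain F :: "nat \<Rightarrow> real set" where F: "E \<subseteq> (\<Union>i. F i)" "\<And>i. boxed s (F i)"
      using packing_measure_0_imp_small[OF s(3,1)] unfolding small_def by blast
    have Fb: "F i \<inter> E \<subseteq> {0..1}" "boxed s (F i \<inter> E)" for i using assms(4) boxed_mono[OF F(2) Int_lower1] by auto
    have "AE \<omega> in M. \<forall>i. eventually (\<lambda>n. \<forall>t\<in>F i \<inter> E. S n t \<omega> \<le> sqrt (real n * barrier c n)) sequentially"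
      unfolding AE_all_countable using upper_bound_AE[OF Fb s(1) sc(1)] by blast
    moreover have "AE \<omega> in M. \<forall>i. eventually (\<lambda>n. \<forall>t\<in>F i \<inter> E. neg.S n t \<omega> \<le> sqrt (real n * barrier c n)) sequentially"
      unfolding AE_all_countable using neg.upper_bound_AE[OF Fb s(1) sc(1)] by blast
    ultimately show ?thesis
    proof eventually_elim
      case (elim \<omega>)
      show ?case
      proof
        fix t assume t: "t \<in> E"
        then obtain i where i: "t \<in> F i \<inter> E" using F(1) by blast
        show "?L \<omega> t \<le> ereal c"
          unfolding dyn_walk_eq
        proof (rule limsup_ratio_le[OF _ _ sc(2)])
          show "eventually (\<lambda>n. S n t \<omega> \<le> sqrt (real n * barrier c n)) sequentially"
            using elim(1)[rule_format, of i] by (rule eventually_mono) (use i in blast)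
          show "eventually (\<lambda>n. - S n t \<omega> \<le> sqrt (real n * barrier c n)) sequentially"
            using elim(2)[rule_format, of i] unfolding negS by (rule eventually_mono) (use i in blast)
        qed
      qed
    qed
  qed
  have lower: "AE \<omega> in M. \<exists>t\<in>E. ereal c \<le> ?L \<omega> t" if c: "0 < c" "ereal c < ?d" for c
  proof -
    have "AE \<omega> in M. \<exists>t\<in>E. \<forall>m. \<exists>n\<ge>m. sqrt (real n * barrier c n) < S n t \<omega>"
    proof (cases "c < 3")
      case True
      obtain t where t: "t \<in> E" using assms(3) by blast
      have "AE \<omega> in M. \<forall>m. \<exists>n\<ge>m. \<exists>t\<in>{t}. sqrt (real n * barrier c n) < S n t \<omega>"
        using t assms(4) True by (intro lower_bound_AE[OF _ _ thick_singleton _ c(1)]) auto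
      then show ?thesis by eventually_elim (use t in auto)
    next
      case False
      \<comment> \<open>Two exponents are inserted: \<open>s\<close> has to satisfy
        \<open>c < 3 + 2 * s\<close>, and \<open>s' > s\<close> is needed because
        \<open>small s E\<close> gives packing measure zero only at exponents above
        \<open>s\<close>.\<close>
      have "ereal ((c - 3) / 2) < packing_dim E" using c by (cases "packing_dim E") auto
      then obtain s where s: "ereal ((c - 3) / 2) < ereal s" "ereal s < packing_dim E"
        using ereal_dense2 by blast
      obtain s' where s': "ereal s < ereal s'" "ereal s' < packing_dim E"
        using ereal_dense2[OF s(2)] by blast
      have s0: "0 \<le> s" "c < 3 + 2 * s" using s(1) False by auto
      have "\<not> small s E"
        using small_imp_packing_measure_0[of s E s'] packing_dim_le[of s' E] s0 s' by auto
      then show ?thesis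
        by (intro exceptional_time_AE[OF borel_imp_analytic[OF assms(2)] assms(4) _ s0(1) c(1) s0(2)])
    qed
    then show ?thesis
    proof eventually_elim
      case (elim \<omega>)
      then obtain t where "t \<in> E" "\<forall>m. \<exists>n\<ge>m. sqrt (real n * barrier c n) < S n t \<omega>" by blast
      then show ?case
        unfolding dyn_walk_eq using less_limsup_ratio[OF c(1), of "\<lambda>n. S n t \<omega>"] by blast
    qed
  qed
  \<comment> \<open>Rational levels combine the one-level statements into a single almost sure
    event.\<close>
  have "AE \<omega> in M. \<forall>q\<in>\<rat>. (?d < ereal q \<longrightarrow> (\<forall>t\<in>E. ?L \<omega> t \<le> ereal q)) \<and> (0 < q \<and> ereal q < ?d \<longrightarrow> (\<exists>t\<in>E. ereal q \<le> ?L \<omega> t))"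
  proof (subst AE_ball_countable)
    show "countable (\<rat> :: real set)" unfolding Rats_def by simp
    show "\<forall>q\<in>\<rat>. AE \<omega> in M. (?d < ereal q \<longrightarrow> (\<forall>t\<in>E. ?L \<omega> t \<le> ereal q)) \<and> (0 < q \<and> ereal q < ?d \<longrightarrow> (\<exists>t\<in>E. ereal q \<le> ?L \<omega> t))"
      using upper lower by (auto simp: AE_conj_iff)
  qed
  then show ?thesis
  proof eventually_elim
    case (elim \<omega>)
    show ?case
    proof (rule antisym)
      show "(SUP t\<in>E. ?L \<omega> t) \<le> ?d"
      proof (rule dense_ge)
        fix x assume "?d < x"
        then obtain q :: real where q: "q \<in> \<rat>" "?d < ereal q" "ereal q < x"
          using ereal_dense3[of ?d x] by (auto simp: Rats_def)
        then have "(SUP t\<in>E. ?L \<omega> t) \<le> ereal q" using elim by (intro SUP_least) blast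
        then show "(SUP t\<in>E. ?L \<omega> t) \<le> x" using q(3) by (meson less_imp_le order_trans)
      qed
      \<comment> \<open>The lower bound is available at positive levels only; since the claimed
        value is positive, levels between \<open>max x 0\<close> and it suffice.\<close>
      have d0: "0 < ?d" using packing_dim_nonneg[of E] by (cases "packing_dim E") auto
      show "?d \<le> (SUP t\<in>E. ?L \<omega> t)"
      proof (rule dense_le)
        fix x assume "x < ?d"
        then have "max x 0 < ?d" using d0 by simp
        then obtain r where "max x 0 < ereal (real_of_rat r)" "ereal (real_of_rat r) < ?d"
          using ereal_dense3[of "max x 0" ?d] by blast
        moreover define q where "q = real_of_rat r"
        ultimately have q: "q \<in> \<rat>" "max x 0 < ereal q" "ereal q < ?d" by simp_all
        have "0 < q" using q(2) by simp
        then obtain t where "t \<in> E" "ereal q \<le> ?L \<omega> t" using elim q by blast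
        then have "ereal q \<le> (SUP t\<in>E. ?L \<omega> t)" by (meson SUP_upper order_trans)
        then show "x \<le> (SUP t\<in>E. ?L \<omega> t)" using q(2) by (meson less_imp_le max.strict_boundedE order_trans)
      qed
    qed
  qed
qed

end
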